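(* Any monoidal category $(\mathcal{C}, \otimes, I)$ gives rise to a free autonomous category $(L(\mathcal{C}), (\_,\_), ())$, where $(\_,\_)$ denotes the monoidal product of $L(\mathcal{C})$ and $()$ its unit. The embedding functor $F : \mathcal{C} \to L(\mathcal{C})$ is strong monoidal and faithful. Here "free" means the following. Let $\mathbf{Mon}$ be the category of monoidal categories and strong monoidal functors, let $\mathbf{Nom}$ be the category of autonomous categories and strong monoidal functors, and let $R : \mathbf{Nom} \to \mathbf{Mon}$ be the inclusion functor. Then $\mathcal{C} \mapsto L(\mathcal{C})$ is the object part of a functor $L : \mathbf{Mon} \to \mathbf{Nom}$ that is left adjoint to $R$, and the unit of this adjunction at $\mathcal{C}$ is the embedding functor $F : \mathcal{C} \to R L(\mathcal{C})$.
   Context: Monoidal categories are taken to be strict and are not assumed symmetric or braided. A strong monoidal functor is a functor $G$ equipped with coherent natural isomorphisms $G(A) \otimes G(B) \cong G(A \otimes B)$ and an isomorphism $I \cong G(I)$. An autonomous (or rigid) category is a monoidal category in which every object $A$ has a left adjoint $A^l$ and a right adjoint $A^r$, meaning that there are morphisms $\epsilon_l : A^l \otimes A \to I$, $\eta_l : I \to A \otimes A^l$, $\epsilon_r : A \otimes A^r \to I$, $\eta_r : I \to A^r \otimes A$ satisfying the usual yanking (snake) equations. Strong monoidal functors automatically preserve adjoints. "Left adjoint" is meant in the ordinary (1-categorical) sense: there are a unit $\eta : 1 \to RL$ and a counit $\epsilon : LR \to 1$ with $(R\epsilon)\circ(\eta R) = 1_R$ and $(\epsilon L)\circ(L\eta)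 = 1_L$. Concretely, the objects of $L(\mathcal{C})$ are finite lists $(A_1^{n_1}, \dots, A_p^{n_p})$ with $A_i$ objects of $\mathcal{C}$ and $n_i \in \mathbb{Z}$ (the integer $n_i$ recording a formal iterated adjoint). The monoidal product on objects is concatenation of lists and the unit is the empty list $()$. Morphisms are equivalence classes of planar string diagrams, with formal cups and caps, whose nodes are labelled by morphisms of $\mathcal{C}$. The equivalence is generated by deformation of diagrams and by the identifications that replace two vertically stacked nodes $f, g$ by a node $g \circ f$, two adjacent nodes $f, g$ by a node $f \otimes g$, and a node $1_A$ by a plain wire. The functor $F$ sends an object $A$ to the one-element list $(A^0)$ and a morphism $f$ to the diagram with the single node $f$.
   Formalization: Factorization through F is never strictly unique (functors to the codiscrete category on Z/2 may differ only at ()), so naturality of the counit and the triangle (εL)∘(Lη)=1 are proved only up to invertible monoidal natural transformation; the other adjunction laws are strict equalities. *)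

theory Defs
  imports Main
begin

section \<open>Strict monoidal categories and autonomous categories\<close>

record ('o, 'm) moncat =
  Obj :: "'o set"
  Arr :: "'m set"
  Dom :: "'m \<Rightarrow> 'o"
  Cod :: "'m \<Rightarrow> 'o"
  Idt :: "'o \<Rightarrow> 'm"
  Comp :: "'m \<Rightarrow> 'm \<Rightarrow> 'm" (infixr "\<cdot>\<index>" 65)
  TensO :: "'o \<Rightarrow> 'o \<Rightarrow> 'o" (infixr "\<odot>\<index>" 75)
  Tens :: "'m \<Rightarrow> 'm \<Rightarrow> 'm" (infixr "\<otimes>\<index>" 75)
  Unit :: "'o" ("\<one>\<index>")

definition hom :: "('o, 'm) moncat \<Rightarrow> 'o \<Rightarrow> 'o \<Rightarrow> 'm set" where
  "hom C A B = {f \<in> Arr C. Dom C f = A \<and> Cod C f = B}"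

locale strict_monoidal_category =
  fixes C :: "('o, 'm) moncat" (structure)
  assumes dom_obj: "f \<in> Arr C \<Longrightarrow> Dom C f \<in> Obj C"
    and cod_obj: "f \<in> Arr C \<Longrightarrow> Cod C f \<in> Obj C"
    and idt_hom: "A \<in> Obj C \<Longrightarrow> Idt C A \<in> hom C A A"
    and comp_hom: "\<lbrakk>f \<in> hom C A B; g \<in> hom C B E\<rbrakk> \<Longrightarrow> g \<cdot> f \<in> hom C A E"
    and comp_idt: "f \<in> hom C A B \<Longrightarrow> f \<cdot> Idt C A = f"
    and idt_comp: "f \<in> hom C A B \<Longrightarrow> Idt C B \<cdot> f = f"
    and comp_assoc: "\<lbrakk>f \<in> hom C A B; g \<in> hom C B E; h \<in> hom C E E'\<rbrakk>
          \<Longrightarrow> (h \<cdot> g) \<cdot> f = h \<cdot> (g \<cdot> f)"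
    and unit_obj: "\<one> \<in> Obj C"
    and tensO_obj: "\<lbrakk>A \<in> Obj C; B \<in> Obj C\<rbrakk> \<Longrightarrow> A \<odot> B \<in> Obj C"
    and tensO_assoc: "\<lbrakk>A \<in> Obj C; B \<in> Obj C; E \<in> Obj C\<rbrakk>
          \<Longrightarrow> (A \<odot> B) \<odot> E = A \<odot> (B \<odot> E)"
    and unit_tensO: "A \<in> Obj C \<Longrightarrow> \<one> \<odot> A = A"
    and tensO_unit: "A \<in> Obj C \<Longrightarrow> A \<odot> \<one> = A"
    and tens_hom: "\<lbrakk>f \<in> hom C A B; f' \<in> hom C A' B'\<rbrakk>
          \<Longrightarrow> f \<otimes> f' \<in> hom C (A \<odot> A') (B \<odot> B')"
    and tens_idt: "\<lbrakk>A \<in> Obj C; B \<in> Obj C\<rbrakk> \<Longrightarrow> Idt C A \<otimes> Idt C B = Idt C (A \<odot> B)"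
    and interchange: "\<lbrakk>f \<in> hom C A B; g \<in> hom C B E; f' \<in> hom C A' B'; g' \<in> hom C B' E'\<rbrakk>
          \<Longrightarrow> (g \<cdot> f) \<otimes> (g' \<cdot> f') = (g \<otimes> g') \<cdot> (f \<otimes> f')"
    and tens_assoc: "\<lbrakk>f \<in> Arr C; g \<in> Arr C; h \<in> Arr C\<rbrakk>
          \<Longrightarrow> (f \<otimes> g) \<otimes> h = f \<otimes> (g \<otimes> h)"
    and unit_tens: "f \<in> Arr C \<Longrightarrow> Idt C \<one> \<otimes> f = f"
    and tens_unit: "f \<in> Arr C \<Longrightarrow> f \<otimes> Idt C \<one> = f"

text \<open>\<open>adjoint_pair C X A e h\<close>: the object \<open>X\<close> is left adjoint to \<open>A\<close>, equivalently \<open>A\<close> is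
  right adjoint to \<open>X\<close>, with counit \<open>e\<close> and unit \<open>h\<close>.\<close>

definition adjoint_pair :: "('o, 'm) moncat \<Rightarrow> 'o \<Rightarrow> 'o \<Rightarrow> 'm \<Rightarrow> 'm \<Rightarrow> bool" where
  "adjoint_pair C X A e h \<longleftrightarrow>
     X \<in> Obj C \<and> A \<in> Obj C \<and>
     e \<in> hom C (X \<odot>\<^bsub>C\<^esub> A) \<one>\<^bsub>C\<^esub> \<and> h \<in> hom C \<one>\<^bsub>C\<^esub> (A \<odot>\<^bsub>C\<^esub> X) \<and>
     (Idt C A \<otimes>\<^bsub>C\<^esub> e) \<cdot>\<^bsub>C\<^esub> (h \<otimes>\<^bsub>C\<^esub> Idt C A) = Idt C A \<and>
     (e \<otimes>\<^bsub>C\<^esub> Idt C X) \<cdot>\<^bsub>C\<^esub> (Idt C X \<otimes>\<^bsub>C\<^esub> h) = Idt C X"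

text \<open>Being autonomous is a property: no choice of adjoints is part of the structure, in accordance
  with strong monoidal functors preserving adjoints only up to isomorphism.  The autonomous
  categories thus form a full subcategory of the monoidal ones, and the inclusion needs no notation.\<close>

locale autonomous_category = strict_monoidal_category +
  assumes left_adjoint: "A \<in> Obj C \<Longrightarrow> \<exists>X e h. adjoint_pair C X A e h"
    and right_adjoint: "A \<in> Obj C \<Longrightarrow> \<exists>Y e h. adjoint_pair C A Y e h"

definition inverse_arrows :: "('o, 'm) moncat \<Rightarrow> 'm \<Rightarrow> 'm \<Rightarrow> bool" where
  "inverse_arrows C f g \<longleftrightarrow>
     f \<in> hom C (Dom C f) (Cod C f) \<and> g \<in> hom C (Cod C f) (Dom C f) \<and>
     g \<cdot>\<^bsub>C\<^esub> f = Idt C (Dom C f) \<and> f \<cdot>\<^bsub>C\<^esub> g = Idt C (Cod C f)"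

definition iso_arrow :: "('o, 'm) moncat \<Rightarrow> 'm \<Rightarrow> bool" where
  "iso_arrow C f \<longleftrightarrow> (\<exists>g. inverse_arrows C f g)"

definition inv_arrow :: "('o, 'm) moncat \<Rightarrow> 'm \<Rightarrow> 'm" where
  "inv_arrow C f = (THE g. inverse_arrows C f g)"


section \<open>Strong monoidal functors\<close>

text \<open>\<open>Mult G A B\<close> is the isomorphism from \<open>G A \<otimes> G B\<close> to \<open>G (A \<otimes> B)\<close>, and \<open>Uni G\<close> the one
  from \<open>I\<close> to \<open>G I\<close>.\<close>

record ('o, 'm, 'p, 'n) monfun =
  MapO :: "'o \<Rightarrow> 'p"
  MapA :: "'m \<Rightarrow> 'n"
  Mult :: "'o \<Rightarrow> 'o \<Rightarrow> 'n"
  Uni :: "'n"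

locale strong_monoidal_functor =
  C: strict_monoidal_category C + D: strict_monoidal_category D
  for C :: "('o, 'm) moncat" and D :: "('p, 'n) moncat" and G :: "('o, 'm, 'p, 'n) monfun" +
  assumes mapO: "A \<in> Obj C \<Longrightarrow> MapO G A \<in> Obj D"
    and mapA: "f \<in> hom C A B \<Longrightarrow> MapA G f \<in> hom D (MapO G A) (MapO G B)"
    and map_idt: "A \<in> Obj C \<Longrightarrow> MapA G (Idt C A) = Idt D (MapO G A)"
    and map_comp: "\<lbrakk>f \<in> hom C A B; g \<in> hom C B E\<rbrakk>
          \<Longrightarrow> MapA G (g \<cdot>\<^bsub>C\<^esub> f) = MapA G g \<cdot>\<^bsub>D\<^esub> MapA G f"
    and mult_hom: "\<lbrakk>A \<in> Obj C; B \<in> Obj C\<rbrakk>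
          \<Longrightarrow> Mult G A B \<in> hom D (MapO G A \<odot>\<^bsub>D\<^esub> MapO G B) (MapO G (A \<odot>\<^bsub>C\<^esub> B))"
    and mult_iso: "\<lbrakk>A \<in> Obj C; B \<in> Obj C\<rbrakk> \<Longrightarrow> iso_arrow D (Mult G A B)"
    and mult_natural: "\<lbrakk>f \<in> hom C A B; f' \<in> hom C A' B'\<rbrakk>
          \<Longrightarrow> Mult G B B' \<cdot>\<^bsub>D\<^esub> (MapA G f \<otimes>\<^bsub>D\<^esub> MapA G f') = MapA G (f \<otimes>\<^bsub>C\<^esub> f') \<cdot>\<^bsub>D\<^esub> Mult G A A'"
    and uni_hom: "Uni G \<in> hom D \<one>\<^bsub>D\<^esub> (MapO G \<one>\<^bsub>C\<^esub>)"
    and uni_iso: "iso_arrow D (Uni G)"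
    and mult_assoc: "\<lbrakk>A \<in> Obj C; B \<in> Obj C; E \<in> Obj C\<rbrakk>
          \<Longrightarrow> Mult G (A \<odot>\<^bsub>C\<^esub> B) E \<cdot>\<^bsub>D\<^esub> (Mult G A B \<otimes>\<^bsub>D\<^esub> Idt D (MapO G E))
            = Mult G A (B \<odot>\<^bsub>C\<^esub> E) \<cdot>\<^bsub>D\<^esub> (Idt D (MapO G A) \<otimes>\<^bsub>D\<^esub> Mult G B E)"
    and mult_uni_left: "A \<in> Obj C
          \<Longrightarrow> Mult G \<one>\<^bsub>C\<^esub> A \<cdot>\<^bsub>D\<^esub> (Uni G \<otimes>\<^bsub>D\<^esub> Idt D (MapO G A)) = Idt D (MapO G A)"
    and mult_uni_right: "A \<in> Obj C
          \<Longrightarrow> Mult G A \<one>\<^bsub>C\<^esub> \<cdot>\<^bsub>D\<^esub> (Idt D (MapO G A) \<otimes>\<^bsub>D\<^esub> Uni G) = Idt D (MapO G A)"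

definition faithful_functor :: "('o, 'm) moncat \<Rightarrow> ('o, 'm, 'p, 'n) monfun \<Rightarrow> bool" where
  "faithful_functor C G \<longleftrightarrow>
     (\<forall>A\<in>Obj C. \<forall>B\<in>Obj C. inj_on (MapA G) (hom C A B))"

definition id_fun :: "('o, 'm) moncat \<Rightarrow> ('o, 'm, 'o, 'm) monfun" where
  "id_fun C = \<lparr>MapO = (\<lambda>A. A), MapA = (\<lambda>f. f),
     Mult = (\<lambda>A B. Idt C (A \<odot>\<^bsub>C\<^esub> B)), Uni = Idt C \<one>\<^bsub>C\<^esub>\<rparr>"

text \<open>\<open>comp_fun E H G\<close> is the composite of \<open>G\<close> followed by \<open>H\<close>; only the category \<open>E\<close> in which
  \<open>H\<close> takes its values is needed to compose the structure isomorphisms.\<close>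

definition comp_fun ::
  "('q, 'r) moncat \<Rightarrow> ('p, 'n, 'q, 'r) monfun \<Rightarrow> ('o, 'm, 'p, 'n) monfun \<Rightarrow> ('o, 'm, 'q, 'r) monfun"
where
  "comp_fun E H G = \<lparr>MapO = MapO H \<circ> MapO G, MapA = MapA H \<circ> MapA G,
     Mult = (\<lambda>A B. MapA H (Mult G A B) \<cdot>\<^bsub>E\<^esub> Mult H (MapO G A) (MapO G B)),
     Uni = MapA H (Uni G) \<cdot>\<^bsub>E\<^esub> Uni H\<rparr>"

text \<open>Equality of monoidal functors out of \<open>C\<close>, including their structure isomorphisms (the
  values outside the carriers are irrelevant).\<close>

definition fun_eq ::
  "('o, 'm) moncat \<Rightarrow> ('o, 'm, 'p, 'n) monfun \<Rightarrow> ('o, 'm, 'p, 'n) monfun \<Rightarrow> bool" where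
  "fun_eq C G H \<longleftrightarrow>
     (\<forall>A\<in>Obj C. MapO G A = MapO H A) \<and> (\<forall>f\<in>Arr C. MapA G f = MapA H f) \<and>
     (\<forall>A\<in>Obj C. \<forall>B\<in>Obj C. Mult G A B = Mult H A B) \<and> Uni G = Uni H"

text \<open>Existence of an invertible monoidal natural transformation.  A strong monoidal functor out of
  \<open>L(C)\<close> is determined by its restriction along the embedding only up to such an isomorphism (the
  values on the unit \<open>()\<close>, on longer lists and on adjoints may be replaced by isomorphic objects), so
  this is the finest sense in which the counit below can be natural.\<close>

definition fun_iso ::
  "('o, 'm) moncat \<Rightarrow> ('p, 'n) moncat \<Rightarrow> ('o, 'm, 'p, 'n) monfun \<Rightarrow> ('o, 'm, 'p, 'n) monfun \<Rightarrow> bool"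
where
  "fun_iso C D G H \<longleftrightarrow> (\<exists>t.
     (\<forall>A\<in>Obj C. t A \<in> hom D (MapO G A) (MapO H A) \<and> iso_arrow D (t A)) \<and>
     (\<forall>A\<in>Obj C. \<forall>B\<in>Obj C. \<forall>f\<in>hom C A B. t B \<cdot>\<^bsub>D\<^esub> MapA G f = MapA H f \<cdot>\<^bsub>D\<^esub> t A) \<and>
     (\<forall>A\<in>Obj C. \<forall>B\<in>Obj C.
        t (A \<odot>\<^bsub>C\<^esub> B) \<cdot>\<^bsub>D\<^esub> Mult G A B = Mult H A B \<cdot>\<^bsub>D\<^esub> (t A \<otimes>\<^bsub>D\<^esub> t B)) \<and>
     t \<one>\<^bsub>C\<^esub> \<cdot>\<^bsub>D\<^esub> Uni G = Uni H)"


section \<open>Planar string diagrams with cups and caps\<close>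

text \<open>The wire \<open>(A, n)\<close> stands for \<open>A\<^sup>n\<close>, with \<open>A\<^sup>n\<close> left adjoint to \<open>A\<^bsup>n+1\<^esup>\<close>: positive exponents are
  iterated right adjoints and negative ones iterated left adjoints.\<close>

type_synonym 'o wire = "'o \<times> int"

text \<open>A node carries, besides the morphism labelling it, the factorisations of the domain and of the
  codomain of that morphism into the wires attached to the node.  A cap joins \<open>A\<^sup>n\<close> and
  \<open>A\<^bsup>n+1\<^esup>\<close>, a cup creates \<open>A\<^bsup>n+1\<^esup>\<close> and \<open>A\<^sup>n\<close>.\<close>

datatype ('o, 'm) cell = Node "'o list" 'm "'o list" | Cap 'o int | Cup 'o int

definition plain :: "'o list \<Rightarrow> 'o wire list" where
  "plain As = map (\<lambda>A. (A, 0)) As"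

fun cell_dom :: "('o, 'm) cell \<Rightarrow> 'o wire list" where
  "cell_dom (Node As f Bs) = plain As"
| "cell_dom (Cap A n) = [(A, n), (A, n + 1)]"
| "cell_dom (Cup A n) = []"

fun cell_cod :: "('o, 'm) cell \<Rightarrow> 'o wire list" where
  "cell_cod (Node As f Bs) = plain Bs"
| "cell_cod (Cap A n) = []"
| "cell_cod (Cup A n) = [(A, n + 1), (A, n)]"

definition tens_list :: "('o, 'm) moncat \<Rightarrow> 'o list \<Rightarrow> 'o" where
  "tens_list C As = foldr (TensO C) As \<one>\<^bsub>C\<^esub>"

fun cell_ok :: "('o, 'm) moncat \<Rightarrow> ('o, 'm) cell \<Rightarrow> bool" where
  "cell_ok C (Node As f Bs) \<longleftrightarrow>
     set As \<subseteq> Obj C \<and> set Bs \<subseteq> Obj C \<and> f \<in> hom C (tens_list C As) (tens_list C Bs)"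
| "cell_ok C (Cap A n) \<longleftrightarrow> A \<in> Obj C"
| "cell_ok C (Cup A n) \<longleftrightarrow> A \<in> Obj C"

definition wires_ok :: "('o, 'm) moncat \<Rightarrow> 'o wire list \<Rightarrow> bool" where
  "wires_ok C X \<longleftrightarrow> fst ` set X \<subseteq> Obj C"

text \<open>A string diagram in general position (no two cells at the same height) is read as the sequence
  of its slices; a slice is one cell together with the wires passing on its left and on its right.
  \<open>diagram C X ss Y\<close> says that \<open>ss\<close> is a diagram from \<open>X\<close> to \<open>Y\<close>.\<close>

type_synonym ('o, 'm) slice = "'o wire list \<times> ('o, 'm) cell \<times> 'o wire list"

fun diagram ::
  "('o, 'm) moncat \<Rightarrow> 'o wire list \<Rightarrow> ('o, 'm) slice list \<Rightarrow> 'o wire list \<Rightarrow> bool" where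
  "diagram C X [] Y \<longleftrightarrow> wires_ok C X \<and> X = Y"
| "diagram C X ((u, c, v) # ss) Y \<longleftrightarrow>
     wires_ok C u \<and> cell_ok C c \<and> wires_ok C v \<and> X = u @ cell_dom c @ v \<and>
     diagram C (u @ cell_cod c @ v) ss Y"

definition whisker ::
  "'o wire list \<Rightarrow> ('o, 'm) slice list \<Rightarrow> 'o wire list \<Rightarrow> ('o, 'm) slice list" where
  "whisker u ss v = map (\<lambda>(a, c, b). (u @ a, c, b @ v)) ss"

text \<open>The first three rules generate the deformations of diagrams.  In \<open>identity\<close>, a node labelled
  by an identity whose domain is spread over the wires \<open>As\<close> is replaced by these wires; \<open>As\<close> may be
  empty, in which case a node labelled \<open>1\<^sub>I\<close> without wires is erased.\<close>

inductive move ::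
  "('o, 'm) moncat \<Rightarrow> ('o, 'm) slice list \<Rightarrow> ('o, 'm) slice list \<Rightarrow> bool" for C where
  exchange: "move C
     [([], c, w @ cell_dom d), (cell_cod c @ w, d, [])]
     [(cell_dom c @ w, d, []), ([], c, w @ cell_cod d)]"
| yank_left: "move C [([(A, n)], Cup A n, []), ([], Cap A n, [(A, n)])] []"
| yank_right: "move C [([], Cup A n, [(A, n + 1)]), ([(A, n + 1)], Cap A n, [])] []"
| stack: "move C
     [([], Node As f Bs, []), ([], Node Bs g Es, [])]
     [([], Node As (g \<cdot>\<^bsub>C\<^esub> f) Es, [])]"
| juxtapose: "move C
     [([], Node As f Bs, plain As'), (plain Bs, Node As' f' Bs', [])]
     [([], Node (As @ As') (f \<otimes>\<^bsub>C\<^esub> f') (Bs @ Bs'), [])]"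
| identity: "move C [([], Node As (Idt C (tens_list C As)) As, [])] []"

inductive diagram_eq ::
  "('o, 'm) moncat \<Rightarrow> 'o wire list \<Rightarrow> 'o wire list \<Rightarrow>
   ('o, 'm) slice list \<Rightarrow> ('o, 'm) slice list \<Rightarrow> bool" for C X Y where
  refl: "diagram C X ss Y \<Longrightarrow> diagram_eq C X Y ss ss"
| step: "\<lbrakk>move C l r; diagram C X (ss @ whisker u l v @ ts) Y; diagram C X (ss @ whisker u r v @ ts) Y\<rbrakk>
     \<Longrightarrow> diagram_eq C X Y (ss @ whisker u l v @ ts) (ss @ whisker u r v @ ts)"
| sym: "diagram_eq C X Y ss ts \<Longrightarrow> diagram_eq C X Y ts ss"
| trans: "\<lbrakk>diagram_eq C X Y ss ts; diagram_eq C X Y ts us\<rbrakk> \<Longrightarrow> diagram_eq C X Y ss us"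


section \<open>The category \<open>L(C)\<close> and the embedding\<close>

text \<open>A morphism of \<open>L(C)\<close> is an equivalence class of diagrams, together with its endpoints.\<close>

type_synonym ('o, 'm) larr = "'o wire list \<times> ('o, 'm) slice list set \<times> 'o wire list"

definition larr ::
  "('o, 'm) moncat \<Rightarrow> 'o wire list \<Rightarrow> ('o, 'm) slice list \<Rightarrow> 'o wire list \<Rightarrow> ('o, 'm) larr" where
  "larr C X ss Y = (X, {ts. diagram_eq C X Y ss ts}, Y)"

definition ldom :: "('o, 'm) larr \<Rightarrow> 'o wire list" where
  "ldom \<phi> = fst \<phi>"

definition lcod :: "('o, 'm) larr \<Rightarrow> 'o wire list" where
  "lcod \<phi> = snd (snd \<phi>)"

definition lrep :: "('o, 'm) larr \<Rightarrow> ('o, 'm) slice list" where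
  "lrep \<phi> = (SOME ss. ss \<in> fst (snd \<phi>))"

definition L :: "('o, 'm) moncat \<Rightarrow> ('o wire list, ('o, 'm) larr) moncat" where
  "L C = \<lparr>Obj = {X. wires_ok C X},
     Arr = {larr C X ss Y | X ss Y. diagram C X ss Y},
     Dom = ldom,
     Cod = lcod,
     Idt = (\<lambda>X. larr C X [] X),
     Comp = (\<lambda>\<psi> \<phi>. larr C (ldom \<phi>) (lrep \<phi> @ lrep \<psi>) (lcod \<psi>)),
     TensO = (@),
     Tens = (\<lambda>\<phi> \<psi>. larr C (ldom \<phi> @ ldom \<psi>)
       (whisker [] (lrep \<phi>) (ldom \<psi>) @ whisker (lcod \<phi>) (lrep \<psi>) []) (lcod \<phi> @ lcod \<psi>)),
     Unit = []\<rparr>"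

definition F :: "('o, 'm) moncat \<Rightarrow> ('o, 'm, 'o wire list, ('o, 'm) larr) monfun" where
  "F C = \<lparr>MapO = (\<lambda>A. plain [A]),
     MapA = (\<lambda>f. larr C (plain [Dom C f]) [([], Node [Dom C f] f [Cod C f], [])] (plain [Cod C f])),
     Mult = (\<lambda>A B. larr C (plain [A, B])
       [([], Node [A, B] (Idt C (A \<odot>\<^bsub>C\<^esub> B)) [A \<odot>\<^bsub>C\<^esub> B], [])] (plain [A \<odot>\<^bsub>C\<^esub> B])),
     Uni = larr C [] [([], Node [] (Idt C \<one>\<^bsub>C\<^esub>) [\<one>\<^bsub>C\<^esub>], [])] (plain [\<one>\<^bsub>C\<^esub>])\<rparr>"


section \<open>The action of \<open>L\<close> on strong monoidal functors\<close>

text \<open>The iterated structure isomorphism of \<open>K\<close>, from the product of \<open>map (MapO K) As\<close> to the image of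
  the product of \<open>As\<close>.\<close>

fun mult_list ::
  "('o, 'm) moncat \<Rightarrow> ('p, 'n) moncat \<Rightarrow> ('o, 'm, 'p, 'n) monfun \<Rightarrow> 'o list \<Rightarrow> 'n" where
  "mult_list C D K [] = Uni K"
| "mult_list C D K (A # As) =
     Mult K A (tens_list C As) \<cdot>\<^bsub>D\<^esub> (Idt D (MapO K A) \<otimes>\<^bsub>D\<^esub> mult_list C D K As)"

fun map_cell ::
  "('o, 'm) moncat \<Rightarrow> ('p, 'n) moncat \<Rightarrow> ('o, 'm, 'p, 'n) monfun \<Rightarrow> ('o, 'm) cell \<Rightarrow> ('p, 'n) cell" where
  "map_cell C D K (Node As f Bs) =
     Node (map (MapO K) As)
       (inv_arrow D (mult_list C D K Bs) \<cdot>\<^bsub>D\<^esub> (MapA K f \<cdot>\<^bsub>D\<^esub> mult_list C D K As))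
       (map (MapO K) Bs)"
| "map_cell C D K (Cap A n) = Cap (MapO K A) n"
| "map_cell C D K (Cup A n) = Cup (MapO K A) n"

definition map_wires :: "('o, 'm, 'p, 'n) monfun \<Rightarrow> 'o wire list \<Rightarrow> 'p wire list" where
  "map_wires K X = map (\<lambda>(A, n). (MapO K A, n)) X"

definition map_slices ::
  "('o, 'm) moncat \<Rightarrow> ('p, 'n) moncat \<Rightarrow> ('o, 'm, 'p, 'n) monfun \<Rightarrow>
   ('o, 'm) slice list \<Rightarrow> ('p, 'n) slice list" where
  "map_slices C D K ss =
     map (\<lambda>(u, c, v). (map_wires K u, map_cell C D K c, map_wires K v)) ss"

definition L_map ::
  "('o, 'm) moncat \<Rightarrow> ('p, 'n) moncat \<Rightarrow> ('o, 'm, 'p, 'n) monfun \<Rightarrow>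
   ('o wire list, ('o, 'm) larr, 'p wire list, ('p, 'n) larr) monfun" where
  "L_map C D K = \<lparr>MapO = map_wires K,
     MapA = (\<lambda>\<phi>. larr D (map_wires K (ldom \<phi>)) (map_slices C D K (lrep \<phi>)) (map_wires K (lcod \<phi>))),
     Mult = (\<lambda>X Y. Idt (L D) (map_wires K (X @ Y))),
     Uni = Idt (L D) []\<rparr>"


section \<open>The counit: evaluation of diagrams in an autonomous category\<close>

definition ladj :: "('o, 'm) moncat \<Rightarrow> 'o \<Rightarrow> 'o" where
  "ladj D A = (SOME X. \<exists>e h. adjoint_pair D X A e h)"

definition radj :: "('o, 'm) moncat \<Rightarrow> 'o \<Rightarrow> 'o" where
  "radj D A = (SOME Y. \<exists>e h. adjoint_pair D A Y e h)"

definition iter_adj :: "('o, 'm) moncat \<Rightarrow> 'o wire \<Rightarrow> 'o" where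
  "iter_adj D = (\<lambda>(A, n). if 0 \<le> n then (radj D ^^ nat n) A else (ladj D ^^ nat (- n)) A)"

definition ev_cap :: "('o, 'm) moncat \<Rightarrow> 'o \<Rightarrow> int \<Rightarrow> 'm" where
  "ev_cap D A n = (SOME e. \<exists>h. adjoint_pair D (iter_adj D (A, n)) (iter_adj D (A, n + 1)) e h)"

definition ev_cup :: "('o, 'm) moncat \<Rightarrow> 'o \<Rightarrow> int \<Rightarrow> 'm" where
  "ev_cup D A n =
     (SOME h. adjoint_pair D (iter_adj D (A, n)) (iter_adj D (A, n + 1)) (ev_cap D A n) h)"

fun ev_cell :: "('o, 'm) moncat \<Rightarrow> ('o, 'm) cell \<Rightarrow> 'm" where
  "ev_cell D (Node As f Bs) = f"
| "ev_cell D (Cap A n) = ev_cap D A n"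
| "ev_cell D (Cup A n) = ev_cup D A n"

definition ev_wires :: "('o, 'm) moncat \<Rightarrow> 'o wire list \<Rightarrow> 'o" where
  "ev_wires D X = tens_list D (map (iter_adj D) X)"

fun ev_slices :: "('o, 'm) moncat \<Rightarrow> 'o wire list \<Rightarrow> ('o, 'm) slice list \<Rightarrow> 'm" where
  "ev_slices D X [] = Idt D (ev_wires D X)"
| "ev_slices D X ((u, c, v) # ss) =
     ev_slices D (u @ cell_cod c @ v) ss \<cdot>\<^bsub>D\<^esub>
       (Idt D (ev_wires D u) \<otimes>\<^bsub>D\<^esub> ev_cell D c \<otimes>\<^bsub>D\<^esub> Idt D (ev_wires D v))"

definition counit :: "('o, 'm) moncat \<Rightarrow> ('o wire list, ('o, 'm) larr, 'o, 'm) monfun" where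
  "counit D = \<lparr>MapO = ev_wires D,
     MapA = (\<lambda>\<phi>. ev_slices D (ldom \<phi>) (lrep \<phi>)),
     Mult = (\<lambda>X Y. Idt D (ev_wires D (X @ Y))),
     Uni = Idt D \<one>\<^bsub>D\<^esub>\<rparr>"

end

(*
  Freeness rests on two facts. Diagrams can be evaluated in any autonomous category, because every
  move of diagrams holds there. Conversely, a strong monoidal functor out of L(C) is determined up to
  isomorphism by its restriction to C: a monoidal isomorphism of the restrictions extends to the
  adjoints A^n as mates, upwards and downwards from n = 0, and its naturality need only be checked on
  cups, caps and nodes. Naturality of the counit and the second triangle follow by restriction to C.

  Faithfulness: an equality of two diagrams with ends in C uses finitely many levels n. The extreme
  levels are removed one at a time, down to level 0, where diagrams are evaluated in C. For the lowest
  level k, let M be the monoidal category of diagrams with levels above k. It acts on the copresheaves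
  on M by precomposition, (X P)(Z) = P(Z X), and every such action has a left adjoint, a coend. So the
  wires of level k can be interpreted as well, and on the representable copresheaf of X a diagram of M
  out of X acts as composition, hence is recovered from its action. The highest level is removed by
  turning diagrams upside down.
*)

theory Submission
  imports Defs
begin

section \<open>Strict monoidal categories\<close>

text \<open>The obstacle to faithfulness is that \<open>C\<close> need not have adjoints: a chain of
  moves between two nodes of \<open>C\<close> may pass through diagrams that have no value in
  \<open>C\<close>. Copresheaves supply left adjoints, but a functor obtained as a coend need not
  have a left adjoint in turn. This is why a single level is adjoined at a time, at an end of the
  interval of levels, and why conservativity returns to diagrams before the next level is treated.
  Level 0 has to stay among the old levels, since nodes live there: nodes then act as old diagrams
  do, and only the cups and caps of the new level call upon the adjunction. Iterated coends over
  words of varying length would need varying types. Their elements are therefore kept in one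
  datatype of representatives, and quotients are replaced by partial equivalence relations, so that
  every equation between natural transformations is an equation up to such a relation.\<close>

context strict_monoidal_category
begin

lemma homD:
  assumes "f \<in> hom C A B"
  shows "f \<in> Arr C" "Dom C f = A" "Cod C f = B" "A \<in> Obj C" "B \<in> Obj C"
  using assms dom_obj cod_obj by (auto simp: hom_def)

lemma idt_arr [simp]:
  assumes "A \<in> Obj C"
  shows "Idt C A \<in> Arr C" "Dom C (Idt C A) = A" "Cod C (Idt C A) = A"
  using idt_hom[OF assms] by (auto simp: hom_def)

text \<open>With \<open>Dom\<close> and \<open>Cod\<close> instead of \<open>hom\<close> no middle
  object occurs that rewriting could not determine; for this reason the axioms about
  \<open>hom\<close> are restated here and below.\<close>

lemma comp_arr [simp]:
  assumes "f \<in> Arr C" "g \<in> Arr C" "Dom C g = Cod C f"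
  shows "g \<cdot> f \<in> Arr C" "Dom C (g \<cdot> f) = Dom C f" "Cod C (g \<cdot> f) = Cod C g"
  using comp_hom[of f "Dom C f" "Cod C f" g "Cod C g"] assms by (auto simp: hom_def)

lemma tens_arr [simp]:
  assumes "f \<in> Arr C" "g \<in> Arr C"
  shows "f \<otimes> g \<in> Arr C" "Dom C (f \<otimes> g) = Dom C f \<odot> Dom C g"
    "Cod C (f \<otimes> g) = Cod C f \<odot> Cod C g"
  using tens_hom[of f "Dom C f" "Cod C f" g "Dom C g" "Cod C g"] assms by (auto simp: hom_def)

lemmas obj_simps [simp] = dom_obj cod_obj unit_obj tensO_obj tensO_assoc unit_tensO tensO_unit

lemma comp_Idt [simp]: "\<lbrakk>f \<in> Arr C; Dom C f = A\<rbrakk> \<Longrightarrow> f \<cdot> Idt C A = f"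
  and Idt_comp [simp]: "\<lbrakk>f \<in> Arr C; Cod C f = A\<rbrakk> \<Longrightarrow> Idt C A \<cdot> f = f"
  using comp_idt[of f "Dom C f" "Cod C f"] idt_comp[of f "Dom C f" "Cod C f"]
  by (auto simp: hom_def)

lemma comp_assoc_arr [simp]:
  "\<lbrakk>f \<in> Arr C; g \<in> Arr C; h \<in> Arr C; Dom C g = Cod C f; Dom C h = Cod C g\<rbrakk>
    \<Longrightarrow> (h \<cdot> g) \<cdot> f = h \<cdot> (g \<cdot> f)"
  using comp_assoc[of f "Dom C f" "Cod C f" g "Cod C g" h "Cod C h"] by (auto simp: hom_def)

lemmas tens_simps [simp] = tens_idt tens_assoc unit_tens tens_unit

text \<open>Once tensor products are nested to the right, \<open>tens_idt\<close> no longer matches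
  two neighbouring identities followed by a further factor.\<close>

lemma tens_idt_assoc [simp]:
  "\<lbrakk>A \<in> Obj C; B \<in> Obj C; f \<in> Arr C\<rbrakk>
    \<Longrightarrow> Idt C A \<otimes> (Idt C B \<otimes> f) = Idt C (A \<odot> B) \<otimes> f"
  using tens_assoc[of "Idt C A" "Idt C B" f] by simp

lemma interchange_arr:
  "\<lbrakk>f \<in> Arr C; g \<in> Arr C; f' \<in> Arr C; g' \<in> Arr C; Dom C g = Cod C f; Dom C g' = Cod C f'\<rbrakk>
    \<Longrightarrow> (g \<otimes> g') \<cdot> (f \<otimes> f') = (g \<cdot> f) \<otimes> (g' \<cdot> f')"
  using interchange[of f "Dom C f" "Cod C f" g "Cod C g" f' "Dom C f'" "Cod C f'" g' "Cod C g'"]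
  by (auto simp: hom_def)

text \<open>The interchange law inside a composite that is nested to the right and continues with
  \<open>h\<close>.\<close>

lemma interchange_arr_assoc:
  assumes "f \<in> Arr C" "g \<in> Arr C" "f' \<in> Arr C" "g' \<in> Arr C" "Dom C g = Cod C f"
    "Dom C g' = Cod C f'" "h \<in> Arr C" "Cod C h = Dom C f \<odot> Dom C f'"
  shows "(g \<otimes> g') \<cdot> ((f \<otimes> f') \<cdot> h) = ((g \<cdot> f) \<otimes> (g' \<cdot> f')) \<cdot> h"
proof -
  have "(g \<otimes> g') \<cdot> ((f \<otimes> f') \<cdot> h) = ((g \<otimes> g') \<cdot> (f \<otimes> f')) \<cdot> h"
    using assms by simp
  then show ?thesis
    using assms by (simp add: interchange_arr)
qed

lemmas merge = interchange_arr interchange_arr_assoc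

lemma hom_iff: "f \<in> hom C A B \<longleftrightarrow> f \<in> Arr C \<and> Dom C f = A \<and> Cod C f = B"
  by (auto simp: hom_def)

section \<open>Isomorphisms and their inverses\<close>

lemma inverse_unique:
  assumes "inverse_arrows C f g" "inverse_arrows C f g'"
  shows "g = g'"
proof -
  have "g = g \<cdot> (f \<cdot> g')"
    using assms by (simp add: inverse_arrows_def hom_iff)
  also have "\<dots> = (g \<cdot> f) \<cdot> g'"
    by (rule comp_assoc_arr[symmetric]) (use assms in \<open>simp_all add: inverse_arrows_def hom_iff\<close>)
  also have "\<dots> = g'"
    using assms by (simp add: inverse_arrows_def hom_iff)
  finally show ?thesis .
qed

lemma inv_arrow_eq: "inverse_arrows C f g \<Longrightarrow> inv_arrow C f = g"
  unfolding inv_arrow_def using inverse_unique by blast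

lemma inverse_inv: "iso_arrow C f \<Longrightarrow> inverse_arrows C f (inv_arrow C f)"
  unfolding iso_arrow_def using inv_arrow_eq by auto

lemma iso_arr: "iso_arrow C f \<Longrightarrow> f \<in> Arr C"
  by (auto simp: iso_arrow_def inverse_arrows_def hom_def)

lemma inv_arr [simp]:
  assumes "iso_arrow C f"
  shows "inv_arrow C f \<in> Arr C" "Dom C (inv_arrow C f) = Cod C f" "Cod C (inv_arrow C f) = Dom C f"
    "inv_arrow C f \<cdot> f = Idt C (Dom C f)" "f \<cdot> inv_arrow C f = Idt C (Cod C f)"
  using inverse_inv[OF assms] by (auto simp: inverse_arrows_def hom_def)

lemma inv_cancel [simp]:
  assumes "iso_arrow C f" "g \<in> Arr C"
  shows "Cod C g = Dom C f \<Longrightarrow> inv_arrow C f \<cdot> (f \<cdot> g) = g"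
    "Cod C g = Cod C f \<Longrightarrow> f \<cdot> (inv_arrow C f \<cdot> g) = g"
proof -
  note f = iso_arr[OF assms(1)] inv_arr[OF assms(1)]
  show "inv_arrow C f \<cdot> (f \<cdot> g) = g" if "Cod C g = Dom C f"
  proof -
    have "inv_arrow C f \<cdot> (f \<cdot> g) = (inv_arrow C f \<cdot> f) \<cdot> g"
      by (rule comp_assoc_arr[symmetric]) (use f that assms in simp_all)
    then show ?thesis
      using f that assms by simp
  qed
  show "f \<cdot> (inv_arrow C f \<cdot> g) = g" if "Cod C g = Cod C f"
  proof -
    have "f \<cdot> (inv_arrow C f \<cdot> g) = (f \<cdot> inv_arrow C f) \<cdot> g"
      by (rule comp_assoc_arr[symmetric]) (use f that assms in simp_all)
    then show ?thesis
      using f that assms by simp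
  qed
qed

lemma inverse_arrows_sym: "inverse_arrows C f g \<Longrightarrow> inverse_arrows C g f"
  by (auto simp: inverse_arrows_def hom_def)

lemma iso_inv [simp]: "iso_arrow C f \<Longrightarrow> iso_arrow C (inv_arrow C f)"
  unfolding iso_arrow_def[of C "inv_arrow C f"] by (blast intro: inverse_inv inverse_arrows_sym)

lemma inverse_Idt: "A \<in> Obj C \<Longrightarrow> inverse_arrows C (Idt C A) (Idt C A)"
  by (simp add: inverse_arrows_def hom_iff)

lemma iso_Idt [simp]: "A \<in> Obj C \<Longrightarrow> iso_arrow C (Idt C A)"
  unfolding iso_arrow_def by (blast intro: inverse_Idt[unfolded iso_arrow_def])

lemma inv_Idt [simp]: "A \<in> Obj C \<Longrightarrow> inv_arrow C (Idt C A) = Idt C A"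
  by (rule inv_arrow_eq[OF inverse_Idt])

lemma inverse_comp:
  assumes "iso_arrow C f" "iso_arrow C g" "Dom C g = Cod C f"
  shows "inverse_arrows C (g \<cdot> f) (inv_arrow C f \<cdot> inv_arrow C g)"
  using assms iso_arr[OF assms(1)] iso_arr[OF assms(2)] by (simp add: inverse_arrows_def hom_iff)

lemma iso_comp [simp]:
  "\<lbrakk>iso_arrow C f; iso_arrow C g; Dom C g = Cod C f\<rbrakk> \<Longrightarrow> iso_arrow C (g \<cdot> f)"
  unfolding iso_arrow_def by (blast intro: inverse_comp[unfolded iso_arrow_def])

lemma inv_comp:
  "\<lbrakk>iso_arrow C f; iso_arrow C g; Dom C g = Cod C f\<rbrakk>
    \<Longrightarrow> inv_arrow C (g \<cdot> f) = inv_arrow C f \<cdot> inv_arrow C g"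
  by (rule inv_arrow_eq[OF inverse_comp])

lemma inverse_tens:
  assumes "iso_arrow C f" "iso_arrow C g"
  shows "inverse_arrows C (f \<otimes> g) (inv_arrow C f \<otimes> inv_arrow C g)"
  using assms iso_arr[OF assms(1)] iso_arr[OF assms(2)]
  by (simp add: inverse_arrows_def hom_iff merge)

lemma iso_tens [simp]: "\<lbrakk>iso_arrow C f; iso_arrow C g\<rbrakk> \<Longrightarrow> iso_arrow C (f \<otimes> g)"
  unfolding iso_arrow_def by (blast intro: inverse_tens[unfolded iso_arrow_def])

lemma inv_tens:
  "\<lbrakk>iso_arrow C f; iso_arrow C g\<rbrakk> \<Longrightarrow> inv_arrow C (f \<otimes> g) = inv_arrow C f \<otimes> inv_arrow C g"
  by (rule inv_arrow_eq[OF inverse_tens])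

lemma comp_left_cancel:
  assumes "iso_arrow C f" "g \<in> Arr C" "h \<in> Arr C" "Cod C g = Dom C f" "Cod C h = Dom C f"
    "f \<cdot> g = f \<cdot> h"
  shows "g = h"
  using inv_cancel(1)[OF assms(1,2,4)] inv_cancel(1)[OF assms(1,3,5)] assms(6) by metis

lemma comp_right_cancel:
  assumes "iso_arrow C f" "g \<in> Arr C" "h \<in> Arr C" "Dom C g = Cod C f" "Dom C h = Cod C f"
    "g \<cdot> f = h \<cdot> f"
  shows "g = h"
proof -
  have "(g \<cdot> f) \<cdot> inv_arrow C f = (h \<cdot> f) \<cdot> inv_arrow C f"
    using assms(6) by simp
  moreover have "(g \<cdot> f) \<cdot> inv_arrow C f = g" "(h \<cdot> f) \<cdot> inv_arrow C f = h"
    using assms(1-5) iso_arr[OF assms(1)] by simp_all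
  ultimately show ?thesis
    by simp
qed

lemma tens_list_simps [simp]:
  "tens_list C [] = \<one>" "tens_list C (A # As) = A \<odot> tens_list C As"
  by (simp_all add: tens_list_def)

lemma tens_list_obj [simp]: "set As \<subseteq> Obj C \<Longrightarrow> tens_list C As \<in> Obj C"
  by (induction As) auto

lemma tens_list_append [simp]:
  "\<lbrakk>set As \<subseteq> Obj C; set Bs \<subseteq> Obj C\<rbrakk>
    \<Longrightarrow> tens_list C (As @ Bs) = tens_list C As \<odot> tens_list C Bs"
  by (induction As) auto

subsection \<open>Adjoints\<close>

lemma adjointD:
  assumes "adjoint_pair C X A e h"
  shows "X \<in> Obj C" "A \<in> Obj C" "e \<in> Arr C" "Dom C e = X \<odot> A" "Cod C e = \<one>"
    "h \<in> Arr C" "Dom C h = \<one>" "Cod C h = A \<odot> X"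
    "(Idt C A \<otimes> e) \<cdot> (h \<otimes> Idt C A) = Idt C A"
    "(e \<otimes> Idt C X) \<cdot> (Idt C X \<otimes> h) = Idt C X"
  using assms by (auto simp: adjoint_pair_def hom_iff)

lemma adjointI:
  assumes "X \<in> Obj C" "A \<in> Obj C" "e \<in> Arr C" "Dom C e = X \<odot> A" "Cod C e = \<one>"
    "h \<in> Arr C" "Dom C h = \<one>" "Cod C h = A \<odot> X"
    "(Idt C A \<otimes> e) \<cdot> (h \<otimes> Idt C A) = Idt C A"
    "(e \<otimes> Idt C X) \<cdot> (Idt C X \<otimes> h) = Idt C X"
  shows "adjoint_pair C X A e h"
  using assms by (auto simp: adjoint_pair_def hom_iff)

lemma adjoint_unit: "adjoint_pair C \<one> \<one> (Idt C \<one>) (Idt C \<one>)"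
  by (rule adjointI) simp_all

lemma whisker_left_comp:
  "\<lbrakk>A \<in> Obj C; f \<in> Arr C; g \<in> Arr C; Dom C g = Cod C f\<rbrakk>
    \<Longrightarrow> Idt C A \<otimes> (g \<cdot> f) = (Idt C A \<otimes> g) \<cdot> (Idt C A \<otimes> f)"
  by (simp add: merge)

lemma whisker_right_comp:
  "\<lbrakk>A \<in> Obj C; f \<in> Arr C; g \<in> Arr C; Dom C g = Cod C f\<rbrakk>
    \<Longrightarrow> (g \<cdot> f) \<otimes> Idt C A = (g \<otimes> Idt C A) \<cdot> (f \<otimes> Idt C A)"
  by (simp add: merge)

text \<open>Equating the two right-hand sides slides \<open>f\<close> and \<open>g\<close> past each
  other; most manipulations of zigzags below consist of such slides.\<close>

lemma tens_split:
  assumes "f \<in> Arr C" "g \<in> Arr C"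
  shows "f \<otimes> g = (Idt C (Cod C f) \<otimes> g) \<cdot> (f \<otimes> Idt C (Dom C g))"
    and "f \<otimes> g = (f \<otimes> Idt C (Cod C g)) \<cdot> (Idt C (Dom C f) \<otimes> g)"
  using assms by (simp_all add: merge)

end

text \<open>By this duality, what is proved for right adjoints holds for left adjoints.\<close>

definition rev_cat :: "('o, 'm) moncat \<Rightarrow> ('o, 'm) moncat" where
  "rev_cat C = C\<lparr>TensO := \<lambda>A B. TensO C B A, Tens := \<lambda>f g. Tens C g f\<rparr>"

lemma rev_cat_simps [simp]:
  "Obj (rev_cat C) = Obj C" "Arr (rev_cat C) = Arr C" "Dom (rev_cat C) = Dom C"
  "Cod (rev_cat C) = Cod C" "Idt (rev_cat C) = Idt C" "Comp (rev_cat C) = Comp C"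
  "TensO (rev_cat C) A B = TensO C B A" "Tens (rev_cat C) f g = Tens C g f"
  "Unit (rev_cat C) = Unit C" "hom (rev_cat C) = hom C"
  "inverse_arrows (rev_cat C) = inverse_arrows C" "iso_arrow (rev_cat C) = iso_arrow C"
  by (auto simp: rev_cat_def hom_def inverse_arrows_def iso_arrow_def fun_eq_iff)

lemma strict_monoidal_category_rev:
  assumes "strict_monoidal_category C"
  shows "strict_monoidal_category (rev_cat C)"
proof -
  interpret strict_monoidal_category C by fact
  show ?thesis
    by unfold_locales (auto simp: hom_iff interchange_arr)
qed

lemma adjoint_pair_rev:
  "adjoint_pair (rev_cat C) A X e h \<longleftrightarrow> adjoint_pair C X A e h"
  by (auto simp: adjoint_pair_def)

section \<open>Adjoints of tensor products, uniqueness of adjoints, and mates\<close>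

context strict_monoidal_category
begin

text \<open>The cap \<open>e\<close> is nested inside \<open>e'\<close>, and the cup
  \<open>h'\<close> inside \<open>h\<close>. After \<open>e\<close> is slid past \<open>h'\<close>,
  the zigzag of \<open>h'\<close> and \<open>e'\<close> straightens the strand of \<open>B\<close>;
  what remains is the zigzag of \<open>A\<close> beside \<open>B\<close>.\<close>

lemma adjoint_tens_triangle:
  assumes XA: "adjoint_pair C X A e h" and YB: "adjoint_pair C Y B e' h'"
  defines "d \<equiv> e' \<cdot> (Idt C Y \<otimes> e \<otimes> Idt C B)" and "k \<equiv> (Idt C A \<otimes> h' \<otimes> Idt C X) \<cdot> h"
  shows "(Idt C (A \<odot> B) \<otimes> d) \<cdot> (k \<otimes> Idt C (A \<odot> B)) = Idt C (A \<odot> B)"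
proof -
  note [simp] = adjointD(1-8)[OF XA] adjointD(1-8)[OF YB]
  have "(Idt C (A \<odot> B) \<otimes> d) \<cdot> (k \<otimes> Idt C (A \<odot> B)) =
      (Idt C A \<otimes> ((Idt C B \<otimes> d) \<cdot> (h' \<otimes> Idt C (X \<odot> A \<odot> B)))) \<cdot> (h \<otimes> Idt C (A \<odot> B))"
  proof -
    have "k \<otimes> Idt C (A \<odot> B) = (Idt C A \<otimes> (h' \<otimes> Idt C (X \<odot> A \<odot> B))) \<cdot> (h \<otimes> Idt C (A \<odot> B))"
      by (simp add: k_def whisker_right_comp)
    moreover have "Idt C (A \<odot> B) \<otimes> d = Idt C A \<otimes> (Idt C B \<otimes> d)"
      by (simp add: d_def)
    ultimately show ?thesis
      by (simp add: d_def whisker_left_comp del: tens_idt_assoc)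
  qed
  also have "(Idt C B \<otimes> d) \<cdot> (h' \<otimes> Idt C (X \<odot> A \<odot> B)) =
      (Idt C B \<otimes> e') \<cdot> ((Idt C (B \<odot> Y) \<otimes> (e \<otimes> Idt C B)) \<cdot> (h' \<otimes> Idt C (X \<odot> A \<odot> B)))"
    by (simp add: d_def whisker_left_comp)
  also have "(Idt C (B \<odot> Y) \<otimes> (e \<otimes> Idt C B)) \<cdot> (h' \<otimes> Idt C (X \<odot> A \<odot> B)) = h' \<otimes> (e \<otimes> Idt C B)"
    by (simp add: merge)
  also have "\<dots> = (h' \<otimes> Idt C B) \<cdot> (e \<otimes> Idt C B)"
    using tens_split(2)[of h' "e \<otimes> Idt C B"] by simp
  also have "(Idt C B \<otimes> e') \<cdot> \<dots> = ((Idt C B \<otimes> e') \<cdot> (h' \<otimes> Idt C B)) \<cdot> (e \<otimes> Idt C B)"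
    by (simp del: adjointD)
  also have "\<dots> = e \<otimes> Idt C B"
    by (simp only: adjointD(9)[OF YB]) simp
  also have "(Idt C A \<otimes> (e \<otimes> Idt C B)) \<cdot> (h \<otimes> Idt C (A \<odot> B)) =
      ((Idt C A \<otimes> e) \<cdot> (h \<otimes> Idt C A)) \<otimes> Idt C B"
    using tens_idt[of A B] by (simp add: whisker_right_comp del: tens_idt)
  also have "\<dots> = Idt C (A \<odot> B)"
    by (simp add: adjointD(9)[OF XA])
  finally show ?thesis .
qed

text \<open>In the reversed tensor product the two triangles change places, so the second one needs
  no computation of its own.\<close>

lemma adjoint_tens:
  assumes XA: "adjoint_pair C X A e h" and YB: "adjoint_pair C Y B e' h'"
  shows "adjoint_pair C (Y \<odot> X) (A \<odot> B)
    (e' \<cdot> (Idt C Y \<otimes> e \<otimes> Idt C B)) ((Idt C A \<otimes> h' \<otimes> Idt C X) \<cdot> h)"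
proof -
  note [simp] = adjointD(1-8)[OF XA] adjointD(1-8)[OF YB]
  interpret R: strict_monoidal_category "rev_cat C"
    by (rule strict_monoidal_category_rev) unfold_locales
  show ?thesis
  proof (rule adjointI)
    show "((e' \<cdot> (Idt C Y \<otimes> e \<otimes> Idt C B)) \<otimes> Idt C (Y \<odot> X)) \<cdot>
        (Idt C (Y \<odot> X) \<otimes> ((Idt C A \<otimes> h' \<otimes> Idt C X) \<cdot> h)) = Idt C (Y \<odot> X)"
      using R.adjoint_tens_triangle[of A X e h B Y e' h']
      by (simp add: adjoint_pair_rev XA YB)
  qed (use adjoint_tens_triangle[OF XA YB] in simp_all)
qed

text \<open>The adjunction is transported along \<open>s\<close>: its inverse is put below the
  counit, \<open>s\<close> itself on top of the unit, and the two cancel in the zigzags.\<close>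

lemma adjoint_change_left:
  assumes XA: "adjoint_pair C X A e h" and s: "iso_arrow C s" "Dom C s = X" "Cod C s = Y"
  shows "adjoint_pair C Y A (e \<cdot> (inv_arrow C s \<otimes> Idt C A)) ((Idt C A \<otimes> s) \<cdot> h)"
proof -
  note [simp] = adjointD(1-8)[OF XA] iso_arr[OF s(1)] s
  have Y [simp]: "Y \<in> Obj C"
    using cod_obj[OF iso_arr[OF s(1)]] by simp
  show ?thesis
  proof (rule adjointI)
    have "(Idt C A \<otimes> (e \<cdot> (inv_arrow C s \<otimes> Idt C A))) \<cdot> (((Idt C A \<otimes> s) \<cdot> h) \<otimes> Idt C A) =
        (Idt C A \<otimes> e) \<cdot> (((Idt C A \<otimes> inv_arrow C s \<otimes> Idt C A) \<cdot> (Idt C A \<otimes> s \<otimes> Idt C A)) \<cdot> (h \<otimes> Idt C A))"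
      by (simp add: whisker_left_comp whisker_right_comp)
    also have "(Idt C A \<otimes> inv_arrow C s \<otimes> Idt C A) \<cdot> (Idt C A \<otimes> s \<otimes> Idt C A) = Idt C (A \<odot> X \<odot> A)"
      by (simp add: merge)
    also have "\<dots> \<cdot> (h \<otimes> Idt C A) = h \<otimes> Idt C A"
      by simp
    finally show "(Idt C A \<otimes> (e \<cdot> (inv_arrow C s \<otimes> Idt C A))) \<cdot> (((Idt C A \<otimes> s) \<cdot> h) \<otimes> Idt C A) = Idt C A"
      by (simp add: adjointD(9)[OF XA])
    \<comment> \<open>In this triangle \<open>s\<close> and its inverse lie on different strands.
      The equations \<open>1\<close>, \<open>2\<close> and \<open>3\<close> slide them to the two
      ends, where they enclose the zigzag of \<open>X\<close>.\<close>
    have 1: "(inv_arrow C s \<otimes> Idt C (A \<odot> Y)) \<cdot> (Idt C (Y \<odot> A) \<otimes> s) =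
        (Idt C (X \<odot> A) \<otimes> s) \<cdot> (inv_arrow C s \<otimes> Idt C (A \<odot> X))"
      by (simp add: merge tens_idt[symmetric] del: tens_idt tens_idt_assoc)
    have 2: "(inv_arrow C s \<otimes> Idt C (A \<odot> X)) \<cdot> (Idt C Y \<otimes> h) = (Idt C X \<otimes> h) \<cdot> inv_arrow C s"
      using tens_split[of "inv_arrow C s" h] by simp
    have 3: "(e \<otimes> Idt C Y) \<cdot> (Idt C (X \<odot> A) \<otimes> s) = s \<cdot> (e \<otimes> Idt C X)"
      using tens_split[of e s] by simp
    have "((e \<cdot> (inv_arrow C s \<otimes> Idt C A)) \<otimes> Idt C Y) \<cdot> (Idt C Y \<otimes> ((Idt C A \<otimes> s) \<cdot> h))
      = (e \<otimes> Idt C Y) \<cdot> (((inv_arrow C s \<otimes> Idt C (A \<odot> Y)) \<cdot> (Idt C (Y \<odot> A) \<otimes> s)) \<cdot> (Idt C Y \<otimes> h))"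
      by (simp add: whisker_left_comp whisker_right_comp)
    also have "\<dots> = ((e \<otimes> Idt C Y) \<cdot> (Idt C (X \<odot> A) \<otimes> s)) \<cdot> ((inv_arrow C s \<otimes> Idt C (A \<odot> X)) \<cdot> (Idt C Y \<otimes> h))"
      unfolding 1 by simp
    also have "\<dots> = s \<cdot> (((e \<otimes> Idt C X) \<cdot> (Idt C X \<otimes> h)) \<cdot> inv_arrow C s)"
      unfolding 2 3 by simp
    finally show "((e \<cdot> (inv_arrow C s \<otimes> Idt C A)) \<otimes> Idt C Y) \<cdot> (Idt C Y \<otimes> ((Idt C A \<otimes> s) \<cdot> h)) = Idt C Y"
      by (simp add: adjointD(10)[OF XA])
  qed simp_all
qed

text \<open>The arrow \<open>s\<close> is the mate of the identity of \<open>X\<close>.\<close>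

lemma adjoint_compare:
  assumes XA: "adjoint_pair C X A e h" and XB: "adjoint_pair C X B e' h'"
  defines "s \<equiv> (Idt C B \<otimes> e) \<cdot> (h' \<otimes> Idt C A)"
  shows "s \<in> Arr C" "Dom C s = A" "Cod C s = B"
    "e' \<cdot> (Idt C X \<otimes> s) = e" "(s \<otimes> Idt C X) \<cdot> h = h'"
proof -
  note [simp] = adjointD(1-8)[OF XA] adjointD(1-8)[OF XB]
  show s [simp]: "s \<in> Arr C" "Dom C s = A" "Cod C s = B"
    by (simp_all add: s_def)
  have 1: "e' \<cdot> (Idt C (X \<odot> B) \<otimes> e) = e \<cdot> (e' \<otimes> Idt C (X \<odot> A))"
    using tens_split[of e' e] by simp
  have 2: "(e' \<otimes> Idt C (X \<odot> A)) \<cdot> (Idt C X \<otimes> h' \<otimes> Idt C A) =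
      ((e' \<otimes> Idt C X) \<cdot> (Idt C X \<otimes> h')) \<otimes> Idt C A"
    by (simp add: whisker_right_comp tens_idt[symmetric] del: tens_idt tens_idt_assoc)
  have "e' \<cdot> (Idt C X \<otimes> s) = (e' \<cdot> (Idt C (X \<odot> B) \<otimes> e)) \<cdot> (Idt C X \<otimes> h' \<otimes> Idt C A)"
    by (simp add: s_def whisker_left_comp)
  also have "\<dots> = e \<cdot> (((e' \<otimes> Idt C X) \<cdot> (Idt C X \<otimes> h')) \<otimes> Idt C A)"
    unfolding 1 2[symmetric] by simp
  finally show "e' \<cdot> (Idt C X \<otimes> s) = e"
    by (simp add: adjointD(10)[OF XB])
  have 3: "(h' \<otimes> Idt C (A \<odot> X)) \<cdot> h = (Idt C (B \<odot> X) \<otimes> h) \<cdot> h'"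
    using tens_split[of h' h] by simp
  have 4: "(Idt C B \<otimes> e \<otimes> Idt C X) \<cdot> (Idt C (B \<odot> X) \<otimes> h) =
      Idt C B \<otimes> ((e \<otimes> Idt C X) \<cdot> (Idt C X \<otimes> h))"
    by (simp add: whisker_left_comp tens_idt[symmetric] del: tens_idt tens_idt_assoc)
  have "(s \<otimes> Idt C X) \<cdot> h = (Idt C B \<otimes> e \<otimes> Idt C X) \<cdot> ((h' \<otimes> Idt C (A \<odot> X)) \<cdot> h)"
    by (simp add: s_def whisker_right_comp)
  also have "\<dots> = ((Idt C B \<otimes> e \<otimes> Idt C X) \<cdot> (Idt C (B \<odot> X) \<otimes> h)) \<cdot> h'"
    unfolding 3 by simp
  finally show "(s \<otimes> Idt C X) \<cdot> h = h'"
    by (simp add: 4 adjointD(10)[OF XA])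
qed

text \<open>Precede \<open>s\<close> by nothing and follow it by the zigzag of \<open>A\<close>,
  which is an identity. Sliding the cup below \<open>s\<close> brings \<open>s\<close> under the
  counit, where it is absorbed, and the zigzag alone is left.\<close>

lemma adjoint_compare_self:
  assumes XA: "adjoint_pair C X A e h" and s: "s \<in> Arr C" "Dom C s = A" "Cod C s = A"
    and "e \<cdot> (Idt C X \<otimes> s) = e"
  shows "s = Idt C A"
proof -
  note [simp] = adjointD(1-8)[OF XA] s
  have "s = ((Idt C A \<otimes> e) \<cdot> (h \<otimes> Idt C A)) \<cdot> s"
    by (simp add: adjointD(9)[OF XA])
  also have "\<dots> = (Idt C A \<otimes> e) \<cdot> ((h \<otimes> Idt C A) \<cdot> s)"
    by simp
  also have "(h \<otimes> Idt C A) \<cdot> s = (Idt C (A \<odot> X) \<otimes> s) \<cdot> (h \<otimes> Idt C A)"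
    using tens_split[of h s] by simp
  also have "(Idt C A \<otimes> e) \<cdot> \<dots> = (Idt C A \<otimes> (e \<cdot> (Idt C X \<otimes> s))) \<cdot> (h \<otimes> Idt C A)"
    by (simp add: whisker_left_comp)
  finally show ?thesis
    by (simp add: assms adjointD(9)[OF XA])
qed

text \<open>Both composites of the two comparison arrows preserve the counit, hence are identities
  by \<open>adjoint_compare_self\<close>.\<close>

lemma adjoint_right_unique:
  assumes XA: "adjoint_pair C X A e h" and XB: "adjoint_pair C X B e' h'"
  obtains s where "iso_arrow C s" "Dom C s = A" "Cod C s = B"
    "e' \<cdot> (Idt C X \<otimes> s) = e" "(s \<otimes> Idt C X) \<cdot> h = h'"
proof -
  define s where "s = (Idt C B \<otimes> e) \<cdot> (h' \<otimes> Idt C A)"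
  define r where "r = (Idt C A \<otimes> e') \<cdot> (h \<otimes> Idt C B)"
  note s = adjoint_compare[OF XA XB, folded s_def]
  note r = adjoint_compare[OF XB XA, folded r_def]
  note [simp] = adjointD(1-8)[OF XA] adjointD(1-8)[OF XB] s(1-3) r(1-3)
  have "r \<cdot> s = Idt C A"
  proof (rule adjoint_compare_self[OF XA])
    have "e \<cdot> (Idt C X \<otimes> (r \<cdot> s)) = (e \<cdot> (Idt C X \<otimes> r)) \<cdot> (Idt C X \<otimes> s)"
      by (simp add: whisker_left_comp)
    then show "e \<cdot> (Idt C X \<otimes> (r \<cdot> s)) = e"
      by (simp add: r s)
  qed simp_all
  moreover have "s \<cdot> r = Idt C B"
  proof (rule adjoint_compare_self[OF XB])
    have "e' \<cdot> (Idt C X \<otimes> (s \<cdot> r)) = (e' \<cdot> (Idt C X \<otimes> s)) \<cdot> (Idt C X \<otimes> r)"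
      by (simp add: whisker_left_comp)
    then show "e' \<cdot> (Idt C X \<otimes> (s \<cdot> r)) = e'"
      by (simp add: r s)
  qed simp_all
  ultimately have "iso_arrow C s"
    by (auto simp: iso_arrow_def inverse_arrows_def hom_iff intro!: exI[of _ r])
  then show ?thesis
    using that s by blast
qed

text \<open>Transporting the first adjunction along \<open>s\<close> leaves two right adjoints of
  the same object \<open>Y\<close>; the comparison between them is the mate
  \<open>t\<close>.\<close>

lemma right_mate:
  assumes XA: "adjoint_pair C X A e h" and YB: "adjoint_pair C Y B e' h'"
    and s: "iso_arrow C s" "Dom C s = X" "Cod C s = Y"
  obtains t where "iso_arrow C t" "Dom C t = A" "Cod C t = B"
    "e' \<cdot> (s \<otimes> t) = e" "(t \<otimes> s) \<cdot> h = h'"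
proof -
  note [simp] = adjointD(1-8)[OF XA] adjointD(1-8)[OF YB] iso_arr[OF s(1)] s
  obtain t where t: "iso_arrow C t" "Dom C t = A" "Cod C t = B"
    and e: "e' \<cdot> (Idt C Y \<otimes> t) = e \<cdot> (inv_arrow C s \<otimes> Idt C A)"
    and h: "(t \<otimes> Idt C Y) \<cdot> (Idt C A \<otimes> s) \<cdot> h = h'"
    using adjoint_right_unique[OF adjoint_change_left[OF XA s] YB] by metis
  note [simp] = iso_arr[OF t(1)] t
  have "e' \<cdot> (s \<otimes> t) = (e' \<cdot> (Idt C Y \<otimes> t)) \<cdot> (s \<otimes> Idt C A)"
    using tens_split(1)[of s t] by simp
  also have "\<dots> = e"
    unfolding e by (simp add: merge)
  finally have "e' \<cdot> (s \<otimes> t) = e" .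
  moreover have "(t \<otimes> s) \<cdot> h = h'"
    using tens_split(2)[of t s] h by simp
  ultimately show ?thesis
    using that t by blast
qed

end

lemma (in strict_monoidal_category) left_mate:
  assumes XA: "adjoint_pair C X A e h" and YB: "adjoint_pair C Y B e' h'"
    and s: "iso_arrow C s" "Dom C s = A" "Cod C s = B"
  obtains t where "iso_arrow C t" "Dom C t = X" "Cod C t = Y"
    "e' \<cdot> (t \<otimes> s) = e" "(s \<otimes> t) \<cdot> h = h'"
proof -
  interpret R: strict_monoidal_category "rev_cat C"
    by (rule strict_monoidal_category_rev) unfold_locales
  show ?thesis
    using R.right_mate[of A X e h B Y e' h' s] that XA YB s by (auto simp: adjoint_pair_rev)
qed

section \<open>Strong monoidal functors\<close>

context strong_monoidal_functor
begin

lemma mapA_arr [simp]: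
  assumes "f \<in> Arr C"
  shows "MapA G f \<in> Arr D" "Dom D (MapA G f) = MapO G (Dom C f)"
    "Cod D (MapA G f) = MapO G (Cod C f)"
  using mapA[of f "Dom C f" "Cod C f"] assms by (auto simp: hom_def)

lemma mult_arr [simp]:
  assumes "A \<in> Obj C" "B \<in> Obj C"
  shows "Mult G A B \<in> Arr D" "Dom D (Mult G A B) = MapO G A \<odot>\<^bsub>D\<^esub> MapO G B"
    "Cod D (Mult G A B) = MapO G (A \<odot>\<^bsub>C\<^esub> B)"
  using mult_hom[OF assms] by (auto simp: hom_def)

lemma uni_arr [simp]:
  "Uni G \<in> Arr D" "Dom D (Uni G) = \<one>\<^bsub>D\<^esub>" "Cod D (Uni G) = MapO G \<one>\<^bsub>C\<^esub>"
  using uni_hom by (auto simp: hom_def)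

lemmas fun_simps [simp] = mapO map_idt mult_iso uni_iso mult_uni_left mult_uni_right

lemma map_comp_arr:
  "\<lbrakk>f \<in> Arr C; g \<in> Arr C; Dom C g = Cod C f\<rbrakk>
    \<Longrightarrow> MapA G (g \<cdot>\<^bsub>C\<^esub> f) = MapA G g \<cdot>\<^bsub>D\<^esub> MapA G f"
  using map_comp[of f "Dom C f" "Cod C f" g "Cod C g"] by (auto simp: hom_def)

lemma mult_natural_arr:
  "\<lbrakk>f \<in> Arr C; f' \<in> Arr C; Cod C f = B; Cod C f' = B'\<rbrakk>
    \<Longrightarrow> Mult G B B' \<cdot>\<^bsub>D\<^esub> (MapA G f \<otimes>\<^bsub>D\<^esub> MapA G f') =
      MapA G (f \<otimes>\<^bsub>C\<^esub> f') \<cdot>\<^bsub>D\<^esub> Mult G (Dom C f) (Dom C f')"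
  using mult_natural[of f "Dom C f" "Cod C f" f' "Dom C f'" "Cod C f'"] by (auto simp: hom_def)

lemma map_inverse:
  assumes "iso_arrow C f"
  shows "inverse_arrows D (MapA G f) (MapA G (inv_arrow C f))"
  using assms C.iso_arr[OF assms]
  by (simp add: inverse_arrows_def D.hom_iff map_comp_arr[symmetric])

lemma map_iso [simp]: "iso_arrow C f \<Longrightarrow> iso_arrow D (MapA G f)"
  unfolding iso_arrow_def[of D] by (blast intro: map_inverse)

lemma map_inv: "iso_arrow C f \<Longrightarrow> inv_arrow D (MapA G f) = MapA G (inv_arrow C f)"
  by (rule D.inv_arrow_eq[OF map_inverse])

lemma inv_mult_natural:
  assumes "f \<in> Arr C" "f' \<in> Arr C" "Dom C f = A" "Dom C f' = A'"
  shows "inv_arrow D (Mult G (Cod C f) (Cod C f')) \<cdot>\<^bsub>D\<^esub> MapA G (f \<otimes>\<^bsub>C\<^esub> f') =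
      (MapA G f \<otimes>\<^bsub>D\<^esub> MapA G f') \<cdot>\<^bsub>D\<^esub> inv_arrow D (Mult G A A')"
  (is "?m \<cdot>\<^bsub>D\<^esub> ?f = ?g \<cdot>\<^bsub>D\<^esub> ?n")
proof -
  have [simp]: "A \<in> Obj C" "A' \<in> Obj C"
    using assms by auto
  have "?g \<cdot>\<^bsub>D\<^esub> ?n = ?m \<cdot>\<^bsub>D\<^esub> ((Mult G (Cod C f) (Cod C f') \<cdot>\<^bsub>D\<^esub> ?g) \<cdot>\<^bsub>D\<^esub> ?n)"
    using assms by simp
  also have "\<dots> = ?m \<cdot>\<^bsub>D\<^esub> ?f"
    using assms by (simp only: mult_natural_arr) simp
  finally show ?thesis ..
qed

lemma mult_list_arr:
  assumes "set As \<subseteq> Obj C"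
  shows "mult_list C D G As \<in> Arr D \<and>
    Dom D (mult_list C D G As) = tens_list D (map (MapO G) As) \<and>
    Cod D (mult_list C D G As) = MapO G (tens_list C As) \<and> iso_arrow D (mult_list C D G As)"
  using assms by (induction As) auto

lemmas mult_list_simps [simp] =
  mult_list_arr[THEN conjunct1] mult_list_arr[THEN conjunct2, THEN conjunct1]
  mult_list_arr[THEN conjunct2, THEN conjunct2, THEN conjunct1]
  mult_list_arr[THEN conjunct2, THEN conjunct2, THEN conjunct2]

lemma image_obj [simp]: "set As \<subseteq> Obj C \<Longrightarrow> MapO G ` set As \<subseteq> Obj D"
  by auto

lemma mult_assoc_cancel:
  assumes "A \<in> Obj C" "B \<in> Obj C" "E \<in> Obj C" "k \<in> Arr D"
    "Cod D k = MapO G A \<odot>\<^bsub>D\<^esub> MapO G B \<odot>\<^bsub>D\<^esub> MapO G E"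
  shows "Mult G A (B \<odot>\<^bsub>C\<^esub> E) \<cdot>\<^bsub>D\<^esub> ((Idt D (MapO G A) \<otimes>\<^bsub>D\<^esub> Mult G B E) \<cdot>\<^bsub>D\<^esub> k) =
    Mult G (A \<odot>\<^bsub>C\<^esub> B) E \<cdot>\<^bsub>D\<^esub> ((Mult G A B \<otimes>\<^bsub>D\<^esub> Idt D (MapO G E)) \<cdot>\<^bsub>D\<^esub> k)"
proof -
  have "(Mult G A (B \<odot>\<^bsub>C\<^esub> E) \<cdot>\<^bsub>D\<^esub> (Idt D (MapO G A) \<otimes>\<^bsub>D\<^esub> Mult G B E)) \<cdot>\<^bsub>D\<^esub> k =
    (Mult G (A \<odot>\<^bsub>C\<^esub> B) E \<cdot>\<^bsub>D\<^esub> (Mult G A B \<otimes>\<^bsub>D\<^esub> Idt D (MapO G E))) \<cdot>\<^bsub>D\<^esub> k"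
    using assms by (simp only: mult_assoc)
  then show ?thesis
    using assms by simp
qed

text \<open>Coherence: associativity of \<open>Mult\<close> moves the place of the split past one
  more factor, and the left unit law starts the induction. Through this lemma the image of two
  juxtaposed nodes splits into two nodes.\<close>

lemma mult_list_append:
  assumes "set As \<subseteq> Obj C" "set Bs \<subseteq> Obj C"
  shows "mult_list C D G (As @ Bs) = Mult G (tens_list C As) (tens_list C Bs) \<cdot>\<^bsub>D\<^esub>
    (mult_list C D G As \<otimes>\<^bsub>D\<^esub> mult_list C D G Bs)"
  using assms
proof (induction As)
  case Nil
  then show ?case
    using D.tens_split(2)[of "Uni G" "mult_list C D G Bs"]
      D.comp_assoc_arr[of "mult_list C D G Bs" "Uni G \<otimes>\<^bsub>D\<^esub> Idt D (MapO G (tens_list C Bs))"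
        "Mult G \<one>\<^bsub>C\<^esub> (tens_list C Bs)", symmetric]
    by (simp del: D.comp_assoc_arr)
next
  case (Cons A As)
  let ?m = "mult_list C D G"
  have "?m ((A # As) @ Bs) = Mult G A (tens_list C As \<odot>\<^bsub>C\<^esub> tens_list C Bs) \<cdot>\<^bsub>D\<^esub>
      ((Idt D (MapO G A) \<otimes>\<^bsub>D\<^esub> Mult G (tens_list C As) (tens_list C Bs)) \<cdot>\<^bsub>D\<^esub>
      (Idt D (MapO G A) \<otimes>\<^bsub>D\<^esub> ?m As \<otimes>\<^bsub>D\<^esub> ?m Bs))"
    using Cons by (simp add: D.whisker_left_comp)
  also have "\<dots> = Mult G (A \<odot>\<^bsub>C\<^esub> tens_list C As) (tens_list C Bs) \<cdot>\<^bsub>D\<^esub>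
      ((Mult G A (tens_list C As) \<otimes>\<^bsub>D\<^esub> Idt D (MapO G (tens_list C Bs))) \<cdot>\<^bsub>D\<^esub>
      (Idt D (MapO G A) \<otimes>\<^bsub>D\<^esub> ?m As \<otimes>\<^bsub>D\<^esub> ?m Bs))"
    using Cons by (intro mult_assoc_cancel) auto
  also have "(Idt D (MapO G A) \<otimes>\<^bsub>D\<^esub> ?m As \<otimes>\<^bsub>D\<^esub> ?m Bs) = (Idt D (MapO G A) \<otimes>\<^bsub>D\<^esub> ?m As) \<otimes>\<^bsub>D\<^esub> ?m Bs"
    using Cons by simp
  also have "(Mult G A (tens_list C As) \<otimes>\<^bsub>D\<^esub> Idt D (MapO G (tens_list C Bs))) \<cdot>\<^bsub>D\<^esub> \<dots> =
      ?m (A # As) \<otimes>\<^bsub>D\<^esub> ?m Bs"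
    using Cons by (simp add: D.merge del: D.tens_assoc)
  finally show ?case
    using Cons by simp
qed

end

lemma functor_rev:
  assumes "strong_monoidal_functor C D G"
  shows "strong_monoidal_functor (rev_cat C) (rev_cat D) (G\<lparr>Mult := \<lambda>A B. Mult G B A\<rparr>)"
proof -
  interpret strong_monoidal_functor C D G by fact
  interpret RC: strict_monoidal_category "rev_cat C"
    by (rule strict_monoidal_category_rev) unfold_locales
  interpret RD: strict_monoidal_category "rev_cat D"
    by (rule strict_monoidal_category_rev) unfold_locales
  show ?thesis
    by unfold_locales (auto simp: mapA map_comp mult_hom mult_natural uni_hom mult_assoc)
qed

section \<open>Strong monoidal functors preserve adjoints\<close>

definition map_counit ::
  "('o, 'm) moncat \<Rightarrow> ('p, 'n) moncat \<Rightarrow> ('o, 'm, 'p, 'n) monfun \<Rightarrow> 'o \<Rightarrow> 'o \<Rightarrow> 'm \<Rightarrow> 'n" where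
  "map_counit C D G X A e = inv_arrow D (Uni G) \<cdot>\<^bsub>D\<^esub> (MapA G e \<cdot>\<^bsub>D\<^esub> Mult G X A)"

definition map_unit ::
  "('o, 'm) moncat \<Rightarrow> ('p, 'n) moncat \<Rightarrow> ('o, 'm, 'p, 'n) monfun \<Rightarrow> 'o \<Rightarrow> 'o \<Rightarrow> 'm \<Rightarrow> 'n" where
  "map_unit C D G X A h = inv_arrow D (Mult G A X) \<cdot>\<^bsub>D\<^esub> (MapA G h \<cdot>\<^bsub>D\<^esub> Uni G)"

context strong_monoidal_functor
begin

text \<open>The unit laws say that the whiskered \<open>Uni G\<close> is a right inverse of an
  isomorphism, hence its inverse.\<close>

lemma inv_mult_uni:
  assumes "A \<in> Obj C"
  shows "inv_arrow D (Mult G A \<one>\<^bsub>C\<^esub>) = Idt D (MapO G A) \<otimes>\<^bsub>D\<^esub> Uni G"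
    and "inv_arrow D (Mult G \<one>\<^bsub>C\<^esub> A) = Uni G \<otimes>\<^bsub>D\<^esub> Idt D (MapO G A)"
  by (rule D.comp_left_cancel[of "Mult G A \<one>\<^bsub>C\<^esub>"]; use assms in simp)
    (rule D.comp_left_cancel[of "Mult G \<one>\<^bsub>C\<^esub> A"]; use assms in simp)

lemma inv_mult_assoc:
  assumes [simp]: "A \<in> Obj C" "B \<in> Obj C" "E \<in> Obj C"
  shows "(Idt D (MapO G A) \<otimes>\<^bsub>D\<^esub> Mult G B E) \<cdot>\<^bsub>D\<^esub> (inv_arrow D (Mult G A B) \<otimes>\<^bsub>D\<^esub> Idt D (MapO G E)) =
      inv_arrow D (Mult G A (B \<odot>\<^bsub>C\<^esub> E)) \<cdot>\<^bsub>D\<^esub> Mult G (A \<odot>\<^bsub>C\<^esub> B) E" (is "?l = ?r")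
proof (rule D.comp_left_cancel[of "Mult G A (B \<odot>\<^bsub>C\<^esub> E)"])
  have "Mult G A (B \<odot>\<^bsub>C\<^esub> E) \<cdot>\<^bsub>D\<^esub> ?l = Mult G (A \<odot>\<^bsub>C\<^esub> B) E \<cdot>\<^bsub>D\<^esub>
      ((Mult G A B \<otimes>\<^bsub>D\<^esub> Idt D (MapO G E)) \<cdot>\<^bsub>D\<^esub> (inv_arrow D (Mult G A B) \<otimes>\<^bsub>D\<^esub> Idt D (MapO G E)))"
    by (rule mult_assoc_cancel) simp_all
  then show "Mult G A (B \<odot>\<^bsub>C\<^esub> E) \<cdot>\<^bsub>D\<^esub> ?l = Mult G A (B \<odot>\<^bsub>C\<^esub> E) \<cdot>\<^bsub>D\<^esub> ?r"
    by (simp add: D.merge)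
qed simp_all

text \<open>The two structure isomorphisms in the middle are rebracketed by associativity;
  naturality then carries them outwards past \<open>MapA G e\<close> and \<open>MapA G h\<close>,
  where the unit laws cancel them. The image of the zigzag in \<open>C\<close> is left in the
  middle.\<close>

lemma map_triangle:
  assumes "adjoint_pair C X A e h"
  shows "(Idt D (MapO G A) \<otimes>\<^bsub>D\<^esub> map_counit C D G X A e) \<cdot>\<^bsub>D\<^esub>
    (map_unit C D G X A h \<otimes>\<^bsub>D\<^esub> Idt D (MapO G A)) = Idt D (MapO G A)"
proof -
  note [simp] = C.adjointD(1-8)[OF assms]
  let ?i = "Idt D (MapO G A)"
  note 1 = inv_mult_assoc[of A X A, simplified]
  note 2 = inv_mult_uni(1)[of A]
  have 3: "(?i \<otimes>\<^bsub>D\<^esub> MapA G e) \<cdot>\<^bsub>D\<^esub> inv_arrow D (Mult G A (X \<odot>\<^bsub>C\<^esub> A)) =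
      inv_arrow D (Mult G A \<one>\<^bsub>C\<^esub>) \<cdot>\<^bsub>D\<^esub> MapA G (Idt C A \<otimes>\<^bsub>C\<^esub> e)"
    using inv_mult_natural[of "Idt C A" e A "X \<odot>\<^bsub>C\<^esub> A"] by simp
  have 4: "Mult G (A \<odot>\<^bsub>C\<^esub> X) A \<cdot>\<^bsub>D\<^esub> (MapA G h \<otimes>\<^bsub>D\<^esub> ?i) =
      MapA G (h \<otimes>\<^bsub>C\<^esub> Idt C A) \<cdot>\<^bsub>D\<^esub> Mult G \<one>\<^bsub>C\<^esub> A"
    using mult_natural_arr[of h "Idt C A" "A \<odot>\<^bsub>C\<^esub> X" A] by simp
  have "(?i \<otimes>\<^bsub>D\<^esub> map_counit C D G X A e) \<cdot>\<^bsub>D\<^esub> (map_unit C D G X A h \<otimes>\<^bsub>D\<^esub> ?i) =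
    (?i \<otimes>\<^bsub>D\<^esub> inv_arrow D (Uni G)) \<cdot>\<^bsub>D\<^esub> ((?i \<otimes>\<^bsub>D\<^esub> MapA G e) \<cdot>\<^bsub>D\<^esub>
      (((?i \<otimes>\<^bsub>D\<^esub> Mult G X A) \<cdot>\<^bsub>D\<^esub> (inv_arrow D (Mult G A X) \<otimes>\<^bsub>D\<^esub> ?i)) \<cdot>\<^bsub>D\<^esub>
      ((MapA G h \<otimes>\<^bsub>D\<^esub> ?i) \<cdot>\<^bsub>D\<^esub> (Uni G \<otimes>\<^bsub>D\<^esub> ?i))))"
    by (simp add: map_counit_def map_unit_def D.whisker_left_comp D.whisker_right_comp)
  also have "\<dots> = (?i \<otimes>\<^bsub>D\<^esub> inv_arrow D (Uni G)) \<cdot>\<^bsub>D\<^esub>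
     (((?i \<otimes>\<^bsub>D\<^esub> MapA G e) \<cdot>\<^bsub>D\<^esub> inv_arrow D (Mult G A (X \<odot>\<^bsub>C\<^esub> A))) \<cdot>\<^bsub>D\<^esub>
      ((Mult G (A \<odot>\<^bsub>C\<^esub> X) A \<cdot>\<^bsub>D\<^esub> (MapA G h \<otimes>\<^bsub>D\<^esub> ?i)) \<cdot>\<^bsub>D\<^esub> (Uni G \<otimes>\<^bsub>D\<^esub> ?i)))"
    unfolding 1 by simp
  also have "\<dots> = ((?i \<otimes>\<^bsub>D\<^esub> inv_arrow D (Uni G)) \<cdot>\<^bsub>D\<^esub> inv_arrow D (Mult G A \<one>\<^bsub>C\<^esub>)) \<cdot>\<^bsub>D\<^esub>
     ((MapA G (Idt C A \<otimes>\<^bsub>C\<^esub> e) \<cdot>\<^bsub>D\<^esub> MapA G (h \<otimes>\<^bsub>C\<^esub> Idt C A)) \<cdot>\<^bsub>D\<^esub>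
      (Mult G \<one>\<^bsub>C\<^esub> A \<cdot>\<^bsub>D\<^esub> (Uni G \<otimes>\<^bsub>D\<^esub> ?i)))"
    unfolding 3 4 by simp
  also have "(?i \<otimes>\<^bsub>D\<^esub> inv_arrow D (Uni G)) \<cdot>\<^bsub>D\<^esub> inv_arrow D (Mult G A \<one>\<^bsub>C\<^esub>) = ?i"
    by (simp add: 2 D.merge)
  also have "MapA G (Idt C A \<otimes>\<^bsub>C\<^esub> e) \<cdot>\<^bsub>D\<^esub> MapA G (h \<otimes>\<^bsub>C\<^esub> Idt C A) = ?i"
    by (simp add: map_comp_arr[symmetric] C.adjointD(9)[OF assms])
  finally show ?thesis
    by simp
qed

end

text \<open>The second triangle is \<open>map_triangle\<close> for \<open>G\<close> regarded as a
  functor between the reversed categories.\<close>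

lemma (in strong_monoidal_functor) map_adjoint:
  assumes "adjoint_pair C X A e h"
  shows "adjoint_pair D (MapO G X) (MapO G A) (map_counit C D G X A e) (map_unit C D G X A h)"
proof -
  note [simp] = C.adjointD(1-8)[OF assms]
  interpret R: strong_monoidal_functor "rev_cat C" "rev_cat D" "G\<lparr>Mult := \<lambda>A B. Mult G B A\<rparr>"
    by (rule functor_rev) unfold_locales
  have [simp]: "inv_arrow (rev_cat D) = inv_arrow D"
    by (simp add: inv_arrow_def fun_eq_iff)
  show ?thesis
  proof (rule D.adjointI)
    show "(map_counit C D G X A e \<otimes>\<^bsub>D\<^esub> Idt D (MapO G X)) \<cdot>\<^bsub>D\<^esub>
        (Idt D (MapO G X) \<otimes>\<^bsub>D\<^esub> map_unit C D G X A h) = Idt D (MapO G X)"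
      using R.map_triangle[of A X e h] assms
      by (simp add: adjoint_pair_rev map_counit_def map_unit_def)
  qed (use map_triangle[OF assms] in \<open>simp_all add: map_counit_def map_unit_def\<close>)
qed

section \<open>Composite functors and isomorphisms between them\<close>

lemma functor_comp:
  assumes "strong_monoidal_functor C D G" "strong_monoidal_functor D E H"
  shows "strong_monoidal_functor C E (comp_fun E H G)"
proof -
  interpret G: strong_monoidal_functor C D G by fact
  interpret H: strong_monoidal_functor D E H by fact
  show ?thesis
  proof unfold_locales
    fix A B F assume [simp]: "A \<in> Obj C" "B \<in> Obj C" "F \<in> Obj C"
    let ?f = "MapO (comp_fun E H G)" and ?m = "Mult (comp_fun E H G)"
    have "?m (A \<odot>\<^bsub>C\<^esub> B) F \<cdot>\<^bsub>E\<^esub> (?m A B \<otimes>\<^bsub>E\<^esub> Idt E (?f F)) =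
      MapA H (Mult G (A \<odot>\<^bsub>C\<^esub> B) F) \<cdot>\<^bsub>E\<^esub> ((Mult H (MapO G (A \<odot>\<^bsub>C\<^esub> B)) (MapO G F) \<cdot>\<^bsub>E\<^esub>
        (MapA H (Mult G A B) \<otimes>\<^bsub>E\<^esub> MapA H (Idt D (MapO G F)))) \<cdot>\<^bsub>E\<^esub>
        (Mult H (MapO G A) (MapO G B) \<otimes>\<^bsub>E\<^esub> Idt E (?f F)))"
      by (simp add: comp_fun_def H.D.whisker_right_comp)
    also have "\<dots> = MapA H (Mult G (A \<odot>\<^bsub>C\<^esub> B) F \<cdot>\<^bsub>D\<^esub> (Mult G A B \<otimes>\<^bsub>D\<^esub> Idt D (MapO G F))) \<cdot>\<^bsub>E\<^esub>
        (Mult H (MapO G A \<odot>\<^bsub>D\<^esub> MapO G B) (MapO G F) \<cdot>\<^bsub>E\<^esub>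
        (Mult H (MapO G A) (MapO G B) \<otimes>\<^bsub>E\<^esub> Idt E (MapO H (MapO G F))))"
      by (subst H.mult_natural_arr) (simp_all add: H.map_comp_arr comp_fun_def)
    also have "\<dots> = MapA H (Mult G A (B \<odot>\<^bsub>C\<^esub> F) \<cdot>\<^bsub>D\<^esub> (Idt D (MapO G A) \<otimes>\<^bsub>D\<^esub> Mult G B F)) \<cdot>\<^bsub>E\<^esub>
        (Mult H (MapO G A) (MapO G B \<odot>\<^bsub>D\<^esub> MapO G F) \<cdot>\<^bsub>E\<^esub>
        (Idt E (MapO H (MapO G A)) \<otimes>\<^bsub>E\<^esub> Mult H (MapO G B) (MapO G F)))"
      by (simp add: G.mult_assoc H.mult_assoc)
    also have "\<dots> = MapA H (Mult G A (B \<odot>\<^bsub>C\<^esub> F)) \<cdot>\<^bsub>E\<^esub> ((Mult H (MapO G A) (MapO G (B \<odot>\<^bsub>C\<^esub> F)) \<cdot>\<^bsub>E\<^esub>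
        (MapA H (Idt D (MapO G A)) \<otimes>\<^bsub>E\<^esub> MapA H (Mult G B F))) \<cdot>\<^bsub>E\<^esub>
        (Idt E (?f A) \<otimes>\<^bsub>E\<^esub> Mult H (MapO G B) (MapO G F)))"
      by (subst H.mult_natural_arr) (simp_all add: H.map_comp_arr comp_fun_def)
    also have "\<dots> = ?m A (B \<odot>\<^bsub>C\<^esub> F) \<cdot>\<^bsub>E\<^esub> (Idt E (?f A) \<otimes>\<^bsub>E\<^esub> ?m B F)"
      by (simp add: comp_fun_def H.D.whisker_left_comp)
    finally show "?m (A \<odot>\<^bsub>C\<^esub> B) F \<cdot>\<^bsub>E\<^esub> (?m A B \<otimes>\<^bsub>E\<^esub> Idt E (?f F)) =
      ?m A (B \<odot>\<^bsub>C\<^esub> F) \<cdot>\<^bsub>E\<^esub> (Idt E (?f A) \<otimes>\<^bsub>E\<^esub> ?m B F)" .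
  next
    fix A assume [simp]: "A \<in> Obj C"
    have "MapA H (Mult G \<one>\<^bsub>C\<^esub> A) \<cdot>\<^bsub>E\<^esub> ((Mult H (MapO G \<one>\<^bsub>C\<^esub>) (MapO G A) \<cdot>\<^bsub>E\<^esub>
       (MapA H (Uni G) \<otimes>\<^bsub>E\<^esub> MapA H (Idt D (MapO G A)))) \<cdot>\<^bsub>E\<^esub> (Uni H \<otimes>\<^bsub>E\<^esub> Idt E (MapO H (MapO G A))))
       = MapA H (Mult G \<one>\<^bsub>C\<^esub> A \<cdot>\<^bsub>D\<^esub> (Uni G \<otimes>\<^bsub>D\<^esub> Idt D (MapO G A))) \<cdot>\<^bsub>E\<^esub>
        (Mult H \<one>\<^bsub>D\<^esub> (MapO G A) \<cdot>\<^bsub>E\<^esub> (Uni H \<otimes>\<^bsub>E\<^esub> Idt E (MapO H (MapO G A))))"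
      by (subst H.mult_natural_arr) (simp_all add: H.map_comp_arr del: G.mult_uni_left H.mult_uni_left)
    then show "Mult (comp_fun E H G) \<one>\<^bsub>C\<^esub> A \<cdot>\<^bsub>E\<^esub> (Uni (comp_fun E H G) \<otimes>\<^bsub>E\<^esub> Idt E (MapO (comp_fun E H G) A)) =
        Idt E (MapO (comp_fun E H G) A)"
      by (simp add: comp_fun_def H.D.whisker_right_comp)
    have "MapA H (Mult G A \<one>\<^bsub>C\<^esub>) \<cdot>\<^bsub>E\<^esub> ((Mult H (MapO G A) (MapO G \<one>\<^bsub>C\<^esub>) \<cdot>\<^bsub>E\<^esub>
       (MapA H (Idt D (MapO G A)) \<otimes>\<^bsub>E\<^esub> MapA H (Uni G))) \<cdot>\<^bsub>E\<^esub> (Idt E (MapO H (MapO G A)) \<otimes>\<^bsub>E\<^esub> Uni H))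
       = MapA H (Mult G A \<one>\<^bsub>C\<^esub> \<cdot>\<^bsub>D\<^esub> (Idt D (MapO G A) \<otimes>\<^bsub>D\<^esub> Uni G)) \<cdot>\<^bsub>E\<^esub>
        (Mult H (MapO G A) \<one>\<^bsub>D\<^esub> \<cdot>\<^bsub>E\<^esub> (Idt E (MapO H (MapO G A)) \<otimes>\<^bsub>E\<^esub> Uni H))"
      by (subst H.mult_natural_arr) (simp_all add: H.map_comp_arr del: G.mult_uni_right H.mult_uni_right)
    then show "Mult (comp_fun E H G) A \<one>\<^bsub>C\<^esub> \<cdot>\<^bsub>E\<^esub> (Idt E (MapO (comp_fun E H G) A) \<otimes>\<^bsub>E\<^esub> Uni (comp_fun E H G)) =
        Idt E (MapO (comp_fun E H G) A)"
      by (simp add: comp_fun_def H.D.whisker_left_comp)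
  next
    fix f f' A B A' B' assume f: "f \<in> hom C A B" "f' \<in> hom C A' B'"
    note [simp] = G.C.homD[OF f(1)] G.C.homD[OF f(2)]
    have "MapA H (Mult G B B') \<cdot>\<^bsub>E\<^esub> (Mult H (MapO G B) (MapO G B') \<cdot>\<^bsub>E\<^esub>
        (MapA H (MapA G f) \<otimes>\<^bsub>E\<^esub> MapA H (MapA G f'))) =
      MapA H (Mult G B B' \<cdot>\<^bsub>D\<^esub> (MapA G f \<otimes>\<^bsub>D\<^esub> MapA G f')) \<cdot>\<^bsub>E\<^esub> Mult H (MapO G A) (MapO G A')"
      by (subst H.mult_natural_arr) (simp_all add: H.map_comp_arr)
    also have "\<dots> = MapA H (MapA G (f \<otimes>\<^bsub>C\<^esub> f')) \<cdot>\<^bsub>E\<^esub> (MapA H (Mult G A A') \<cdot>\<^bsub>E\<^esub> Mult H (MapO G A) (MapO G A'))"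
      by (subst G.mult_natural_arr) (simp_all add: H.map_comp_arr)
    finally show "Mult (comp_fun E H G) B B' \<cdot>\<^bsub>E\<^esub> (MapA (comp_fun E H G) f \<otimes>\<^bsub>E\<^esub> MapA (comp_fun E H G) f') =
       MapA (comp_fun E H G) (f \<otimes>\<^bsub>C\<^esub> f') \<cdot>\<^bsub>E\<^esub> Mult (comp_fun E H G) A A'"
      by (simp add: comp_fun_def)
  qed (auto simp: comp_fun_def H.D.hom_iff G.C.hom_iff G.map_comp_arr H.map_comp_arr)
qed

text \<open>The components are the images under \<open>H\<close> of those of the given isomorphism;
  naturality of \<open>Mult H\<close> makes them compatible with the composite structure
  arrows.\<close>

lemma fun_iso_whisker:
  assumes "strong_monoidal_functor C D G" "strong_monoidal_functor C D G'"
    and "strong_monoidal_functor D E H" and "fun_iso C D G G'"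
  shows "fun_iso C E (comp_fun E H G) (comp_fun E H G')"
proof -
  interpret G: strong_monoidal_functor C D G by fact
  interpret G': strong_monoidal_functor C D G' by fact
  interpret H: strong_monoidal_functor D E H by fact
  obtain t where t: "\<forall>A\<in>Obj C. t A \<in> hom D (MapO G A) (MapO G' A) \<and> iso_arrow D (t A)"
    and nat: "\<forall>A\<in>Obj C. \<forall>B\<in>Obj C. \<forall>f\<in>hom C A B. t B \<cdot>\<^bsub>D\<^esub> MapA G f = MapA G' f \<cdot>\<^bsub>D\<^esub> t A"
    and mult: "\<forall>A\<in>Obj C. \<forall>B\<in>Obj C.
        t (A \<odot>\<^bsub>C\<^esub> B) \<cdot>\<^bsub>D\<^esub> Mult G A B = Mult G' A B \<cdot>\<^bsub>D\<^esub> (t A \<otimes>\<^bsub>D\<^esub> t B)"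
    and uni: "t \<one>\<^bsub>C\<^esub> \<cdot>\<^bsub>D\<^esub> Uni G = Uni G'"
    using assms(4) unfolding fun_iso_def by blast
  have [simp]: "t A \<in> Arr D" "Dom D (t A) = MapO G A" "Cod D (t A) = MapO G' A" "iso_arrow D (t A)"
    if "A \<in> Obj C" for A
    using t that by (auto simp: hom_def)
  show ?thesis
    unfolding fun_iso_def
  proof (intro exI[of _ "\<lambda>A. MapA H (t A)"] conjI ballI)
    fix A B f assume A [simp]: "A \<in> Obj C" "B \<in> Obj C" and f: "f \<in> hom C A B"
    note [simp] = G.C.homD(1-3)[OF f]
    show "MapA H (t B) \<cdot>\<^bsub>E\<^esub> MapA (comp_fun E H G) f = MapA (comp_fun E H G') f \<cdot>\<^bsub>E\<^esub> MapA H (t A)"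
      using nat[rule_format, OF A f] by (simp add: comp_fun_def H.map_comp_arr[symmetric])
  next
    fix A B assume A [simp]: "A \<in> Obj C" "B \<in> Obj C"
    have "MapA H (t (A \<odot>\<^bsub>C\<^esub> B)) \<cdot>\<^bsub>E\<^esub> Mult (comp_fun E H G) A B =
        MapA H (t (A \<odot>\<^bsub>C\<^esub> B) \<cdot>\<^bsub>D\<^esub> Mult G A B) \<cdot>\<^bsub>E\<^esub> Mult H (MapO G A) (MapO G B)"
      by (simp add: comp_fun_def H.map_comp_arr)
    also have "\<dots> = MapA H (Mult G' A B) \<cdot>\<^bsub>E\<^esub> (MapA H (t A \<otimes>\<^bsub>D\<^esub> t B) \<cdot>\<^bsub>E\<^esub> Mult H (MapO G A) (MapO G B))"
      unfolding mult[rule_format, OF A] by (simp add: H.map_comp_arr)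
    also have "MapA H (t A \<otimes>\<^bsub>D\<^esub> t B) \<cdot>\<^bsub>E\<^esub> Mult H (MapO G A) (MapO G B) =
        Mult H (MapO G' A) (MapO G' B) \<cdot>\<^bsub>E\<^esub> (MapA H (t A) \<otimes>\<^bsub>E\<^esub> MapA H (t B))"
      by (subst H.mult_natural_arr) simp_all
    finally show "MapA H (t (A \<odot>\<^bsub>C\<^esub> B)) \<cdot>\<^bsub>E\<^esub> Mult (comp_fun E H G) A B =
        Mult (comp_fun E H G') A B \<cdot>\<^bsub>E\<^esub> (MapA H (t A) \<otimes>\<^bsub>E\<^esub> MapA H (t B))"
      by (simp add: comp_fun_def)
  next
    have "MapA H (t \<one>\<^bsub>C\<^esub>) \<cdot>\<^bsub>E\<^esub> (MapA H (Uni G) \<cdot>\<^bsub>E\<^esub> Uni H) = MapA H (t \<one>\<^bsub>C\<^esub> \<cdot>\<^bsub>D\<^esub> Uni G) \<cdot>\<^bsub>E\<^esub> Uni H"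
      by (simp add: H.map_comp_arr)
    then show "MapA H (t \<one>\<^bsub>C\<^esub>) \<cdot>\<^bsub>E\<^esub> Uni (comp_fun E H G) = Uni (comp_fun E H G')"
      by (simp add: comp_fun_def uni)
  qed (simp_all add: comp_fun_def H.D.hom_iff)
qed

lemma fun_iso_refl:
  assumes "strong_monoidal_functor C D G"
  shows "fun_iso C D G G"
proof -
  interpret strong_monoidal_functor C D G by fact
  show ?thesis
    unfolding fun_iso_def
    by (rule exI[of _ "\<lambda>A. Idt D (MapO G A)"]) (auto simp: D.hom_iff C.hom_iff)
qed

lemma fun_iso_cong:
  assumes "strict_monoidal_category C" "fun_eq C G G'" "fun_eq C H H'" "fun_iso C D G H"
  shows "fun_iso C D G' H'"
proof -
  interpret strict_monoidal_category C by fact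
  have "MapA G f = MapA G' f" "MapA H f = MapA H' f" if "f \<in> hom C A B" for f A B
    using assms(2,3) that by (auto simp: fun_eq_def hom_def)
  then show ?thesis
    using assms(2-4) unfolding fun_iso_def fun_eq_def by (auto cong: conj_cong)
qed

section \<open>Diagrams\<close>

text \<open>For the faithfulness of the embedding, diagrams are considered whose wires all have their
  exponents in a given set \<open>J\<close>; the category \<open>L(C)\<close> is the case \<open>J = UNIV\<close>.\<close>

definition wires_in :: "('o, 'm) moncat \<Rightarrow> int set \<Rightarrow> 'o wire list \<Rightarrow> bool" where
  "wires_in C J X \<longleftrightarrow> wires_ok C X \<and> snd ` set X \<subseteq> J"

fun diagram_in ::
  "('o, 'm) moncat \<Rightarrow> int set \<Rightarrow> 'o wire list \<Rightarrow> ('o, 'm) slice list \<Rightarrow> 'o wire list \<Rightarrow> bool"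
where
  "diagram_in C J X [] Y \<longleftrightarrow> wires_in C J X \<and> X = Y"
| "diagram_in C J X ((u, c, v) # ss) Y \<longleftrightarrow>
     wires_in C J u \<and> cell_ok C c \<and> wires_in C J (cell_dom c) \<and> wires_in C J (cell_cod c) \<and>
     wires_in C J v \<and> X = u @ cell_dom c @ v \<and> diagram_in C J (u @ cell_cod c @ v) ss Y"

inductive diagram_eq_in ::
  "('o, 'm) moncat \<Rightarrow> int set \<Rightarrow> 'o wire list \<Rightarrow> 'o wire list \<Rightarrow>
   ('o, 'm) slice list \<Rightarrow> ('o, 'm) slice list \<Rightarrow> bool" for C J X Y where
  refl: "diagram_in C J X ss Y \<Longrightarrow> diagram_eq_in C J X Y ss ss"
| step: "\<lbrakk>move C l r; diagram_in C J X (ss @ whisker u l v @ ts) Y;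
      diagram_in C J X (ss @ whisker u r v @ ts) Y\<rbrakk>
     \<Longrightarrow> diagram_eq_in C J X Y (ss @ whisker u l v @ ts) (ss @ whisker u r v @ ts)"
| sym: "diagram_eq_in C J X Y ss ts \<Longrightarrow> diagram_eq_in C J X Y ts ss"
| trans: "\<lbrakk>diagram_eq_in C J X Y ss ts; diagram_eq_in C J X Y ts us\<rbrakk> \<Longrightarrow> diagram_eq_in C J X Y ss us"

lemma whisker_simps [simp]:
  "whisker u [] v = []"
  "whisker u ((a, c, b) # ss) v = (u @ a, c, b @ v) # whisker u ss v"
  "whisker u (ss @ ts) v = whisker u ss v @ whisker u ts v"
  "whisker u (whisker u' ss v') v = whisker (u @ u') ss (v' @ v)"
  "whisker [] ss [] = ss"
  "whisker u ss v = [] \<longleftrightarrow> ss = []"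
  by (auto simp: whisker_def)

lemma wires_in_simps [simp]:
  "wires_in C J []"
  "wires_in C J ((A, n) # X) \<longleftrightarrow> A \<in> Obj C \<and> n \<in> J \<and> wires_in C J X"
  "wires_in C J (X @ Y) \<longleftrightarrow> wires_in C J X \<and> wires_in C J Y"
  by (auto simp: wires_in_def wires_ok_def)

lemma plain_simps [simp]:
  "plain [] = []" "plain (A # As) = (A, 0) # plain As" "plain (As @ Bs) = plain As @ plain Bs"
  by (simp_all add: plain_def)

lemma wires_in_plain: "wires_in C J (plain As) \<longleftrightarrow> set As \<subseteq> Obj C \<and> (As = [] \<or> 0 \<in> J)"
  by (induction As) auto

lemma wires_ok_iff: "wires_ok C = wires_in C UNIV"
  by (simp add: wires_in_def fun_eq_iff)

lemma cell_wires_in: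
  assumes "cell_ok C c"
  shows "wires_in C UNIV (cell_dom c)" "wires_in C UNIV (cell_cod c)"
  using assms by (cases c; simp add: wires_in_plain)+

lemma diagram_iff: "diagram C X ss Y \<longleftrightarrow> diagram_in C UNIV X ss Y"
  by (induction C X ss Y rule: diagram.induct) (auto simp: wires_ok_iff cell_wires_in)

lemma diagram_eq_iff: "diagram_eq C X Y ss ts \<longleftrightarrow> diagram_eq_in C UNIV X Y ss ts"
proof
  show "diagram_eq_in C UNIV X Y ss ts" if "diagram_eq C X Y ss ts"
    using that by (induction) (auto simp: diagram_iff intro: diagram_eq_in.intros)
  show "diagram_eq C X Y ss ts" if "diagram_eq_in C UNIV X Y ss ts"
    using that by (induction) (auto simp: diagram_iff intro: diagram_eq.intros)
qed

lemma diagram_in_append: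
  "diagram_in C J X (ss @ ts) Y \<longleftrightarrow> (\<exists>Z. diagram_in C J X ss Z \<and> diagram_in C J Z ts Y)"
proof (induction ss arbitrary: X)
  case Nil
  have "diagram_in C J X ts Y \<Longrightarrow> wires_in C J X"
    by (cases ts) auto
  then show ?case
    by auto
qed auto

lemma diagram_in_appendI:
  "\<lbrakk>diagram_in C J X ss Y; diagram_in C J Y ts Z\<rbrakk> \<Longrightarrow> diagram_in C J X (ss @ ts) Z"
  by (auto simp: diagram_in_append)

lemma diagram_in_ends:
  "diagram_in C J X ss Y \<Longrightarrow> wires_in C J X"
  "diagram_in C J X ss Y \<Longrightarrow> wires_in C J Y"
  by (induction C J X ss Y rule: diagram_in.induct) auto

lemma diagram_in_functional:
  "diagram_in C J X ss Y \<Longrightarrow> diagram_in C J X ss Y' \<Longrightarrow> Y = Y'"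
  by (induction C J X ss Y rule: diagram_in.induct) auto

lemma diagram_in_source:
  "diagram_in C J X ss Y \<Longrightarrow> diagram_in C J X' ss Y \<Longrightarrow> X = X'"
  by (cases ss) auto

lemma diagram_in_whisker:
  "\<lbrakk>diagram_in C J X ss Y; wires_in C J u; wires_in C J v\<rbrakk>
    \<Longrightarrow> diagram_in C J (u @ X @ v) (whisker u ss v) (u @ Y @ v)"
  by (induction C J X ss Y rule: diagram_in.induct) auto

lemma diagram_in_whisker_left:
  "\<lbrakk>diagram_in C J X ss Y; wires_in C J u\<rbrakk> \<Longrightarrow> diagram_in C J (u @ X) (whisker u ss []) (u @ Y)"
  using diagram_in_whisker[of C J X ss Y u "[]"] by simp

lemma diagram_in_whisker_right:
  "\<lbrakk>diagram_in C J X ss Y; wires_in C J v\<rbrakk> \<Longrightarrow> diagram_in C J (X @ v) (whisker [] ss v) (Y @ v)"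
  using diagram_in_whisker[of C J X ss Y "[]" v] by simp

lemma diagram_in_mono: "diagram_in C J X ss Y \<Longrightarrow> J \<subseteq> J' \<Longrightarrow> diagram_in C J' X ss Y"
  by (induction C J X ss Y rule: diagram_in.induct) (auto simp: wires_in_def)

text \<open>A slice displays all the wires at its height, so the whiskers \<open>u\<close> and
  \<open>v\<close> can be stripped off. An empty list displays nothing, whence the assumption
  \<open>ss \<noteq> []\<close>.\<close>

lemma diagram_in_whiskerD:
  assumes "diagram_in C J X (whisker u ss v) Y" "ss \<noteq> []"
  obtains a b where "X = u @ a @ v" "Y = u @ b @ v" "diagram_in C J a ss b"
    "wires_in C J u" "wires_in C J v"
proof -
  have "\<exists>a b. X = u @ a @ v \<and> Y = u @ b @ v \<and> diagram_in C J a ss b \<and> wires_in C J u \<and> wires_in C J v"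
    using assms
  proof (induction ss arbitrary: X)
    case (Cons s ss)
    obtain x c y where s: "s = (x, c, y)"
      by (cases s)
    show ?case
    proof (cases "ss = []")
      case True
      then show ?thesis
        using Cons.prems by (auto simp: s)
    next
      case False
      have "diagram_in C J (u @ x @ cell_cod c @ y @ v) (whisker u ss v) Y"
        using Cons.prems by (simp add: s)
      from Cons.IH[OF this False] show ?thesis
        using Cons.prems by (auto simp: s)
    qed
  qed simp
  then show ?thesis
    using that by blast
qed

lemma move_nonempty: "move C l r \<Longrightarrow> l \<noteq> []"
  by (induction rule: move.induct) auto

lemma diagram_eq_inD:
  "diagram_eq_in C J X Y ss ts \<Longrightarrow> diagram_in C J X ss Y \<and> diagram_in C J X ts Y"
  by (induction rule: diagram_eq_in.induct) auto

text \<open>In contrast to the generated rule, the two sides of the move come as diagrams with the same ends.\<close>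

lemma diagram_eq_in_induct [consumes 1, case_names refl step sym trans]:
  assumes "diagram_eq_in C J X Y ss ts"
    and "\<And>ss. diagram_in C J X ss Y \<Longrightarrow> P ss ss"
    and "\<And>l r a b u v ss ts. \<lbrakk>move C l r; diagram_in C J a l b; diagram_in C J a r b;
        wires_in C J u; wires_in C J v; diagram_in C J X ss (u @ a @ v);
        diagram_in C J (u @ b @ v) ts Y\<rbrakk>
      \<Longrightarrow> P (ss @ whisker u l v @ ts) (ss @ whisker u r v @ ts)"
    and "\<And>ss ts. \<lbrakk>diagram_eq_in C J X Y ss ts; P ss ts\<rbrakk> \<Longrightarrow> P ts ss"
    and "\<And>ss ts us. \<lbrakk>diagram_eq_in C J X Y ss ts; P ss ts; diagram_eq_in C J X Y ts us; P ts us\<rbrakk>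
      \<Longrightarrow> P ss us"
  shows "P ss ts"
  using assms(1)
proof induction
  case (step l r ss u v ts)
  from step(2) obtain Z Z' where 1: "diagram_in C J X ss Z" "diagram_in C J Z (whisker u l v) Z'"
      "diagram_in C J Z' ts Y"
    by (auto simp: diagram_in_append)
  from diagram_in_whiskerD[OF 1(2) move_nonempty[OF step(1)]]
  obtain a b where 2: "Z = u @ a @ v" "Z' = u @ b @ v" "diagram_in C J a l b"
      "wires_in C J u" "wires_in C J v"
    by blast
  from step(3) obtain W where 3: "diagram_in C J Z (whisker u r v) W" "diagram_in C J W ts Y"
    using diagram_in_functional[OF 1(1)] by (auto simp: diagram_in_append)
  \<comment> \<open>The tail \<open>ts\<close> is common to both sides, and together with its end
    \<open>Y\<close> it determines the object at which it starts.\<close>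
  have W: "W = Z'"
    using diagram_in_source[OF 1(3) 3(2)] by simp
  have "diagram_in C J a r b"
  proof (cases "r = []")
    \<comment> \<open>An empty right-hand side does not display its whiskers; here both ends of the
      move coincide, and \<open>a = b\<close> follows by cancelling \<open>u\<close> and
      \<open>v\<close>.\<close>
    case True
    then have "u @ a @ v = u @ b @ v"
      using 2 3 W by simp
    then show ?thesis
      using True 2(3) diagram_in_ends(1) by auto
  next
    case False
    from diagram_in_whiskerD[OF 3(1) this] show ?thesis
      using 2 W by (metis append_same_eq same_append_eq)
  qed
  then show ?case
    using 1 2 step(1) by (intro assms(3)) auto
qed (use assms in blast)+

section \<open>Congruence and interchange for equality of diagrams\<close>

lemma diagram_eq_in_append_left:
  "\<lbrakk>diagram_eq_in C J Y Z ts ts'; diagram_in C J X ss Y\<rbrakk>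
    \<Longrightarrow> diagram_eq_in C J X Z (ss @ ts) (ss @ ts')"
proof (induction rule: diagram_eq_in.induct)
  case (step l r ss' u v ts')
  then show ?case
    using diagram_eq_in.step[of C l r J X "ss @ ss'" u v ts' Z] by (auto simp: diagram_in_append)
qed (auto simp: diagram_in_append intro!: diagram_eq_in.refl intro: diagram_eq_in.sym diagram_eq_in.trans)

lemma diagram_eq_in_append_right:
  "\<lbrakk>diagram_eq_in C J X Y ss ss'; diagram_in C J Y ts Z\<rbrakk>
    \<Longrightarrow> diagram_eq_in C J X Z (ss @ ts) (ss' @ ts)"
proof (induction rule: diagram_eq_in.induct)
  case (step l r ss' u v ts')
  then have "diagram_eq_in C J X Z (ss' @ whisker u l v @ ts' @ ts) (ss' @ whisker u r v @ ts' @ ts)"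
    by (intro diagram_eq_in.step) (auto simp: diagram_in_append)
  then show ?case
    by simp
qed (auto simp: diagram_in_append intro!: diagram_eq_in.refl intro: diagram_eq_in.sym diagram_eq_in.trans)

lemma diagram_eq_in_append:
  "\<lbrakk>diagram_eq_in C J X Y ss ss'; diagram_eq_in C J Y Z ts ts'\<rbrakk>
    \<Longrightarrow> diagram_eq_in C J X Z (ss @ ts) (ss' @ ts')"
  using diagram_eq_in_append_left diagram_eq_in_append_right diagram_eq_inD diagram_eq_in.trans
  by metis

lemma diagram_eq_in_whisker:
  "\<lbrakk>diagram_eq_in C J X Y ss ts; wires_in C J u; wires_in C J v\<rbrakk>
    \<Longrightarrow> diagram_eq_in C J (u @ X @ v) (u @ Y @ v) (whisker u ss v) (whisker u ts v)"
proof (induction rule: diagram_eq_in.induct)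
  case (step l r ss' u' v' ts')
  have "diagram_eq_in C J (u @ X @ v) (u @ Y @ v)
    (whisker u ss' v @ whisker (u @ u') l (v' @ v) @ whisker u ts' v)
    (whisker u ss' v @ whisker (u @ u') r (v' @ v) @ whisker u ts' v)"
    using diagram_in_whisker[OF step(2,4,5)] diagram_in_whisker[OF step(3,4,5)] step(1)
    by (intro diagram_eq_in.step) auto
  then show ?case
    by simp
qed (auto intro: diagram_eq_in.intros diagram_in_whisker)

lemma diagram_eq_in_whisker_left:
  "\<lbrakk>diagram_eq_in C J X Y ss ts; wires_in C J u\<rbrakk>
    \<Longrightarrow> diagram_eq_in C J (u @ X) (u @ Y) (whisker u ss []) (whisker u ts [])"
  using diagram_eq_in_whisker[of C J X Y ss ts u "[]"] by simp

lemma diagram_eq_in_whisker_right: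
  "\<lbrakk>diagram_eq_in C J X Y ss ts; wires_in C J v\<rbrakk>
    \<Longrightarrow> diagram_eq_in C J (X @ v) (Y @ v) (whisker [] ss v) (whisker [] ts v)"
  using diagram_eq_in_whisker[of C J X Y ss ts "[]" v] by simp

lemma move_diagram_eq:
  "\<lbrakk>move C l r; diagram_in C J X l Y; diagram_in C J X r Y\<rbrakk> \<Longrightarrow> diagram_eq_in C J X Y l r"
  using diagram_eq_in.step[of C l r J X "[]" "[]" "[]" "[]" Y] by simp

text \<open>The exchange move swaps two cells only; by induction on \<open>ts\<close> a single slice
  on the left passes a whole diagram on the right.\<close>

lemma slice_interchange:
  assumes "diagram_in C J X [(a, c, b)] Y" "diagram_in C J X' ts Y'"
  shows "diagram_eq_in C J (X @ X') (Y @ Y')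
    ((a, c, b @ X') # whisker Y ts []) (whisker X ts [] @ [(a, c, b @ Y')])"
  using assms(2)
proof (induction ts arbitrary: X')
  case Nil
  then show ?case
    using assms(1) by (auto intro!: diagram_eq_in.refl)
next
  case (Cons t ts)
  obtain a' d b' where t: "t = (a', d, b')"
    by (cases t)
  define Z where "Z = a' @ cell_cod d @ b'"
  have X': "X' = a' @ cell_dom d @ b'" and Z: "diagram_in C J Z ts Y'"
    using Cons.prems by (auto simp: t Z_def)
  have ok: "wires_in C J a'" "wires_in C J b'" "wires_in C J (cell_dom d)" "wires_in C J (cell_cod d)"
      "cell_ok C d"
    using Cons.prems by (auto simp: t)
  have XY: "X = a @ cell_dom c @ b" "Y = a @ cell_cod c @ b"
    using assms(1) by auto
  \<comment> \<open>The wires between the two cells are \<open>b @ a'\<close>, which is the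
    \<open>w\<close> of the exchange move; the outer wires \<open>a\<close> and \<open>b'\<close>
    are its whiskers.\<close>
  have "diagram_eq_in C J (X @ X') (Y @ Z)
    (whisker a [([], c, (b @ a') @ cell_dom d), (cell_cod c @ b @ a', d, [])] b')
    (whisker a [(cell_dom c @ b @ a', d, []), ([], c, (b @ a') @ cell_cod d)] b')"
    using assms(1) ok diagram_eq_in.step[OF move.exchange[of C c "b @ a'" d],
        of J "X @ X'" "[]" a b' "[]" "Y @ Z"]
    by (simp add: X' XY Z_def)
  then have "diagram_eq_in C J (X @ X') (Y @ Z)
      [(a, c, b @ X'), (Y @ a', d, b')] [(X @ a', d, b'), (a, c, b @ Z)]"
    by (simp add: X' XY Z_def)
  moreover have "diagram_in C J (Y @ Z) (whisker Y ts []) (Y @ Y')"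
    using assms(1) diagram_in_ends by (intro diagram_in_whisker_left Z) auto
  ultimately have "diagram_eq_in C J (X @ X') (Y @ Y')
      ((a, c, b @ X') # (Y @ a', d, b') # whisker Y ts []) ((X @ a', d, b') # (a, c, b @ Z) # whisker Y ts [])"
    using diagram_eq_in_append_right by fastforce
  moreover have "diagram_eq_in C J (X @ X') (Y @ Y')
      ([(X @ a', d, b')] @ (a, c, b @ Z) # whisker Y ts [])
      ([(X @ a', d, b')] @ whisker X ts [] @ [(a, c, b @ Y')])"
    using assms(1) ok
    by (intro diagram_eq_in_append_left[OF Cons.IH[OF Z]]) (auto simp: X' XY Z_def)
  ultimately show ?case
    by (auto simp: t intro: diagram_eq_in.trans)
qed

text \<open>The slices of \<open>ss\<close> pass \<open>ts\<close> one by one. Besides the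
  interchange law of \<open>L(C)\<close> this yields, for general \<open>J\<close>, the naturality
  of the action of old cells on copresheaves.\<close>

lemma diagram_interchange:
  assumes "diagram_in C J X ss Y" "diagram_in C J X' ts Y'"
  shows "diagram_eq_in C J (X @ X') (Y @ Y')
    (whisker [] ss X' @ whisker Y ts []) (whisker X ts [] @ whisker [] ss Y')"
  using assms(1)
proof (induction ss arbitrary: X)
  case Nil
  then show ?case
    using assms(2) by (auto intro!: diagram_eq_in.refl diagram_in_whisker_left)
next
  case (Cons s ss)
  obtain a c b where s: "s = (a, c, b)"
    by (cases s)
  define Z where "Z = a @ cell_cod c @ b"
  have 1: "diagram_in C J X [s] Z" and 2: "diagram_in C J Z ss Y"
    using Cons.prems diagram_in_ends by (auto simp: s Z_def)
  have "diagram_eq_in C J (X @ X') (Y @ Y')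
      (whisker [] [s] X' @ whisker [] ss X' @ whisker Y ts [])
      (whisker [] [s] X' @ whisker Z ts [] @ whisker [] ss Y')"
    using 1 assms(2) diagram_in_ends
    by (intro diagram_eq_in_append_left[OF Cons.IH[OF 2]] diagram_in_whisker_right) auto
  moreover have "diagram_eq_in C J (X @ X') (Y @ Y')
      (((a, c, b @ X') # whisker Z ts []) @ whisker [] ss Y')
      ((whisker X ts [] @ [(a, c, b @ Y')]) @ whisker [] ss Y')"
    using 1 2 assms(2) diagram_in_ends unfolding s
    by (intro diagram_eq_in_append_right[OF slice_interchange] diagram_in_whisker_right) auto
  ultimately show ?case
    by (auto simp: s intro: diagram_eq_in.trans)
qed

section \<open>The monoidal category \<open>L(C)\<close>\<close>

lemma larr_eq_iff:
  assumes "diagram_in C UNIV X ss Y"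
  shows "larr C X ss Y = larr C X' ts Y' \<longleftrightarrow> X = X' \<and> Y = Y' \<and> diagram_eq_in C UNIV X Y ss ts"
proof -
  have "diagram_eq_in C UNIV X Y ss ss"
    using assms by (rule diagram_eq_in.refl)
  then show ?thesis
    unfolding larr_def diagram_eq_iff
    by (auto simp: set_eq_iff intro: diagram_eq_in.sym diagram_eq_in.trans)
qed

lemma larr_eqI: "diagram_eq_in C UNIV X Y ss ts \<Longrightarrow> larr C X ss Y = larr C X ts Y"
  using larr_eq_iff diagram_eq_inD by metis

lemma larr_ends [simp]: "ldom (larr C X ss Y) = X" "lcod (larr C X ss Y) = Y"
  by (simp_all add: larr_def ldom_def lcod_def)

lemma lrep_eq:
  assumes "diagram_in C UNIV X ss Y"
  shows "diagram_eq_in C UNIV X Y ss (lrep (larr C X ss Y))"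
proof -
  have "lrep (larr C X ss Y) \<in> {ts. diagram_eq C X Y ss ts}"
    unfolding lrep_def larr_def using diagram_eq_in.refl[OF assms]
    by (auto simp: diagram_eq_iff intro!: someI[of "\<lambda>ts. diagram_eq_in C UNIV X Y ss ts"])
  then show ?thesis
    by (simp add: diagram_eq_iff)
qed

lemma L_simps [simp]:
  "Obj (L C) = {X. wires_in C UNIV X}"
  "Dom (L C) = ldom" "Cod (L C) = lcod" "Unit (L C) = []" "TensO (L C) = (@)"
  "Idt (L C) X = larr C X [] X"
  by (simp_all add: L_def wires_ok_iff)

lemma L_Arr: "\<phi> \<in> Arr (L C) \<longleftrightarrow> (\<exists>X ss Y. diagram_in C UNIV X ss Y \<and> \<phi> = larr C X ss Y)"
  by (auto simp: L_def diagram_iff)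

lemma larr_Arr [simp]: "diagram_in C UNIV X ss Y \<Longrightarrow> larr C X ss Y \<in> Arr (L C)"
  by (auto simp: L_Arr)

lemma L_homE:
  assumes "\<phi> \<in> hom (L C) X Y"
  obtains ss where "diagram_in C UNIV X ss Y" "\<phi> = larr C X ss Y"
  using assms by (auto simp: hom_def L_Arr)

lemma larr_hom: "diagram_in C UNIV X ss Y \<Longrightarrow> larr C X ss Y \<in> hom (L C) X Y"
  by (simp add: hom_def)

text \<open>The composite is defined by chosen representatives; since equality of diagrams is a
  congruence for concatenation, any representatives may be used.\<close>

lemma L_Comp:
  assumes "diagram_in C UNIV X ss Y" "diagram_in C UNIV Y ts Z"
  shows "Comp (L C) (larr C Y ts Z) (larr C X ss Y) = larr C X (ss @ ts) Z"
proof -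
  have "Comp (L C) (larr C Y ts Z) (larr C X ss Y) =
      larr C X (lrep (larr C X ss Y) @ lrep (larr C Y ts Z)) Z"
    by (simp add: L_def)
  then show ?thesis
    using larr_eqI[OF diagram_eq_in_append[OF lrep_eq lrep_eq]] assms by metis
qed

lemma L_Tens:
  assumes ss: "diagram_in C UNIV X ss Y" and ts: "diagram_in C UNIV X' ts Y'"
  shows "Tens (L C) (larr C X ss Y) (larr C X' ts Y') =
    larr C (X @ X') (whisker [] ss X' @ whisker Y ts []) (Y @ Y')"
proof -
  have "Tens (L C) (larr C X ss Y) (larr C X' ts Y') =
      larr C (X @ X') (whisker [] (lrep (larr C X ss Y)) X' @ whisker Y (lrep (larr C X' ts Y')) [])
      (Y @ Y')"
    by (simp add: L_def)
  also have "\<dots> = larr C (X @ X') (whisker [] ss X' @ whisker Y ts []) (Y @ Y')"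
    using diagram_in_ends[OF ss] diagram_in_ends[OF ts]
    by (intro larr_eqI[symmetric] diagram_eq_in_append[of C UNIV _ "Y @ X'"]
        diagram_eq_in_whisker_right diagram_eq_in_whisker_left lrep_eq assms)
  finally show ?thesis .
qed

lemma whisker_diagrams:
  assumes "diagram_in C J X ss Y" "diagram_in C J X' ts Y'"
  shows "diagram_in C J (X @ X') (whisker [] ss X') (Y @ X')"
    "diagram_in C J (Y @ X') (whisker Y ts []) (Y @ Y')"
    "diagram_in C J (X @ X') (whisker [] ss X' @ whisker Y ts []) (Y @ Y')"
proof -
  show 1: "diagram_in C J (X @ X') (whisker [] ss X') (Y @ X')"
    using assms diagram_in_ends by (intro diagram_in_whisker_right) auto
  show 2: "diagram_in C J (Y @ X') (whisker Y ts []) (Y @ Y')"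
    using assms diagram_in_ends by (intro diagram_in_whisker_left) auto
  show "diagram_in C J (X @ X') (whisker [] ss X' @ whisker Y ts []) (Y @ Y')"
    using 1 2 by (rule diagram_in_appendI)
qed

text \<open>Concatenation and whiskering of lists are strictly associative and unital, so these laws
  hold already for the slices themselves. Only the interchange law needs moves:
  \<open>diagram_interchange\<close> swaps the two middle quarters.\<close>

theorem strict_monoidal_category_L: "strict_monoidal_category (L C)"
proof
  fix f g f' g' A B E A' B' E'
  assume "f \<in> hom (L C) A B" "g \<in> hom (L C) B E" "f' \<in> hom (L C) A' B'" "g' \<in> hom (L C) B' E'"
  then obtain ss ts ss' ts' where
    f: "diagram_in C UNIV A ss B" "f = larr C A ss B" and g: "diagram_in C UNIV B ts E" "g = larr C B ts E"
    and f': "diagram_in C UNIV A' ss' B'" "f' = larr C A' ss' B'"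
    and g': "diagram_in C UNIV B' ts' E'" "g' = larr C B' ts' E'"
    by (metis L_homE)
  have fg: "diagram_in C UNIV A (ss @ ts) E" and fg': "diagram_in C UNIV A' (ss' @ ts') E'"
    using f g f' g' by (auto simp: diagram_in_append)
  note w = whisker_diagrams[OF f(1) f'(1)] whisker_diagrams[OF g(1) g'(1)]
    whisker_diagrams[OF g(1) f'(1)] whisker_diagrams[OF f(1) g'(1)]
  have "diagram_eq_in C UNIV (A @ A') (E @ E')
     (whisker [] ss A' @ (whisker [] ts A' @ whisker E ss' []) @ whisker E ts' [])
     (whisker [] ss A' @ (whisker B ss' [] @ whisker [] ts B') @ whisker E ts' [])"
    by (intro diagram_eq_in_append_left[OF diagram_eq_in_append_right[OF diagram_interchange]]
        f g f' g' w)
  then show "Tens (L C) (Comp (L C) g f) (Comp (L C) g' f') =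
      Comp (L C) (Tens (L C) g g') (Tens (L C) f f')"
    using w by (simp add: f g f' g' L_Comp[OF f(1) g(1)] L_Comp[OF f'(1) g'(1)] L_Tens[OF fg fg']
        L_Tens[OF f(1) f'(1)] L_Tens[OF g(1) g'(1)] L_Comp larr_eqI)
next
  fix f g h assume "f \<in> Arr (L C)" "g \<in> Arr (L C)" "h \<in> Arr (L C)"
  then obtain A A' ss B B' ts E E' us where d: "diagram_in C UNIV A ss A'"
    "diagram_in C UNIV B ts B'" "diagram_in C UNIV E us E'"
    and e: "f = larr C A ss A'" "g = larr C B ts B'" "h = larr C E us E'"
    unfolding L_Arr by metis
  show "Tens (L C) (Tens (L C) f g) h = Tens (L C) f (Tens (L C) g h)"
    unfolding e L_Tens[OF d(1,2)] L_Tens[OF d(2,3)]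
      L_Tens[OF whisker_diagrams(3)[OF d(1,2)] d(3)] L_Tens[OF d(1) whisker_diagrams(3)[OF d(2,3)]]
    by simp
next
  fix f assume "f \<in> Arr (L C)"
  then obtain A ss B where f: "diagram_in C UNIV A ss B" "f = larr C A ss B"
    unfolding L_Arr by metis
  have 0: "diagram_in C UNIV [] [] []"
    by simp
  show "Tens (L C) (Idt (L C) (Unit (L C))) f = f" "Tens (L C) f (Idt (L C) (Unit (L C))) = f"
    using L_Tens[OF 0 f(1)] L_Tens[OF f(1) 0] by (simp_all add: f)
next
  fix f g A B E assume "f \<in> hom (L C) A B" "g \<in> hom (L C) B E"
  then show "Comp (L C) g f \<in> hom (L C) A E"
    by (auto elim!: L_homE simp: L_Comp intro!: larr_hom intro: diagram_in_appendI)
next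
  fix f g h A B E E' assume "f \<in> hom (L C) A B" "g \<in> hom (L C) B E" "h \<in> hom (L C) E E'"
  then obtain ss ts us where d: "diagram_in C UNIV A ss B" "diagram_in C UNIV B ts E"
    "diagram_in C UNIV E us E'" and e: "f = larr C A ss B" "g = larr C B ts E" "h = larr C E us E'"
    by (metis L_homE)
  have "diagram_in C UNIV A (ss @ ts) E" "diagram_in C UNIV B (ts @ us) E'"
    using d by (auto simp: diagram_in_append)
  with d show "Comp (L C) (Comp (L C) h g) f = Comp (L C) h (Comp (L C) g f)"
    by (simp add: e L_Comp)
next
  fix f A B assume "f \<in> hom (L C) A B"
  then obtain ss where d: "diagram_in C UNIV A ss B" and f: "f = larr C A ss B"
    by (rule L_homE)
  have "diagram_in C UNIV A [] A" "diagram_in C UNIV B [] B"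
    using diagram_in_ends[OF d] by auto
  then show "Comp (L C) f (Idt (L C) A) = f" "Comp (L C) (Idt (L C) B) f = f"
    using d by (simp_all add: f L_Comp)
next
  fix f f' A B A' B' assume "f \<in> hom (L C) A B" "f' \<in> hom (L C) A' B'"
  then show "Tens (L C) f f' \<in> hom (L C) (TensO (L C) A A') (TensO (L C) B B')"
    by (auto elim!: L_homE simp: L_Tens intro!: larr_hom whisker_diagrams)
next
  fix A B assume "A \<in> Obj (L C)" "B \<in> Obj (L C)"
  then show "Tens (L C) (Idt (L C) A) (Idt (L C) B) = Idt (L C) (TensO (L C) A B)"
    by (simp add: L_Tens)
next
  fix A assume "A \<in> Obj (L C)"
  then show "Idt (L C) A \<in> hom (L C) A A"
    by (simp add: larr_hom)
qed (auto simp: L_Arr hom_def dest: diagram_in_ends)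

interpretation L: strict_monoidal_category "L C" for C
  by (rule strict_monoidal_category_L)

section \<open>Adjoints in \<open>L(C)\<close>\<close>

lemma adjoint_wire:
  assumes "A \<in> Obj C"
  shows "adjoint_pair (L C) [(A, n)] [(A, n + 1)]
    (larr C [(A, n), (A, n + 1)] [([], Cap A n, [])] [])
    (larr C [] [([], Cup A n, [])] [(A, n + 1), (A, n)])"
proof (rule L.adjointI)
  have d: "diagram_in C UNIV [(A, n), (A, n + 1)] [([], Cap A n, [])] []"
    "diagram_in C UNIV [] [([], Cup A n, [])] [(A, n + 1), (A, n)]"
    using assms by simp_all
  show "larr C [(A, n), (A, n + 1)] [([], Cap A n, [])] [] \<in> Arr (L C)"
    "larr C [] [([], Cup A n, [])] [(A, n + 1), (A, n)] \<in> Arr (L C)"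
    by (rule larr_Arr[OF d(1)], rule larr_Arr[OF d(2)])
  have i: "diagram_in C UNIV [(A, k)] [] [(A, k)]" for k
    using assms by simp
  \<comment> \<open>The move \<open>yank_right\<close> is the triangle of \<open>(A, n + 1)\<close>;
    likewise \<open>yank_left\<close> below is the triangle of \<open>(A, n)\<close>.\<close>
  have "diagram_eq_in C UNIV [(A, n + 1)] [(A, n + 1)]
      [([], Cup A n, [(A, n + 1)]), ([(A, n + 1)], Cap A n, [])] []"
    using assms by (intro move_diagram_eq move.yank_right) auto
  then show "Comp (L C)
     (Tens (L C) (Idt (L C) [(A, n + 1)]) (larr C [(A, n), (A, n + 1)] [([], Cap A n, [])] []))
     (Tens (L C) (larr C [] [([], Cup A n, [])] [(A, n + 1), (A, n)]) (Idt (L C) [(A, n + 1)])) =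
    Idt (L C) [(A, n + 1)]"
    using assms by (simp add: L_Tens[OF d(2) i] L_Tens[OF i d(1)] L_Comp larr_eqI)
  have "diagram_eq_in C UNIV [(A, n)] [(A, n)]
      [([(A, n)], Cup A n, []), ([], Cap A n, [(A, n)])] []"
    using assms by (intro move_diagram_eq move.yank_left) auto
  then show "Comp (L C)
     (Tens (L C) (larr C [(A, n), (A, n + 1)] [([], Cap A n, [])] []) (Idt (L C) [(A, n)]))
     (Tens (L C) (Idt (L C) [(A, n)]) (larr C [] [([], Cup A n, [])] [(A, n + 1), (A, n)])) =
    Idt (L C) [(A, n)]"
    using assms by (simp add: L_Tens[OF d(1) i] L_Tens[OF i d(2)] L_Comp larr_eqI)
qed (use assms in simp_all)

text \<open>A list is the tensor product of its wires. The wire \<open>(A, n)\<close> has the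
  adjoints \<open>(A, n - 1)\<close> and \<open>(A, n + 1)\<close>, and \<open>adjoint_tens\<close>
  puts the adjoints of the wires together in reversed order.\<close>

theorem autonomous_category_L: "autonomous_category (L C)"
proof unfold_locales
  show "\<exists>Y e h. adjoint_pair (L C) Y X e h" if "X \<in> Obj (L C)" for X
    using that
  proof (induction X)
    case Nil
    then show ?case
      using L.adjoint_unit[of C] unfolding L_simps by blast
  next
    case (Cons w X)
    obtain A n where w: "w = (A, n)"
      by (cases w)
    obtain Y e h where "adjoint_pair (L C) Y X e h"
      using Cons by (auto simp: w)
    moreover obtain e' h' where "adjoint_pair (L C) [(A, n - 1)] [(A, n)] e' h'"
      using Cons.prems adjoint_wire[of A C "n - 1"] by (auto simp: w)
    ultimately show ?case
      using L.adjoint_tens[of C "[(A, n - 1)]" "[(A, n)]" e' h' Y X e h]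
      unfolding w L_simps append_Cons append_Nil by blast
  qed
  show "\<exists>Y e h. adjoint_pair (L C) X Y e h" if "X \<in> Obj (L C)" for X
    using that
  proof (induction X)
    case Nil
    then show ?case
      using L.adjoint_unit[of C] unfolding L_simps by blast
  next
    case (Cons w X)
    obtain A n where w: "w = (A, n)"
      by (cases w)
    obtain Y e h where "adjoint_pair (L C) X Y e h"
      using Cons by (auto simp: w)
    moreover obtain e' h' where "adjoint_pair (L C) [(A, n)] [(A, n + 1)] e' h'"
      using Cons.prems adjoint_wire[of A C n] by (auto simp: w)
    ultimately show ?case
      using L.adjoint_tens[of C X Y e h "[(A, n)]" "[(A, n + 1)]" e' h']
      unfolding w L_simps append_Cons append_Nil by blast
  qed
qed

section \<open>Nodes as arrows of \<open>L(C)\<close>, and the embedding\<close>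

definition node :: "('o, 'm) moncat \<Rightarrow> 'o list \<Rightarrow> 'm \<Rightarrow> 'o list \<Rightarrow> ('o, 'm) larr" where
  "node C As f Bs = larr C (plain As) [([], Node As f Bs, [])] (plain Bs)"

context strict_monoidal_category
begin

lemma cell_ok_Node:
  "cell_ok C (Node As f Bs) \<longleftrightarrow> set As \<subseteq> Obj C \<and> set Bs \<subseteq> Obj C \<and>
    f \<in> Arr C \<and> Dom C f = tens_list C As \<and> Cod C f = tens_list C Bs"
  by (auto simp: hom_iff)

lemma node_diagram:
  assumes "cell_ok C (Node As f Bs)"
  shows "diagram_in C UNIV (plain As) [([], Node As f Bs, [])] (plain Bs)"
  using assms by (auto simp: wires_in_plain)

lemma node_simps [simp]:
  "ldom (node C As f Bs) = plain As" "lcod (node C As f Bs) = plain Bs"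
  by (simp_all add: node_def)

lemma node_Arr: "cell_ok C (Node As f Bs) \<Longrightarrow> node C As f Bs \<in> Arr (L C)"
  unfolding node_def by (rule larr_Arr[OF node_diagram])

lemma node_comp:
  assumes f: "cell_ok C (Node As f Bs)" and g: "cell_ok C (Node Bs g Es)"
  shows "Comp (L C) (node C Bs g Es) (node C As f Bs) = node C As (g \<cdot> f) Es"
proof -
  have gf: "cell_ok C (Node As (g \<cdot> f) Es)"
    using f g by (auto simp: comp_hom)
  have "diagram_eq_in C UNIV (plain As) (plain Es)
      ([([], Node As f Bs, [])] @ [([], Node Bs g Es, [])]) [([], Node As (g \<cdot> f) Es, [])]"
    using diagram_in_appendI[OF node_diagram[OF f] node_diagram[OF g]] node_diagram[OF gf]
    by (intro move_diagram_eq) (auto intro: move.stack)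
  then show ?thesis
    by (simp only: node_def L_Comp[OF node_diagram[OF f] node_diagram[OF g]] larr_eqI)
qed

lemma node_tens:
  assumes f: "cell_ok C (Node As f Bs)" and g: "cell_ok C (Node As' g Bs')"
  shows "Tens (L C) (node C As f Bs) (node C As' g Bs') = node C (As @ As') (f \<otimes> g) (Bs @ Bs')"
proof -
  have fg: "cell_ok C (Node (As @ As') (f \<otimes> g) (Bs @ Bs'))"
    using f g by (auto simp: tens_hom)
  note w = whisker_diagrams(3)[OF node_diagram[OF f] node_diagram[OF g]]
  have "diagram_eq_in C UNIV (plain As @ plain As') (plain Bs @ plain Bs')
      (whisker [] [([], Node As f Bs, [])] (plain As') @ whisker (plain Bs) [([], Node As' g Bs', [])] [])
      [([], Node (As @ As') (f \<otimes> g) (Bs @ Bs'), [])]"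
    using w node_diagram[OF fg] by (intro move_diagram_eq) (auto intro: move.juxtapose)
  then show ?thesis
    by (simp only: node_def L_Tens[OF node_diagram[OF f] node_diagram[OF g]] larr_eqI plain_simps)
qed

lemma node_Idt:
  assumes "set As \<subseteq> Obj C"
  shows "node C As (Idt C (tens_list C As)) As = Idt (L C) (plain As)"
proof -
  have ok: "cell_ok C (Node As (Idt C (tens_list C As)) As)"
    using assms by (auto simp: idt_hom)
  show ?thesis
    unfolding node_def L_simps using node_diagram[OF ok] assms
    by (intro larr_eqI move_diagram_eq move.identity) (auto simp: wires_in_plain)
qed

lemma node_inverse:
  assumes "cell_ok C (Node As f Bs)" "iso_arrow C f"
  shows "inverse_arrows (L C) (node C As f Bs) (node C Bs (inv_arrow C f) As)"
proof -
  have "cell_ok C (Node Bs (inv_arrow C f) As)"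
    using assms by (simp add: cell_ok_Node del: cell_ok.simps)
  then show ?thesis
    using assms unfolding inverse_arrows_def
    by (simp add: node_comp L.hom_iff node_Arr node_Idt[symmetric] cell_ok_Node del: cell_ok.simps L_simps(6))
qed

lemma node_iso [simp]:
  "cell_ok C (Node As f Bs) \<Longrightarrow> iso_arrow C f \<Longrightarrow> iso_arrow (L C) (node C As f Bs)"
  unfolding iso_arrow_def[of "L C"] by (blast intro: node_inverse)

lemma F_simps [simp]:
  "MapO (F C) A = [(A, 0)]"
  "MapA (F C) f = node C [Dom C f] f [Cod C f]"
  "Mult (F C) A B = node C [A, B] (Idt C (A \<odot> B)) [A \<odot> B]"
  "Uni (F C) = node C [] (Idt C \<one>) [\<one>]"
  by (simp_all add: F_def node_def)

lemma Idt_plain: "A \<in> Obj C \<Longrightarrow> larr C [(A, 0)] [] [(A, 0)] = node C [A] (Idt C A) [A]"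
  using node_Idt[of "[A]"] by simp

text \<open>All arrows that \<open>F C\<close> provides are nodes, so its laws reduce to laws of
  \<open>C\<close>. Nodes with several wires give the structure arrows their inverses: the node with
  an identity label is simply read the other way.\<close>

theorem functor_F: "strong_monoidal_functor C (L C) (F C)"
  by unfold_locales (simp_all add: Idt_plain cell_ok_Node L.hom_iff hom_iff node_Arr node_comp node_tens
  del: cell_ok.simps)

end

section \<open>Evaluation of diagrams\<close>

lemma iter_adj_0 [simp]: "iter_adj D (A, 0) = A"
  by (simp add: iter_adj_def)

locale evaluation = strict_monoidal_category D for D :: "('o, 'm) moncat" (structure) +
  fixes J :: "int set"
  assumes iter_adj_obj: "\<lbrakk>A \<in> Obj D; n \<in> J\<rbrakk> \<Longrightarrow> iter_adj D (A, n) \<in> Obj D"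
    and ev_adjoint: "\<lbrakk>A \<in> Obj D; n \<in> J; n + 1 \<in> J\<rbrakk> \<Longrightarrow>
      adjoint_pair D (iter_adj D (A, n)) (iter_adj D (A, n + 1)) (ev_cap D A n) (ev_cup D A n)"
begin

lemma ev_wires_simps [simp]:
  "ev_wires D [] = \<one>" "ev_wires D (w # X) = iter_adj D w \<odot> ev_wires D X"
  by (simp_all add: ev_wires_def)

lemma ev_wires_obj [simp]: "wires_in D J X \<Longrightarrow> ev_wires D X \<in> Obj D"
  by (induction X) (auto simp: iter_adj_obj)

lemma ev_wires_append [simp]:
  "\<lbrakk>wires_in D J X; wires_in D J Y\<rbrakk> \<Longrightarrow> ev_wires D (X @ Y) = ev_wires D X \<odot> ev_wires D Y"
  by (induction X) (auto simp: iter_adj_obj)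

lemma ev_wires_plain [simp]: "ev_wires D (plain As) = tens_list D As"
  by (induction As) auto

lemma ev_cell_arr [simp]:
  assumes "cell_ok D c" "wires_in D J (cell_dom c)" "wires_in D J (cell_cod c)"
  shows "ev_cell D c \<in> Arr D" "Dom D (ev_cell D c) = ev_wires D (cell_dom c)"
    "Cod D (ev_cell D c) = ev_wires D (cell_cod c)"
  using assms adjointD[OF ev_adjoint]
  by (cases c; simp add: iter_adj_obj hom_iff)+

lemma ev_slices_arr:
  assumes "diagram_in D J X ss Y"
  shows "ev_slices D X ss \<in> Arr D \<and> Dom D (ev_slices D X ss) = ev_wires D X \<and>
    Cod D (ev_slices D X ss) = ev_wires D Y"
  using assms
proof (induction ss arbitrary: X)
  case (Cons s ss)
  then show ?case
    by (cases s) auto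
qed auto

lemmas ev_slices_simps =
  ev_slices_arr[THEN conjunct1] ev_slices_arr[THEN conjunct2, THEN conjunct1]
  ev_slices_arr[THEN conjunct2, THEN conjunct2]

lemma ev_slices_append:
  assumes "diagram_in D J X ss Y" "diagram_in D J Y ts Z"
  shows "ev_slices D X (ss @ ts) = ev_slices D Y ts \<cdot> ev_slices D X ss"
  using assms
proof (induction ss arbitrary: X)
  case Nil
  then show ?case
    by (simp add: ev_slices_simps[OF assms(2)])
next
  case (Cons s ss)
  obtain u c v where s: "s = (u, c, v)"
    by (cases s)
  from Cons.prems have d: "diagram_in D J (u @ cell_cod c @ v) ss Y"
    by (simp add: s)
  show ?case
    using Cons.prems Cons.IH[OF d assms(2)]
    by (simp add: s ev_slices_simps[OF assms(2)] ev_slices_simps[OF d])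
qed

lemma ev_slices_whisker:
  assumes "diagram_in D J X ss Y" "wires_in D J u" "wires_in D J v"
  shows "ev_slices D (u @ X @ v) (whisker u ss v) =
    Idt D (ev_wires D u) \<otimes> ev_slices D X ss \<otimes> Idt D (ev_wires D v)"
  using assms(1)
proof (induction ss arbitrary: X)
  case Nil
  then show ?case
    using assms(2,3) by auto
next
  case (Cons s ss)
  obtain a c b where s: "s = (a, c, b)"
    by (cases s)
  from Cons.prems have d: "diagram_in D J (a @ cell_cod c @ b) ss Y"
    by (simp add: s)
  have "ev_slices D (u @ X @ v) (whisker u (s # ss) v) =
    (Idt D (ev_wires D u) \<otimes> ev_slices D (a @ cell_cod c @ b) ss \<otimes> Idt D (ev_wires D v)) \<cdot>
    (Idt D (ev_wires D u) \<otimes> (Idt D (ev_wires D a) \<otimes> ev_cell D c \<otimes> Idt D (ev_wires D b)) \<otimes>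
      Idt D (ev_wires D v))"
    using Cons.IH[OF d] Cons.prems assms(2,3) by (simp add: s)
  also have "\<dots> = Idt D (ev_wires D u) \<otimes> ev_slices D X (s # ss) \<otimes> Idt D (ev_wires D v)"
    using Cons.prems assms(2,3)
    by (simp add: s ev_slices_simps[OF d] merge del: tens_assoc tens_idt_assoc)
  finally show ?case .
qed

lemma ev_slice:
  assumes "diagram_in D J X [(u, c, v)] Y"
  shows "ev_slices D X [(u, c, v)] = Idt D (ev_wires D u) \<otimes> ev_cell D c \<otimes> Idt D (ev_wires D v)"
  using assms by auto

text \<open>The moves \<open>exchange\<close> and \<open>juxtapose\<close> are the interchange law,
  the yankings are the triangles of \<open>ev_cap\<close> and \<open>ev_cup\<close>, and the other
  two hold because the value of a node is its label.\<close>

lemma ev_move: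
  assumes "move D l r" "diagram_in D J X l Y" "diagram_in D J X r Y"
  shows "ev_slices D X l = ev_slices D X r"
  using assms
proof (cases rule: move.cases)
  case (exchange c w d)
  show ?thesis
  proof -
    have Y: "Y = cell_cod c @ w @ cell_cod d" and ok: "cell_ok D c" "cell_ok D d" "wires_in D J w"
      "wires_in D J (cell_dom c)" "wires_in D J (cell_cod c)"
      "wires_in D J (cell_dom d)" "wires_in D J (cell_cod d)"
      using exchange assms(2) by auto
    show ?thesis
      unfolding exchange Y using ok
      by (simp add: merge tens_idt[symmetric] del: tens_idt tens_idt_assoc)
  qed
next
  case (yank_left A n)
  then show ?thesis
    using assms(2,3) adjointD[OF ev_adjoint, of A n] by auto
next
  case (yank_right A n)
  then show ?thesis
    using assms(2,3) adjointD[OF ev_adjoint, of A n] by auto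
next
  case (stack As f Bs g Es)
  then show ?thesis
    using assms(2,3) by (auto simp: wires_in_plain hom_iff)
next
  case (juxtapose As f Bs As' f' Bs')
  have Y: "Y = plain Bs @ plain Bs'" and ok: "wires_in D J (plain As)" "wires_in D J (plain As')"
    "wires_in D J (plain Bs)" "wires_in D J (plain Bs')" "f \<in> Arr D" "Dom D f = tens_list D As"
    "Cod D f = tens_list D Bs" "f' \<in> Arr D" "Dom D f' = tens_list D As'" "Cod D f' = tens_list D Bs'"
    using juxtapose assms(2) by (auto simp: hom_iff)
  then show ?thesis
    unfolding juxtapose by (simp add: wires_in_plain merge)
next
  case (identity As)
  then show ?thesis
    using assms(2,3) by (auto simp: wires_in_plain hom_iff)
qed

lemma ev_diagram_eq:
  assumes "diagram_eq_in D J X Y ss ts"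
  shows "ev_slices D X ss = ev_slices D X ts"
  using assms
proof (induction rule: diagram_eq_in_induct)
  case (step l r a b u v ss ts)
  have "diagram_in D J X (ss @ whisker u s v) (u @ b @ v) \<and>
      ev_slices D X (ss @ whisker u s v @ ts) = ev_slices D (u @ b @ v) ts \<cdot>
      ((Idt D (ev_wires D u) \<otimes> ev_slices D a s \<otimes> Idt D (ev_wires D v)) \<cdot> ev_slices D X ss)"
    if s: "diagram_in D J a s b" for s
    using ev_slices_append[OF diagram_in_appendI[OF step(6) diagram_in_whisker[OF s step(4,5)]] step(7)]
      ev_slices_append[OF step(6) diagram_in_whisker[OF s step(4,5)]] ev_slices_whisker[OF s step(4,5)]
      diagram_in_appendI[OF step(6) diagram_in_whisker[OF s step(4,5)]]
    by simp
  then show ?case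
    using step ev_move by metis
qed auto

end

lemma evaluation_level_0: "strict_monoidal_category D \<Longrightarrow> evaluation D {0}"
  by (auto simp: evaluation_def evaluation_axioms_def)

section \<open>Iterated adjoints and the counit in an autonomous category\<close>

context autonomous_category
begin

lemma ladj: "A \<in> Obj C \<Longrightarrow> \<exists>e h. adjoint_pair C (ladj C A) A e h"
  unfolding ladj_def using left_adjoint by (rule someI_ex)

lemma radj: "A \<in> Obj C \<Longrightarrow> \<exists>e h. adjoint_pair C A (radj C A) e h"
  unfolding radj_def using right_adjoint by (rule someI_ex)

lemma funpow_ladj: "A \<in> Obj C \<Longrightarrow> (ladj C ^^ k) A \<in> Obj C"
  using ladj adjointD(1,2) by (induction k) (simp, metis funpow.simps(2) comp_apply)

lemma funpow_radj: "A \<in> Obj C \<Longrightarrow> (radj C ^^ k) A \<in> Obj C"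
  using radj adjointD(1,2) by (induction k) (simp, metis funpow.simps(2) comp_apply)

lemma iter_adj_adjoint:
  assumes "A \<in> Obj C"
  shows "\<exists>e h. adjoint_pair C (iter_adj C (A, n)) (iter_adj C (A, n + 1)) e h"
proof (cases "0 \<le> n")
  case True
  then have "iter_adj C (A, n + 1) = radj C (iter_adj C (A, n))"
    by (simp add: iter_adj_def nat_add_distrib)
  then show ?thesis
    using radj funpow_radj[OF assms] True by (simp add: iter_adj_def)
next
  case False
  \<comment> \<open>For negative \<open>n\<close> one more \<open>ladj\<close> is applied at
    \<open>n\<close> than at \<open>n + 1\<close>. At \<open>n = -1\<close> the exponent
    \<open>n + 1 = 0\<close> belongs to the branch of \<open>radj\<close>, with no application in
    either reading.\<close>
  then have "nat (- n) = Suc (nat (- (n + 1)))"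
    by simp
  then have "iter_adj C (A, n) = ladj C (iter_adj C (A, n + 1))"
    using False by (auto simp: iter_adj_def)
  moreover have "iter_adj C (A, n + 1) \<in> Obj C"
    using funpow_ladj[OF assms] assms False by (auto simp: iter_adj_def)
  ultimately show ?thesis
    using ladj by simp
qed

text \<open>\<open>ev_cap\<close> is chosen among the counits that admit a unit, and
  \<open>ev_cup\<close> as a unit for that very counit, so the two choices fit together.\<close>

lemma evaluation_UNIV: "evaluation C UNIV"
proof unfold_locales
  fix A n assume A: "A \<in> Obj C"
  show "adjoint_pair C (iter_adj C (A, n)) (iter_adj C (A, n + 1)) (ev_cap C A n) (ev_cup C A n)"
    using iter_adj_adjoint[OF A] unfolding ev_cup_def ev_cap_def
    by (rule someI2_ex) (rule someI_ex)
  show "iter_adj C (A, n) \<in> Obj C"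
    using iter_adj_adjoint[OF A] by (auto simp: adjoint_pair_def)
qed

end

locale autonomous_evaluation = evaluation D UNIV for D :: "('o, 'm) moncat" (structure)
begin

lemma counit_simps [simp]:
  "MapO (counit D) = ev_wires D" "Mult (counit D) X Y = Idt D (ev_wires D (X @ Y))"
  "Uni (counit D) = Idt D \<one>"
  by (simp_all add: counit_def)

lemma counit_larr [simp]:
  assumes "diagram_in D UNIV X ss Y"
  shows "MapA (counit D) (larr D X ss Y) = ev_slices D X ss"
  using ev_diagram_eq[OF lrep_eq[OF assms]] by (simp add: counit_def)

theorem functor_counit: "strong_monoidal_functor (L D) D (counit D)"
proof (unfold_locales, goal_cases)
  case (2 f A B)
  then show ?case
    by (elim L_homE) (simp add: hom_iff ev_slices_simps)
next
  case (4 f A B g E)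
  then show ?case
    by (elim L_homE) (simp add: L_Comp ev_slices_append diagram_in_appendI)
next
  case (7 f A B f' A' B')
  then obtain ss ss' where f: "diagram_in D UNIV A ss B" "f = larr D A ss B"
    and f': "diagram_in D UNIV A' ss' B'" "f' = larr D A' ss' B'"
    by (metis L_homE)
  note w = whisker_diagrams[OF f(1) f'(1)]
  have "MapA (counit D) (Tens (L D) f f') = ev_slices D A ss \<otimes> ev_slices D A' ss'"
    using ev_slices_append[OF w(1,2)] ev_slices_whisker[OF f(1), of "[]" A']
      ev_slices_whisker[OF f'(1), of B "[]"] diagram_in_ends[OF f(1)] diagram_in_ends[OF f'(1)] w
      ev_slices_simps[OF f(1)] ev_slices_simps[OF f'(1)]
    by (simp add: f(2) f'(2) L_Tens[OF f(1) f'(1)] merge)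
  then show ?case
    using diagram_in_ends[OF f(1)] diagram_in_ends[OF f'(1)] ev_slices_simps[OF f(1)]
      ev_slices_simps[OF f'(1)] by (simp add: f f')
qed (auto simp: hom_iff)

lemma counit_node:
  assumes "cell_ok D (Node As f Bs)"
  shows "MapA (counit D) (node D As f Bs) = f"
proof -
  have "ev_slices D (plain As) [([], Node As f Bs, [])] = f"
    using assms ev_slice[OF node_diagram[OF assms]] by (simp add: cell_ok_Node del: cell_ok.simps)
  then show ?thesis
    unfolding node_def counit_larr[OF node_diagram[OF assms]] .
qed

text \<open>Evaluation returns the label of a node, and the structure nodes of \<open>F D\<close>
  are labelled by identities; this triangle therefore holds as an equality.\<close>

theorem counit_F: "fun_eq D (comp_fun D (counit D) (F D)) (id_fun D)"
  unfolding fun_eq_def comp_fun_def id_fun_def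
  by (auto simp: counit_node cell_ok_Node simp del: cell_ok.simps)

end

lemma autonomous_evaluation: "autonomous_category D \<Longrightarrow> autonomous_evaluation D"
  by (simp add: autonomous_evaluation_def autonomous_category.evaluation_UNIV)

section \<open>The action of \<open>L\<close> on functors\<close>

lemma map_wires_simps [simp]:
  "map_wires K [] = []"
  "map_wires K ((A, n) # X) = (MapO K A, n) # map_wires K X"
  "map_wires K (X @ Y) = map_wires K X @ map_wires K Y"
  "map_wires K (plain As) = plain (map (MapO K) As)"
  by (simp_all add: map_wires_def plain_def)

lemma map_slices_simps [simp]:
  "map_slices C D K [] = []"
  "map_slices C D K ((u, c, v) # ss) =
    (map_wires K u, map_cell C D K c, map_wires K v) # map_slices C D K ss"
  "map_slices C D K (ss @ ts) = map_slices C D K ss @ map_slices C D K ts"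
  by (simp_all add: map_slices_def)

lemma map_cell_ends [simp]:
  "cell_dom (map_cell C D K c) = map_wires K (cell_dom c)"
  "cell_cod (map_cell C D K c) = map_wires K (cell_cod c)"
  by (cases c; simp)+

lemma map_slices_whisker:
  "map_slices C D K (whisker u ss v) = whisker (map_wires K u) (map_slices C D K ss) (map_wires K v)"
  by (induction ss) auto

context strong_monoidal_functor
begin

lemma wires_in_map [simp]: "wires_in C J X \<Longrightarrow> wires_in D J (map_wires G X)"
  by (induction X) auto

lemma map_cell_ok:
  assumes "cell_ok C c"
  shows "cell_ok D (map_cell C D G c)"
  using assms by (cases c) (auto simp: C.hom_iff D.hom_iff)

lemma map_diagram:
  "diagram_in C J X ss Y \<Longrightarrow> diagram_in D J (map_wires G X) (map_slices C D G ss) (map_wires G Y)"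
proof (induction ss arbitrary: X)
  case (Cons s ss)
  obtain u c v where s: "s = (u, c, v)"
    by (cases s)
  show ?case
    using Cons.prems Cons.IH[of "u @ cell_cod c @ v"] by (auto simp: s map_cell_ok)
qed auto

text \<open>By \<open>mult_list_append\<close> each of the two outer isomorphisms consists of a
  single \<open>Mult G\<close> and a tensor product. Naturality carries one \<open>Mult G\<close>
  across \<open>f \<otimes> f'\<close> to the other, and they cancel.\<close>

lemma map_juxtapose:
  assumes "cell_ok C (Node As f Bs)" "cell_ok C (Node As' f' Bs')"
  shows "inv_arrow D (mult_list C D G (Bs @ Bs')) \<cdot>\<^bsub>D\<^esub>
      (MapA G (f \<otimes>\<^bsub>C\<^esub> f') \<cdot>\<^bsub>D\<^esub> mult_list C D G (As @ As')) =
    (inv_arrow D (mult_list C D G Bs) \<cdot>\<^bsub>D\<^esub> (MapA G f \<cdot>\<^bsub>D\<^esub> mult_list C D G As)) \<otimes>\<^bsub>D\<^esub>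
    (inv_arrow D (mult_list C D G Bs') \<cdot>\<^bsub>D\<^esub> (MapA G f' \<cdot>\<^bsub>D\<^esub> mult_list C D G As'))"
proof -
  have [simp]: "set As \<subseteq> Obj C" "set Bs \<subseteq> Obj C" "set As' \<subseteq> Obj C" "set Bs' \<subseteq> Obj C"
    and f [simp]: "f \<in> Arr C" "Dom C f = tens_list C As" "Cod C f = tens_list C Bs"
      "f' \<in> Arr C" "Dom C f' = tens_list C As'" "Cod C f' = tens_list C Bs'"
    using assms by (auto simp: C.hom_iff)
  let ?m = "mult_list C D G"
  have "inv_arrow D (?m (Bs @ Bs')) \<cdot>\<^bsub>D\<^esub> (MapA G (f \<otimes>\<^bsub>C\<^esub> f') \<cdot>\<^bsub>D\<^esub> ?m (As @ As')) =
    (inv_arrow D (?m Bs) \<otimes>\<^bsub>D\<^esub> inv_arrow D (?m Bs')) \<cdot>\<^bsub>D\<^esub>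
    ((inv_arrow D (Mult G (Cod C f) (Cod C f')) \<cdot>\<^bsub>D\<^esub> MapA G (f \<otimes>\<^bsub>C\<^esub> f')) \<cdot>\<^bsub>D\<^esub>
      (Mult G (tens_list C As) (tens_list C As') \<cdot>\<^bsub>D\<^esub> (?m As \<otimes>\<^bsub>D\<^esub> ?m As')))"
    by (simp add: mult_list_append D.inv_comp D.inv_tens)
  also have "\<dots> = (inv_arrow D (?m Bs) \<otimes>\<^bsub>D\<^esub> inv_arrow D (?m Bs')) \<cdot>\<^bsub>D\<^esub>
    ((MapA G f \<otimes>\<^bsub>D\<^esub> MapA G f') \<cdot>\<^bsub>D\<^esub> (?m As \<otimes>\<^bsub>D\<^esub> ?m As'))"
    by (subst inv_mult_natural[OF f(1,4,2,5)]) simp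
  also have "\<dots> = (inv_arrow D (?m Bs) \<cdot>\<^bsub>D\<^esub> (MapA G f \<cdot>\<^bsub>D\<^esub> ?m As)) \<otimes>\<^bsub>D\<^esub>
    (inv_arrow D (?m Bs') \<cdot>\<^bsub>D\<^esub> (MapA G f' \<cdot>\<^bsub>D\<^esub> ?m As'))"
    by (simp add: D.merge)
  finally show ?thesis .
qed

text \<open>A move goes to a move of the same kind. The isomorphisms inserted into the labels cancel
  between two stacked nodes, and conjugating an identity by them gives an identity.\<close>

lemma map_move:
  assumes "move C l r" "diagram_in C J X l Y"
  shows "move D (map_slices C D G l) (map_slices C D G r)"
  using assms(1)
proof (cases rule: move.cases)
  case (exchange c w d)
  then show ?thesis
    using move.exchange[of D "map_cell C D G c" "map_wires G w" "map_cell C D G d"] by simp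
next
  case (yank_left A n)
  then show ?thesis
    using move.yank_left[of D "MapO G A" n] by simp
next
  case (yank_right A n)
  then show ?thesis
    using move.yank_right[of D "MapO G A" n] by simp
next
  case (stack As f Bs g Es)
  let ?m = "mult_list C D G"
  have [simp]: "set As \<subseteq> Obj C" "set Bs \<subseteq> Obj C" "set Es \<subseteq> Obj C" "f \<in> Arr C" "Dom C f = tens_list C As"
    "Cod C f = tens_list C Bs" "g \<in> Arr C" "Dom C g = tens_list C Bs" "Cod C g = tens_list C Es"
    using stack assms(2) by (auto simp: C.hom_iff)
  have "inv_arrow D (?m Es) \<cdot>\<^bsub>D\<^esub> (MapA G (g \<cdot>\<^bsub>C\<^esub> f) \<cdot>\<^bsub>D\<^esub> ?m As) =
      (inv_arrow D (?m Es) \<cdot>\<^bsub>D\<^esub> (MapA G g \<cdot>\<^bsub>D\<^esub> ?m Bs)) \<cdot>\<^bsub>D\<^esub>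
      (inv_arrow D (?m Bs) \<cdot>\<^bsub>D\<^esub> (MapA G f \<cdot>\<^bsub>D\<^esub> ?m As))"
    by (simp add: map_comp_arr)
  then show ?thesis
    unfolding stack map_slices_simps map_cell.simps map_wires_simps(1) by (metis move.stack)
next
  case (juxtapose As f Bs As' f' Bs')
  have "cell_ok C (Node As f Bs)" "cell_ok C (Node As' f' Bs')"
    using juxtapose assms(2) by simp_all
  then show ?thesis
    unfolding juxtapose by (simp add: map_juxtapose move.juxtapose del: cell_ok.simps)
next
  case (identity As)
  then have "set As \<subseteq> Obj C"
    using assms(2) by simp
  then show ?thesis
    unfolding identity using move.identity[of D "map (MapO G) As"] by simp
qed

lemma map_diagram_eq:
  "diagram_eq_in C J X Y ss ts \<Longrightarrow>
    diagram_eq_in D J (map_wires G X) (map_wires G Y) (map_slices C D G ss) (map_slices C D G ts)"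
proof (induction rule: diagram_eq_in_induct)
  case (refl ss)
  then show ?case
    by (intro diagram_eq_in.refl map_diagram)
next
  case (step l r a b u v ss ts)
  have "diagram_eq_in D J (map_wires G (u @ a @ v)) (map_wires G (u @ b @ v))
      (map_slices C D G (whisker u l v)) (map_slices C D G (whisker u r v))"
    unfolding map_slices_whisker map_wires_simps
    using step by (intro diagram_eq_in_whisker move_diagram_eq map_move map_diagram) auto
  then show ?case
    unfolding map_slices_simps(3)
    by (rule diagram_eq_in_append_left[OF diagram_eq_in_append_right
          [OF _ map_diagram[OF step(7)]] map_diagram[OF step(6)]])
qed (blast intro: diagram_eq_in.intros)+

lemma L_map_simps [simp]:
  "MapO (L_map C D G) = map_wires G"
  "Mult (L_map C D G) X Y = Idt (L D) (map_wires G (X @ Y))"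
  "Uni (L_map C D G) = Idt (L D) []"
  by (simp_all add: L_map_def del: L_simps(6))

lemma L_map_larr:
  assumes "diagram_in C UNIV X ss Y"
  shows "MapA (L_map C D G) (larr C X ss Y) =
    larr D (map_wires G X) (map_slices C D G ss) (map_wires G Y)"
  using larr_eqI[OF map_diagram_eq[OF lrep_eq[OF assms]]] by (simp add: L_map_def)

theorem functor_L_map: "strong_monoidal_functor (L C) (L D) (L_map C D G)"
proof (unfold_locales, goal_cases)
  case (2 f A B)
  then show ?case
    by (elim L_homE) (auto simp: L_map_larr intro!: larr_hom map_diagram)
next
  case (4 f A B g E)
  then obtain ss ts where d: "diagram_in C UNIV A ss B" "diagram_in C UNIV B ts E"
    and e: "f = larr C A ss B" "g = larr C B ts E"
    by (metis L_homE)
  show ?case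
    by (simp add: e L_Comp[OF d] L_map_larr[OF diagram_in_appendI[OF d]] L_map_larr[OF d(1)]
        L_map_larr[OF d(2)] L_Comp[OF map_diagram[OF d(1)] map_diagram[OF d(2)]])
next
  case (7 f A B f' A' B')
  then obtain ss ss' where d: "diagram_in C UNIV A ss B" "diagram_in C UNIV A' ss' B'"
    and e: "f = larr C A ss B" "f' = larr C A' ss' B'"
    by (metis L_homE)
  note w = whisker_diagrams(3)[OF d] and m = map_diagram[OF d(1)] map_diagram[OF d(2)]
  have "MapA (L_map C D G) (Tens (L C) f f') = Tens (L D) (MapA (L_map C D G) f) (MapA (L_map C D G) f')"
    by (simp add: e L_Tens[OF d] L_map_larr[OF w] L_map_larr[OF d(1)] L_map_larr[OF d(2)]
      L_Tens[OF m] map_slices_whisker)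
  moreover have "Tens (L D) (MapA (L_map C D G) f) (MapA (L_map C D G) f') \<in> Arr (L D)"
    "Dom (L D) (Tens (L D) (MapA (L_map C D G) f) (MapA (L_map C D G) f')) = map_wires G (A @ A')"
    "Cod (L D) (Tens (L D) (MapA (L_map C D G) f) (MapA (L_map C D G) f')) = map_wires G (B @ B')"
    using m by (simp_all add: e L_map_larr[OF d(1)] L_map_larr[OF d(2)] L_Tens[OF m] whisker_diagrams)
  ultimately show ?case
    by (simp del: L_simps(6))
next
  case (3 A)
  then show ?case
    by (simp add: L_map_larr)
qed (auto simp: L.hom_iff L_Comp L_Tens L.iso_Idt[unfolded L_simps])

lemma map_node:
  assumes "cell_ok C (Node As f Bs)"
  shows "MapA (L_map C D G) (node C As f Bs) = node D (map (MapO G) As)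
    (inv_arrow D (mult_list C D G Bs) \<cdot>\<^bsub>D\<^esub> (MapA G f \<cdot>\<^bsub>D\<^esub> mult_list C D G As)) (map (MapO G) Bs)"
  unfolding node_def L_map_larr[OF C.node_diagram[OF assms]] by simp

text \<open>On a one-element list \<open>mult_list\<close> is an identity, by the right unit law.
  Hence a node with single wires keeps the label \<open>MapA G f\<close>, while the structure nodes
  of \<open>F C\<close> receive the labels \<open>Mult G A B\<close> and \<open>Uni G\<close>, just
  as in the other composite.\<close>

theorem F_natural:
  "fun_eq C (comp_fun (L D) (F D) G) (comp_fun (L D) (L_map C D G) (F C))"
  unfolding fun_eq_def
proof (intro conjI ballI)
  fix f assume "f \<in> Arr C"
  then show "MapA (comp_fun (L D) (F D) G) f = MapA (comp_fun (L D) (L_map C D G) (F C)) f"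
    by (simp add: comp_fun_def map_node C.cell_ok_Node del: cell_ok.simps)
next
  fix A B assume AB: "A \<in> Obj C" "B \<in> Obj C"
  then have "node D [MapO G A, MapO G B] (Mult G A B) [MapO G (A \<odot>\<^bsub>C\<^esub> B)] \<in> Arr (L D)"
    by (intro D.node_Arr) (simp add: D.cell_ok_Node del: cell_ok.simps)
  then show "Mult (comp_fun (L D) (F D) G) A B = Mult (comp_fun (L D) (L_map C D G) (F C)) A B"
    using AB by (simp add: comp_fun_def map_node C.cell_ok_Node D.cell_ok_Node D.node_comp
        del: cell_ok.simps L_simps(6))
next
  have "node D [] (Uni G) [MapO G \<one>\<^bsub>C\<^esub>] \<in> Arr (L D)"
    by (intro D.node_Arr) (simp add: D.cell_ok_Node del: cell_ok.simps)
  then show "Uni (comp_fun (L D) (F D) G) = Uni (comp_fun (L D) (L_map C D G) (F C))"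
    by (simp add: comp_fun_def map_node C.cell_ok_Node D.cell_ok_Node D.node_comp
        del: cell_ok.simps L_simps(6))
qed (simp add: comp_fun_def)

end

section \<open>Functoriality of \<open>L\<close>\<close>

context strict_monoidal_category
begin

lemma functor_id: "strong_monoidal_functor C C (id_fun C)"
  by unfold_locales (auto simp: id_fun_def hom_iff)

lemma mult_list_id: "set As \<subseteq> Obj C \<Longrightarrow> mult_list C C (id_fun C) As = Idt C (tens_list C As)"
  by (induction As) (simp_all add: id_fun_def)

lemma map_wires_id [simp]: "map_wires (id_fun C) X = X"
  by (induction X) (auto simp: id_fun_def)

lemma map_slices_id:
  "diagram_in C J X ss Y \<Longrightarrow> map_slices C C (id_fun C) ss = ss"
proof (induction ss arbitrary: X)
  case (Cons s ss)
  obtain u c v where s: "s = (u, c, v)"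
    by (cases s)
  have "map_cell C C (id_fun C) c = c" if "cell_ok C c"
    using that mult_list_id by (cases c) (auto simp: id_fun_def hom_iff)
  then show ?case
    using Cons by (auto simp: s)
qed simp

theorem L_map_id: "fun_eq (L C) (L_map C C (id_fun C)) (id_fun (L C))"
proof -
  interpret I: strong_monoidal_functor C C "id_fun C"
    by (rule functor_id)
  have "MapA (L_map C C (id_fun C)) \<phi> = \<phi>" if "\<phi> \<in> Arr (L C)" for \<phi>
    using that unfolding L_Arr by (auto simp: I.L_map_larr map_slices_id)
  then show ?thesis
    by (simp add: fun_eq_def id_fun_def[of "L C"] del: L_simps(6))
qed

end

text \<open>Only the labels of nodes need an argument: by naturality of \<open>Mult H\<close>, the
  iterated isomorphism of the composite is that of \<open>H\<close> followed by the image under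
  \<open>H\<close> of that of \<open>G\<close>.\<close>

lemma L_map_comp:
  assumes "strong_monoidal_functor C D G" "strong_monoidal_functor D E H"
  shows "fun_eq (L C) (L_map C E (comp_fun E H G)) (comp_fun (L E) (L_map D E H) (L_map C D G))"
proof -
  interpret G: strong_monoidal_functor C D G by fact
  interpret H: strong_monoidal_functor D E H by fact
  interpret HG: strong_monoidal_functor C E "comp_fun E H G"
    by (rule functor_comp) fact+
  interpret LH: strong_monoidal_functor "L D" "L E" "L_map D E H"
    by (rule H.functor_L_map)
  have wires: "map_wires (comp_fun E H G) X = map_wires H (map_wires G X)" for X
    by (induction X) (auto simp: comp_fun_def)
  have mult: "mult_list C E (comp_fun E H G) As =
      MapA H (mult_list C D G As) \<cdot>\<^bsub>E\<^esub> mult_list D E H (map (MapO G) As)"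
    if "set As \<subseteq> Obj C" for As
    using that
  proof (induction As)
    case Nil
    then show ?case
      by (simp add: comp_fun_def)
  next
    case (Cons A As)
    let ?A = "MapO G A" and ?As = "map (MapO G) As"
    have [simp]: "A \<in> Obj C" "set As \<subseteq> Obj C"
      using Cons.prems by auto
    have "Mult H ?A (MapO G (tens_list C As)) \<cdot>\<^bsub>E\<^esub>
        (MapA H (Idt D ?A) \<otimes>\<^bsub>E\<^esub> MapA H (mult_list C D G As)) =
      MapA H (Idt D ?A \<otimes>\<^bsub>D\<^esub> mult_list C D G As) \<cdot>\<^bsub>E\<^esub> Mult H ?A (tens_list D ?As)"
      by (subst H.mult_natural_arr) simp_all
    note * = this
    have nat: "Mult H ?A (MapO G (tens_list C As)) \<cdot>\<^bsub>E\<^esub>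
        ((Idt E (MapO H ?A) \<otimes>\<^bsub>E\<^esub> MapA H (mult_list C D G As)) \<cdot>\<^bsub>E\<^esub> k) =
      MapA H (Idt D ?A \<otimes>\<^bsub>D\<^esub> mult_list C D G As) \<cdot>\<^bsub>E\<^esub> (Mult H ?A (tens_list D ?As) \<cdot>\<^bsub>E\<^esub> k)"
      if "k \<in> Arr E" "Cod E k = MapO H ?A \<odot>\<^bsub>E\<^esub> MapO H (tens_list D ?As)" for k
    proof -
      have "(Mult H ?A (MapO G (tens_list C As)) \<cdot>\<^bsub>E\<^esub>
          (Idt E (MapO H ?A) \<otimes>\<^bsub>E\<^esub> MapA H (mult_list C D G As))) \<cdot>\<^bsub>E\<^esub> k =
        (MapA H (Idt D ?A \<otimes>\<^bsub>D\<^esub> mult_list C D G As) \<cdot>\<^bsub>E\<^esub> Mult H ?A (tens_list D ?As)) \<cdot>\<^bsub>E\<^esub> k"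
        using * by (simp del: H.D.comp_assoc_arr)
      then show ?thesis
        using that by (simp del: map_map)
    qed
    show ?case
      using Cons nat[of "Idt E (MapO H ?A) \<otimes>\<^bsub>E\<^esub> mult_list D E H ?As"]
      by (simp add: comp_fun_def H.D.whisker_left_comp H.map_comp_arr)
  qed
  have cell: "map_cell C E (comp_fun E H G) c = map_cell D E H (map_cell C D G c)" if "cell_ok C c" for c
  proof (cases c)
    case (Node As f Bs)
    have [simp]: "set As \<subseteq> Obj C" "set Bs \<subseteq> Obj C" "f \<in> Arr C" "Dom C f = tens_list C As"
      "Cod C f = tens_list C Bs"
      using that by (auto simp: Node G.C.hom_iff)
    have "inv_arrow E (MapA H (mult_list C D G Bs) \<cdot>\<^bsub>E\<^esub> mult_list D E H (map (MapO G) Bs)) =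
      inv_arrow E (mult_list D E H (map (MapO G) Bs)) \<cdot>\<^bsub>E\<^esub> MapA H (inv_arrow D (mult_list C D G Bs))"
      by (simp add: H.D.inv_comp H.map_inv)
    then show ?thesis
      by (simp add: Node mult H.map_comp_arr) (simp add: comp_fun_def)
  qed (simp_all add: comp_fun_def)
  have slices: "map_slices C E (comp_fun E H G) ss = map_slices D E H (map_slices C D G ss)"
    if "diagram_in C UNIV X ss Y" for X ss Y
    using that
  proof (induction ss arbitrary: X)
    case (Cons s ss)
    then show ?case
      by (cases s) (auto simp: wires cell)
  qed simp
  have "MapA (L_map C E (comp_fun E H G)) \<phi> = MapA (L_map D E H) (MapA (L_map C D G) \<phi>)"
    if "\<phi> \<in> Arr (L C)" for \<phi>
    using that unfolding L_Arr
    by (auto simp: HG.L_map_larr G.L_map_larr H.L_map_larr[OF G.map_diagram] wires slices)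
  moreover have "diagram_in E UNIV (map_wires H (map_wires G X)) [] (map_wires H (map_wires G X))"
    if "wires_in C UNIV X" for X
    using that by simp
  ultimately show ?thesis
    unfolding fun_eq_def comp_fun_def[of "L E"]
    by (simp add: wires L_Comp H.L_map_larr)
qed

section \<open>Functors out of \<open>L(C)\<close> are determined by their restriction along the embedding\<close>

text \<open>Dependent choice from 0 in both directions. A mate is obtained relative to its
  neighbour, so the components at all exponents must be chosen as one coherent family.\<close>

lemma int_chain:
  fixes P :: "int \<Rightarrow> 'a \<Rightarrow> bool"
  assumes "P 0 s"
    and up: "\<And>n x. P n x \<Longrightarrow> \<exists>y. P (n + 1) y \<and> R n x y"
    and down: "\<And>n y. P (n + 1) y \<Longrightarrow> \<exists>x. P n x \<and> R n x y"
  shows "\<exists>t. t 0 = s \<and> (\<forall>n. P n (t n) \<and> R n (t n) (t (n + 1)))"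
proof -
  \<comment> \<open>The conjunct about \<open>k = 0\<close> pins the start of each half-chain to
    \<open>s\<close>, so that the halves can be joined at 0.\<close>
  have "\<exists>f. \<forall>k. (P (int k) (f k) \<and> (k = 0 \<longrightarrow> f k = s)) \<and> R (int k) (f k) (f (Suc k))"
  proof (rule dependent_nat_choice[where P = "\<lambda>k x. P (int k) x \<and> (k = 0 \<longrightarrow> x = s)"
        and Q = "\<lambda>k. R (int k)"])
    show "\<exists>y. (P (int (Suc k)) y \<and> (Suc k = 0 \<longrightarrow> y = s)) \<and> R (int k) x y"
      if "P (int k) x \<and> (k = 0 \<longrightarrow> x = s)" for x k
      using up[of "int k" x] that unfolding int_Suc by blast
    show "\<exists>x. P (int 0) x \<and> (0 = (0::nat) \<longrightarrow> x = s)"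
      using assms(1) by simp
  qed
  then obtain f where f: "\<And>k. (P (int k) (f k) \<and> (k = 0 \<longrightarrow> f k = s)) \<and> R (int k) (f k) (f (Suc k))"
    by blast
  \<comment> \<open>The step from \<open>- k\<close> down to \<open>- (k + 1)\<close> is governed by
    \<open>R\<close> at its lower end \<open>- int (Suc k)\<close>, with the new element as first
    argument.\<close>
  have "\<exists>g. \<forall>k. (P (- int k) (g k) \<and> (k = 0 \<longrightarrow> g k = s)) \<and> R (- int (Suc k)) (g (Suc k)) (g k)"
  proof (rule dependent_nat_choice[where P = "\<lambda>k x. P (- int k) x \<and> (k = 0 \<longrightarrow> x = s)"
        and Q = "\<lambda>k x y. R (- int (Suc k)) y x"])
    have "- int (Suc k) + 1 = - int k" for k
      by simp
    then show "\<exists>x. (P (- int (Suc k)) x \<and> (Suc k = 0 \<longrightarrow> x = s)) \<and> R (- int (Suc k)) x y"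
      if "P (- int k) y \<and> (k = 0 \<longrightarrow> y = s)" for y k
      using down[of "- int (Suc k)" y] that by (metis Zero_not_Suc)
    show "\<exists>x. P (- int 0) x \<and> (0 = (0::nat) \<longrightarrow> x = s)"
      using assms(1) by simp
  qed
  then obtain g where g: "\<And>k. (P (- int k) (g k) \<and> (k = 0 \<longrightarrow> g k = s)) \<and> R (- int (Suc k)) (g (Suc k)) (g k)"
    by blast
  define t where "t n = (if 0 \<le> n then f (nat n) else g (nat (- n)))" for n
  have t0: "t 0 = s"
    using f[of 0] by (simp add: t_def)
  have up_t: "t (int k) = f k" and down_t: "t (- int k) = g k" for k
    using f[of 0] g[of 0] by (simp_all add: t_def)
  have "P n (t n) \<and> R n (t n) (t (n + 1))" for n
  proof (cases n rule: int_cases)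
    case (nonneg k)
    then have "n + 1 = int (Suc k)"
      by simp
    then show ?thesis
      using f[of k] nonneg up_t by metis
  next
    case (neg k)
    then have "n + 1 = - int k"
      by simp
    then show ?thesis
      using g[of k] g[of "Suc k"] neg down_t by metis
  qed
  then show ?thesis
    using t0 by blast
qed

declare L_simps(1-3,6) [simp del]

lemma L_Obj: "X \<in> Obj (L C) \<longleftrightarrow> wires_in C UNIV X"
  by (simp add: L_simps)

lemma L_Obj_simps [simp]:
  "[] \<in> Obj (L C)"
  "(A, n) # X \<in> Obj (L C) \<longleftrightarrow> A \<in> Obj C \<and> X \<in> Obj (L C)"
  "X @ Y \<in> Obj (L C) \<longleftrightarrow> X \<in> Obj (L C) \<and> Y \<in> Obj (L C)"
  by (simp_all add: L_Obj)

lemma L_larr_ends [simp]: "Dom (L C) (larr C X ss Y) = X" "Cod (L C) (larr C X ss Y) = Y"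
  by (simp_all add: L_simps)

lemma L_larr_Nil: "larr C X [] X = Idt (L C) X"
  by (simp add: L_simps)

abbreviation cap_arr :: "('o, 'm) moncat \<Rightarrow> 'o \<Rightarrow> int \<Rightarrow> ('o, 'm) larr" where
  "cap_arr C A n \<equiv> larr C [(A, n), (A, n + 1)] [([], Cap A n, [])] []"

abbreviation cup_arr :: "('o, 'm) moncat \<Rightarrow> 'o \<Rightarrow> int \<Rightarrow> ('o, 'm) larr" where
  "cup_arr C A n \<equiv> larr C [] [([], Cup A n, [])] [(A, n + 1), (A, n)]"

text \<open>The assumptions on \<open>t0\<close> spell out a monoidal isomorphism between the
  restrictions of \<open>G\<close> and \<open>H\<close> along \<open>F C\<close>, with the structure
  arrows of these composites written in full.\<close>

locale functor_pair =
  C: strict_monoidal_category C +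
  G: strong_monoidal_functor "L C" D G + H: strong_monoidal_functor "L C" D H
  for C :: "('o, 'm) moncat" and D :: "('p, 'n) moncat" (structure) and G H +
  fixes t0 :: "'o \<Rightarrow> 'n"
  assumes t0: "A \<in> Obj C \<Longrightarrow> t0 A \<in> Arr D" "A \<in> Obj C \<Longrightarrow> Dom D (t0 A) = MapO G [(A, 0)]"
      "A \<in> Obj C \<Longrightarrow> Cod D (t0 A) = MapO H [(A, 0)]" "A \<in> Obj C \<Longrightarrow> iso_arrow D (t0 A)"
    and t0_nat: "\<lbrakk>f \<in> Arr C; Dom C f = A; Cod C f = B\<rbrakk> \<Longrightarrow>
      t0 B \<cdot> MapA G (node C [A] f [B]) = MapA H (node C [A] f [B]) \<cdot> t0 A"
    and t0_mult: "\<lbrakk>A \<in> Obj C; B \<in> Obj C\<rbrakk> \<Longrightarrow>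
      t0 (A \<odot>\<^bsub>C\<^esub> B) \<cdot> (MapA G (Mult (F C) A B) \<cdot> Mult G [(A, 0)] [(B, 0)]) =
      (MapA H (Mult (F C) A B) \<cdot> Mult H [(A, 0)] [(B, 0)]) \<cdot> (t0 A \<otimes> t0 B)"
    and t0_uni: "t0 \<one>\<^bsub>C\<^esub> \<cdot> (MapA G (Uni (F C)) \<cdot> Uni G) = MapA H (Uni (F C)) \<cdot> Uni H"
begin

text \<open>The two equations are those that \<open>right_mate\<close> and \<open>left_mate\<close>
  deliver, for the images of the cap and the cup under the two functors.\<close>

definition mate_chain :: "'o \<Rightarrow> (int \<Rightarrow> 'n) \<Rightarrow> bool" where
  "mate_chain A t \<longleftrightarrow> t 0 = t0 A \<and> (\<forall>n.
    (t n \<in> Arr D \<and> Dom D (t n) = MapO G [(A, n)] \<and> Cod D (t n) = MapO H [(A, n)] \<and> iso_arrow D (t n)) \<and>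
    map_counit (L C) D H [(A, n)] [(A, n + 1)] (cap_arr C A n) \<cdot> (t n \<otimes> t (n + 1)) =
      map_counit (L C) D G [(A, n)] [(A, n + 1)] (cap_arr C A n) \<and>
    (t (n + 1) \<otimes> t n) \<cdot> map_unit (L C) D G [(A, n)] [(A, n + 1)] (cup_arr C A n) =
      map_unit (L C) D H [(A, n)] [(A, n + 1)] (cup_arr C A n))"

lemma mate_chain_exists:
  assumes "A \<in> Obj C"
  shows "\<exists>t. mate_chain A t"
  unfolding mate_chain_def
proof (rule int_chain, goal_cases)
  case 1
  then show ?case
    using assms t0 by simp
next
  case (2 n x)
  then show ?case
    using G.D.right_mate[OF G.map_adjoint[OF adjoint_wire[OF assms, of n]]
        H.map_adjoint[OF adjoint_wire[OF assms, of n]], of x] by (metis G.D.iso_arr)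
next
  case (3 n y)
  then show ?case
    using G.D.left_mate[OF G.map_adjoint[OF adjoint_wire[OF assms, of n]]
        H.map_adjoint[OF adjoint_wire[OF assms, of n]], of y] by (metis G.D.iso_arr)
qed

definition wire_iso :: "'o wire \<Rightarrow> 'n" where
  "wire_iso = (\<lambda>(A, n). (SOME t. mate_chain A t) n)"

lemma mate_chain_wire_iso: "A \<in> Obj C \<Longrightarrow> mate_chain A (\<lambda>n. wire_iso (A, n))"
  unfolding wire_iso_def using someI_ex[OF mate_chain_exists] by simp

lemma wire_iso_simps [simp]:
  assumes "A \<in> Obj C"
  shows "wire_iso (A, n) \<in> Arr D" "Dom D (wire_iso (A, n)) = MapO G [(A, n)]"
    "Cod D (wire_iso (A, n)) = MapO H [(A, n)]" "iso_arrow D (wire_iso (A, n))"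
    "wire_iso (A, 0) = t0 A"
  using mate_chain_wire_iso[OF assms] unfolding mate_chain_def by auto

text \<open>Both clauses are forced: a monoidal transformation has to commute with
  \<open>Uni\<close> at the empty list and with \<open>Mult\<close> at the splitting off of the
  first wire.\<close>

fun list_iso :: "'o wire list \<Rightarrow> 'n" where
  "list_iso [] = Uni H \<cdot> inv_arrow D (Uni G)"
| "list_iso (w # X) = Mult H [w] X \<cdot> ((wire_iso w \<otimes> list_iso X) \<cdot> inv_arrow D (Mult G [w] X))"

lemma list_iso_arr:
  assumes "X \<in> Obj (L C)"
  shows "list_iso X \<in> Arr D \<and> Dom D (list_iso X) = MapO G X \<and> Cod D (list_iso X) = MapO H X \<and>
    iso_arrow D (list_iso X)"
  using assms
proof (induction X)
  case (Cons w X)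
  then show ?case
    by (cases w) simp
qed simp

lemmas list_iso_simps [simp] =
  list_iso_arr[THEN conjunct1] list_iso_arr[THEN conjunct2, THEN conjunct1]
  list_iso_arr[THEN conjunct2, THEN conjunct2, THEN conjunct1]
  list_iso_arr[THEN conjunct2, THEN conjunct2, THEN conjunct2]

lemma list_iso_single:
  assumes "A \<in> Obj C"
  shows "list_iso [(A, n)] = wire_iso (A, n)"
proof -
  let ?t = "wire_iso (A, n)"
  have "list_iso [(A, n)] = Mult H [(A, n)] [] \<cdot>
      ((?t \<otimes> (Uni H \<cdot> inv_arrow D (Uni G))) \<cdot> (Idt D (MapO G [(A, n)]) \<otimes> Uni G))"
    using assms G.inv_mult_uni(1)[of "[(A, n)]"] by simp
  also have "\<dots> = Mult H [(A, n)] [] \<cdot> (?t \<otimes> Uni H)"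
    using assms by (simp add: G.D.merge)
  also have "\<dots> = (Mult H [(A, n)] [] \<cdot> (Idt D (MapO H [(A, n)]) \<otimes> Uni H)) \<cdot> ?t"
    using assms G.D.tens_split(1)[of ?t "Uni H"] by (simp del: H.mult_uni_right)
  also have "\<dots> = ?t"
    using assms H.mult_uni_right[of "[(A, n)]"] by simp
  finally show ?thesis .
qed

text \<open>The definition gives this for a split after the first wire; associativity of
  \<open>Mult G\<close> and of \<open>Mult H\<close> extends it to an arbitrary split, and the unit
  laws cover the empty list.\<close>

lemma list_iso_append:
  assumes "X \<in> Obj (L C)" "Y \<in> Obj (L C)"
  shows "list_iso (X @ Y) \<cdot> Mult G X Y = Mult H X Y \<cdot> (list_iso X \<otimes> list_iso Y)"
  using assms(1)
proof (induction X)
  case Nil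
  let ?t = "list_iso Y"
  have "Mult H [] Y \<cdot> (list_iso [] \<otimes> ?t) =
      Mult H [] Y \<cdot> ((Uni H \<otimes> Idt D (MapO H Y)) \<cdot> (inv_arrow D (Uni G) \<otimes> ?t))"
    using assms(2) by (simp add: G.D.merge)
  also have "\<dots> = (Mult H [] Y \<cdot> (Uni H \<otimes> Idt D (MapO H Y))) \<cdot> (inv_arrow D (Uni G) \<otimes> ?t)"
    using assms(2) by simp
  also have "\<dots> = inv_arrow D (Uni G) \<otimes> ?t"
    using assms(2) H.mult_uni_left[of Y] by simp
  finally have 1: "Mult H [] Y \<cdot> (list_iso [] \<otimes> ?t) = inv_arrow D (Uni G) \<otimes> ?t" .
  show ?case
  proof (rule G.D.comp_right_cancel[of "Uni G \<otimes> Idt D (MapO G Y)"])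
    have "(?t \<cdot> Mult G [] Y) \<cdot> (Uni G \<otimes> Idt D (MapO G Y)) = ?t"
      using assms(2) G.mult_uni_left[of Y] by simp
    moreover have "(inv_arrow D (Uni G) \<otimes> ?t) \<cdot> (Uni G \<otimes> Idt D (MapO G Y)) = ?t"
      using assms(2) by (simp add: G.D.merge)
    ultimately show "(list_iso ([] @ Y) \<cdot> Mult G [] Y) \<cdot> (Uni G \<otimes> Idt D (MapO G Y)) =
        (Mult H [] Y \<cdot> (list_iso [] \<otimes> list_iso Y)) \<cdot> (Uni G \<otimes> Idt D (MapO G Y))"
      unfolding 1 by simp
  qed (use assms(2) in simp_all)
next
  case (Cons w X)
  have w [simp]: "[w] \<in> Obj (L C)" "wire_iso w \<in> Arr D" "Dom D (wire_iso w) = MapO G [w]"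
      "Cod D (wire_iso w) = MapO H [w]" and X [simp]: "X \<in> Obj (L C)" "Y \<in> Obj (L C)"
    using Cons.prems assms(2) by (cases w; simp)+
  have wX [simp]: "w # X \<in> Obj (L C)" "w # (X @ Y) \<in> Obj (L C)"
    using Cons.prems assms(2) by (cases w; simp)+
  let ?g = "\<lambda>Z. Idt D (MapO G Z)" and ?h = "\<lambda>Z. Idt D (MapO H Z)"
  have 1: "inv_arrow D (Mult G [w] (X @ Y)) \<cdot> Mult G (w # X) Y =
      (?g [w] \<otimes> Mult G X Y) \<cdot> (inv_arrow D (Mult G [w] X) \<otimes> ?g Y)"
    using G.inv_mult_assoc[of "[w]" X Y] by simp
  have "list_iso ((w # X) @ Y) \<cdot> Mult G (w # X) Y =
      Mult H [w] (X @ Y) \<cdot> ((wire_iso w \<otimes> list_iso (X @ Y)) \<cdot>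
      (inv_arrow D (Mult G [w] (X @ Y)) \<cdot> Mult G (w # X) Y))"
    by simp
  also have "\<dots> = Mult H [w] (X @ Y) \<cdot> ((wire_iso w \<otimes> (list_iso (X @ Y) \<cdot> Mult G X Y)) \<cdot>
      (inv_arrow D (Mult G [w] X) \<otimes> ?g Y))"
    unfolding 1 by (simp add: G.D.merge)
  also have "\<dots> = Mult H [w] (X @ Y) \<cdot> ((?h [w] \<otimes> Mult H X Y) \<cdot>
      ((wire_iso w \<otimes> list_iso X \<otimes> list_iso Y) \<cdot> (inv_arrow D (Mult G [w] X) \<otimes> ?g Y)))"
    unfolding Cons.IH[OF X(1)] by (simp add: G.D.merge)
  also have "\<dots> = Mult H ([w] @ X) Y \<cdot> ((Mult H [w] X \<otimes> ?h Y) \<cdot>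
      (((wire_iso w \<otimes> list_iso X) \<otimes> list_iso Y) \<cdot> (inv_arrow D (Mult G [w] X) \<otimes> ?g Y)))"
    using H.mult_assoc_cancel[of "[w]" X Y "(wire_iso w \<otimes> list_iso X \<otimes> list_iso Y) \<cdot>
        (inv_arrow D (Mult G [w] X) \<otimes> ?g Y)"] by simp
  also have "\<dots> = Mult H (w # X) Y \<cdot> (list_iso (w # X) \<otimes> list_iso Y)"
    by (simp add: G.D.merge del: G.D.tens_assoc)
  finally show ?case .
qed

lemma list_iso_append':
  assumes "X \<in> Obj (L C)" "Y \<in> Obj (L C)" "k \<in> Arr D" "Cod D k = MapO G X \<odot> MapO G Y"
  shows "list_iso (X @ Y) \<cdot> (Mult G X Y \<cdot> k) =
    Mult H X Y \<cdot> ((list_iso X \<otimes> list_iso Y) \<cdot> k)"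
proof -
  have "(list_iso (X @ Y) \<cdot> Mult G X Y) \<cdot> k =
    (Mult H X Y \<cdot> (list_iso X \<otimes> list_iso Y)) \<cdot> k"
    using assms by (simp only: list_iso_append)
  then show ?thesis
    using assms by simp
qed

section \<open>Naturality of the extended isomorphism\<close>

definition natural_at :: "('o, 'm) larr \<Rightarrow> bool" where
  "natural_at \<phi> \<longleftrightarrow> \<phi> \<in> Arr (L C) \<and>
    list_iso (Cod (L C) \<phi>) \<cdot> MapA G \<phi> = MapA H \<phi> \<cdot> list_iso (Dom (L C) \<phi>)"

lemma natural_Idt: "X \<in> Obj (L C) \<Longrightarrow> natural_at (Idt (L C) X)"
  by (simp add: natural_at_def)

lemma natural_comp:
  assumes "natural_at \<phi>" "natural_at \<psi>" "Dom (L C) \<psi> = Cod (L C) \<phi>"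
  shows "natural_at (\<psi> \<cdot>\<^bsub>L C\<^esub> \<phi>)"
proof -
  have [simp]: "\<phi> \<in> Arr (L C)" "\<psi> \<in> Arr (L C)"
    using assms by (auto simp: natural_at_def)
  have "list_iso (Cod (L C) \<psi>) \<cdot> (MapA G \<psi> \<cdot> MapA G \<phi>) =
      (list_iso (Cod (L C) \<psi>) \<cdot> MapA G \<psi>) \<cdot> MapA G \<phi>"
    using assms(3) by simp
  also have "\<dots> = MapA H \<psi> \<cdot> (list_iso (Cod (L C) \<phi>) \<cdot> MapA G \<phi>)"
    using assms by (simp add: natural_at_def)
  also have "\<dots> = MapA H \<psi> \<cdot> (MapA H \<phi> \<cdot> list_iso (Dom (L C) \<phi>))"
    using assms by (simp add: natural_at_def)
  finally show ?thesis
    using assms(3) by (simp add: natural_at_def G.map_comp_arr H.map_comp_arr)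
qed

lemma natural_tens:
  assumes "natural_at \<phi>" "natural_at \<psi>"
  shows "natural_at (\<phi> \<otimes>\<^bsub>L C\<^esub> \<psi>)"
proof -
  have a [simp]: "\<phi> \<in> Arr (L C)" "\<psi> \<in> Arr (L C)"
    using assms by (auto simp: natural_at_def)
  let ?X = "Dom (L C) \<phi>" and ?Y = "Cod (L C) \<phi>" and ?X' = "Dom (L C) \<psi>" and ?Y' = "Cod (L C) \<psi>"
  have "list_iso (?Y @ ?Y') \<cdot> MapA G (\<phi> \<otimes>\<^bsub>L C\<^esub> \<psi>) = MapA H (\<phi> \<otimes>\<^bsub>L C\<^esub> \<psi>) \<cdot> list_iso (?X @ ?X')"
  proof (rule G.D.comp_right_cancel[of "Mult G ?X ?X'"])
    have "(list_iso (?Y @ ?Y') \<cdot> MapA G (\<phi> \<otimes>\<^bsub>L C\<^esub> \<psi>)) \<cdot> Mult G ?X ?X' =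
      list_iso (?Y @ ?Y') \<cdot> (Mult G ?Y ?Y' \<cdot> (MapA G \<phi> \<otimes> MapA G \<psi>))"
      using G.mult_natural_arr[OF a] by simp
    also have "\<dots> = Mult H ?Y ?Y' \<cdot> ((list_iso ?Y \<cdot> MapA G \<phi>) \<otimes> (list_iso ?Y' \<cdot> MapA G \<psi>))"
      by (simp add: list_iso_append' G.D.merge)
    also have "\<dots> = Mult H ?Y ?Y' \<cdot> ((MapA H \<phi> \<cdot> list_iso ?X) \<otimes> (MapA H \<psi> \<cdot> list_iso ?X'))"
      using assms by (simp add: natural_at_def)
    also have "\<dots> = (Mult H ?Y ?Y' \<cdot> (MapA H \<phi> \<otimes> MapA H \<psi>)) \<cdot> (list_iso ?X \<otimes> list_iso ?X')"
      by (simp add: G.D.merge)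
    also have "\<dots> = (MapA H (\<phi> \<otimes>\<^bsub>L C\<^esub> \<psi>) \<cdot> Mult H ?X ?X') \<cdot> (list_iso ?X \<otimes> list_iso ?X')"
      using H.mult_natural_arr[OF a] by simp
    also have "\<dots> = (MapA H (\<phi> \<otimes>\<^bsub>L C\<^esub> \<psi>) \<cdot> list_iso (?X @ ?X')) \<cdot> Mult G ?X ?X'"
      by (simp add: list_iso_append)
    finally show "(list_iso (?Y @ ?Y') \<cdot> MapA G (\<phi> \<otimes>\<^bsub>L C\<^esub> \<psi>)) \<cdot> Mult G ?X ?X' =
      (MapA H (\<phi> \<otimes>\<^bsub>L C\<^esub> \<psi>) \<cdot> list_iso (?X @ ?X')) \<cdot> Mult G ?X ?X'" .
  qed simp_all
  then show ?thesis
    by (simp add: natural_at_def)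
qed

text \<open>Needed for nodes with several outgoing wires, which involve the inverse of a node that
  merges wires.\<close>

lemma natural_inv:
  assumes "natural_at \<phi>" "iso_arrow (L C) \<phi>"
  shows "natural_at (inv_arrow (L C) \<phi>)"
proof -
  have a [simp]: "\<phi> \<in> Arr (L C)"
    using assms by (auto simp: natural_at_def)
  let ?X = "Dom (L C) \<phi>" and ?Y = "Cod (L C) \<phi>"
  have "list_iso ?X \<cdot> inv_arrow D (MapA G \<phi>) = inv_arrow D (MapA H \<phi>) \<cdot> list_iso ?Y"
  proof (rule G.D.comp_right_cancel[of "MapA G \<phi>"])
    have "(inv_arrow D (MapA H \<phi>) \<cdot> list_iso ?Y) \<cdot> MapA G \<phi> =
        inv_arrow D (MapA H \<phi>) \<cdot> (list_iso ?Y \<cdot> MapA G \<phi>)"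
      using assms(2) by simp
    also have "\<dots> = list_iso ?X"
      using assms by (simp add: natural_at_def)
    finally show "(list_iso ?X \<cdot> inv_arrow D (MapA G \<phi>)) \<cdot> MapA G \<phi> =
        (inv_arrow D (MapA H \<phi>) \<cdot> list_iso ?Y) \<cdot> MapA G \<phi>"
      using assms(2) by simp
  qed (use assms(2) in simp_all)
  then show ?thesis
    using assms(2) by (simp add: natural_at_def G.map_inv H.map_inv)
qed

lemma list_iso_pair:
  assumes "A \<in> Obj C" "B \<in> Obj C"
  shows "list_iso [(A, m), (B, n)] \<cdot> Mult G [(A, m)] [(B, n)] =
    Mult H [(A, m)] [(B, n)] \<cdot> (wire_iso (A, m) \<otimes> wire_iso (B, n))"
  using list_iso_append[of "[(A, m)]" "[(B, n)]"] assms
  by (simp add: list_iso_single del: list_iso.simps)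

text \<open>After composition with \<open>Mult G\<close>, which can be cancelled, the claim is the
  mate equation for the counits with \<open>Uni H\<close> in front.\<close>

lemma natural_cap:
  assumes A [simp]: "A \<in> Obj C"
  shows "natural_at (cap_arr C A n)"
proof -
  let ?x = "[(A, n)]" and ?y = "[(A, n + 1)]" and ?t = "wire_iso (A, n)" and ?s = "wire_iso (A, n + 1)"
  have a [simp]: "cap_arr C A n \<in> Arr (L C)"
    by (rule larr_Arr) simp
  have c: "Uni H \<cdot> map_counit (L C) D H ?x ?y (cap_arr C A n) =
      MapA H (cap_arr C A n) \<cdot> Mult H ?x ?y"
    by (simp add: map_counit_def)
  have "list_iso [] \<cdot> MapA G (cap_arr C A n) = MapA H (cap_arr C A n) \<cdot> list_iso [(A, n), (A, n + 1)]"
  proof (rule G.D.comp_right_cancel[of "Mult G ?x ?y"])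
    have "(list_iso [] \<cdot> MapA G (cap_arr C A n)) \<cdot> Mult G ?x ?y =
        Uni H \<cdot> map_counit (L C) D G ?x ?y (cap_arr C A n)"
      by (simp add: map_counit_def)
    also have "\<dots> = Uni H \<cdot> (map_counit (L C) D H ?x ?y (cap_arr C A n) \<cdot> (?t \<otimes> ?s))"
      using mate_chain_wire_iso[OF A] by (simp add: mate_chain_def)
    also have "\<dots> = (Uni H \<cdot> map_counit (L C) D H ?x ?y (cap_arr C A n)) \<cdot> (?t \<otimes> ?s)"
      by (simp add: map_counit_def)
    also have "\<dots> = (MapA H (cap_arr C A n) \<cdot> list_iso [(A, n), (A, n + 1)]) \<cdot> Mult G ?x ?y"
      unfolding c by (simp add: list_iso_pair del: list_iso.simps)
    finally show "(list_iso [] \<cdot> MapA G (cap_arr C A n)) \<cdot> Mult G ?x ?y =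
      (MapA H (cap_arr C A n) \<cdot> list_iso [(A, n), (A, n + 1)]) \<cdot> Mult G ?x ?y" .
  qed (simp_all del: list_iso.simps)
  then show ?thesis
    by (simp add: natural_at_def del: list_iso.simps)
qed

lemma natural_cup:
  assumes A [simp]: "A \<in> Obj C"
  shows "natural_at (cup_arr C A n)"
proof -
  let ?x = "[(A, n)]" and ?y = "[(A, n + 1)]" and ?t = "wire_iso (A, n)" and ?s = "wire_iso (A, n + 1)"
  have a [simp]: "cup_arr C A n \<in> Arr (L C)"
    by (rule larr_Arr) simp
  have c: "Mult G ?y ?x \<cdot> map_unit (L C) D G ?x ?y (cup_arr C A n) =
      MapA G (cup_arr C A n) \<cdot> Uni G"
    by (simp add: map_unit_def)
  have "list_iso [(A, n + 1), (A, n)] \<cdot> MapA G (cup_arr C A n) = MapA H (cup_arr C A n) \<cdot> list_iso []"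
  proof (rule G.D.comp_right_cancel[of "Uni G"])
    have "(list_iso [(A, n + 1), (A, n)] \<cdot> MapA G (cup_arr C A n)) \<cdot> Uni G =
        list_iso [(A, n + 1), (A, n)] \<cdot> (Mult G ?y ?x \<cdot> map_unit (L C) D G ?x ?y (cup_arr C A n))"
      unfolding c by (simp del: list_iso.simps)
    also have "\<dots> = Mult H ?y ?x \<cdot> ((?s \<otimes> ?t) \<cdot> map_unit (L C) D G ?x ?y (cup_arr C A n))"
      using list_iso_append'[of ?y ?x "map_unit (L C) D G ?x ?y (cup_arr C A n)"]
      by (simp add: map_unit_def list_iso_single del: list_iso.simps)
    also have "\<dots> = Mult H ?y ?x \<cdot> map_unit (L C) D H ?x ?y (cup_arr C A n)"
      using mate_chain_wire_iso[OF A] by (simp add: mate_chain_def)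
    also have "\<dots> = (MapA H (cup_arr C A n) \<cdot> list_iso []) \<cdot> Uni G"
      by (simp add: map_unit_def)
    finally show "(list_iso [(A, n + 1), (A, n)] \<cdot> MapA G (cup_arr C A n)) \<cdot> Uni G =
      (MapA H (cup_arr C A n) \<cdot> list_iso []) \<cdot> Uni G" .
  qed (simp_all del: list_iso.simps)
  then show ?thesis
    by (simp add: natural_at_def del: list_iso.simps)
qed

lemma node_ends [simp]:
  "Dom (L C) (node C As f Bs) = plain As" "Cod (L C) (node C As f Bs) = plain Bs"
  by (simp_all add: node_def)

lemma natural_F_MapA:
  assumes "f \<in> Arr C" "Dom C f = A" "Cod C f = B"
  shows "natural_at (node C [A] f [B])"
  using assms t0_nat C.node_Arr[of "[A]" f "[B]"]
  by (auto simp: natural_at_def list_iso_single C.cell_ok_Node simp del: list_iso.simps cell_ok.simps)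

lemma natural_F_Mult:
  assumes [simp]: "A \<in> Obj C" "B \<in> Obj C"
  shows "natural_at (Mult (F C) A B)"
proof -
  let ?m = "Mult (F C) A B" and ?A = "[(A, 0)]" and ?B = "[(B, 0)]"
  interpret F: strong_monoidal_functor C "L C" "F C"
    by (rule C.functor_F)
  have [simp]: "?m \<in> Arr (L C)" "Dom (L C) ?m = [(A, 0), (B, 0)]" "Cod (L C) ?m = [(A \<odot>\<^bsub>C\<^esub> B, 0)]"
    using F.mult_arr[of A B] by (simp_all del: C.F_simps(3))
  have "t0 (A \<odot>\<^bsub>C\<^esub> B) \<cdot> MapA G ?m = MapA H ?m \<cdot> list_iso [(A, 0), (B, 0)]"
  proof (rule G.D.comp_right_cancel[of "Mult G ?A ?B"])
    show "(t0 (A \<odot>\<^bsub>C\<^esub> B) \<cdot> MapA G ?m) \<cdot> Mult G ?A ?B =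
        (MapA H ?m \<cdot> list_iso [(A, 0), (B, 0)]) \<cdot> Mult G ?A ?B"
      using t0_mult[of A B] list_iso_pair[of A B 0 0] t0
      by (simp del: list_iso.simps C.F_simps(3))
  qed (use t0 in \<open>simp_all del: list_iso.simps C.F_simps(3)\<close>)
  then show ?thesis
    by (simp add: natural_at_def list_iso_single del: list_iso.simps C.F_simps(3))
qed

lemma natural_F_Uni: "natural_at (Uni (F C))"
proof -
  let ?u = "Uni (F C)"
  interpret F: strong_monoidal_functor C "L C" "F C"
    by (rule C.functor_F)
  have [simp]: "?u \<in> Arr (L C)" "Dom (L C) ?u = []" "Cod (L C) ?u = [(\<one>\<^bsub>C\<^esub>, 0)]"
    using F.uni_arr by (simp_all del: C.F_simps(4))
  have "t0 \<one>\<^bsub>C\<^esub> \<cdot> MapA G ?u = MapA H ?u \<cdot> list_iso []"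
  proof (rule G.D.comp_right_cancel[of "Uni G"])
    show "(t0 \<one>\<^bsub>C\<^esub> \<cdot> MapA G ?u) \<cdot> Uni G = (MapA H ?u \<cdot> list_iso []) \<cdot> Uni G"
      using t0_uni t0 by (simp del: C.F_simps(4))
  qed (use t0 in \<open>simp_all del: C.F_simps(4)\<close>)
  then show ?thesis
    by (simp add: natural_at_def list_iso_single del: list_iso.simps(2) C.F_simps(4))
qed

text \<open>The node merging \<open>A # As\<close> is the node merging \<open>As\<close>, placed
  beside the wire \<open>A\<close> and followed by \<open>Mult (F C)\<close>. Hence naturality at
  the structure arrows of \<open>F C\<close>, which is assumed of \<open>t0\<close>,
  suffices.\<close>

lemma natural_merge:
  "set As \<subseteq> Obj C \<Longrightarrow> natural_at (node C As (Idt C (tens_list C As)) [tens_list C As])"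
proof (induction As)
  case Nil
  then show ?case
    using natural_F_Uni by simp
next
  case (Cons A As)
  let ?n = "node C As (Idt C (tens_list C As)) [tens_list C As]" and ?T = "tens_list C As"
  have [simp]: "A \<in> Obj C" "set As \<subseteq> Obj C"
    using Cons.prems by auto
  have n: "natural_at ?n"
    using Cons by simp
  then have [simp]: "?n \<in> Arr (L C)"
    by (simp add: natural_at_def)
  have "natural_at (Mult (F C) A ?T \<cdot>\<^bsub>L C\<^esub> (Idt (L C) [(A, 0)] \<otimes>\<^bsub>L C\<^esub> ?n))"
    by (intro natural_comp natural_tens natural_Idt n natural_F_Mult) simp_all
  moreover have "Idt (L C) [(A, 0)] \<otimes>\<^bsub>L C\<^esub> ?n = node C (A # As) (Idt C (A \<odot>\<^bsub>C\<^esub> ?T)) [A, ?T]"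
    using C.node_Idt[of "[A]"] C.node_tens[of "[A]" "Idt C A" "[A]" As "Idt C ?T" "[?T]"]
    by (simp add: C.cell_ok_Node del: cell_ok.simps)
  ultimately show ?case
    by (simp add: C.node_comp C.cell_ok_Node del: cell_ok.simps)
qed

text \<open>An arbitrary node factors into a merging node, a node with one wire on either side, and
  the inverse of a merging node.\<close>

lemma natural_node:
  assumes "cell_ok C (Node As f Bs)"
  shows "natural_at (node C As f Bs)"
proof -
  have [simp]: "set As \<subseteq> Obj C" "set Bs \<subseteq> Obj C" "f \<in> Arr C" "Dom C f = tens_list C As"
    "Cod C f = tens_list C Bs"
    using assms by (auto simp: C.hom_iff)
  let ?n = "\<lambda>As. node C As (Idt C (tens_list C As)) [tens_list C As]"
  have "natural_at (inv_arrow (L C) (?n Bs) \<cdot>\<^bsub>L C\<^esub> (node C [tens_list C As] f [tens_list C Bs] \<cdot>\<^bsub>L C\<^esub> ?n As))"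
    by (intro natural_comp natural_inv natural_merge natural_F_MapA)
      (simp_all add: C.node_Arr C.cell_ok_Node del: cell_ok.simps)
  moreover have "inv_arrow (L C) (?n Bs) = node C [tens_list C Bs] (Idt C (tens_list C Bs)) Bs"
    using C.node_inverse[of Bs "Idt C (tens_list C Bs)" "[tens_list C Bs]"]
    by (intro L.inv_arrow_eq) (simp add: C.cell_ok_Node del: cell_ok.simps)
  ultimately show ?thesis
    by (simp add: C.node_comp C.cell_ok_Node del: cell_ok.simps)
qed

lemma natural_cell:
  assumes "cell_ok C c"
  shows "natural_at (larr C (cell_dom c) [([], c, [])] (cell_cod c))"
  using assms natural_cap natural_cup natural_node by (cases c) (auto simp: node_def)

text \<open>A slice is a cell tensored with identities, and a diagram is a composite of slices;
  naturality is stable under both operations.\<close>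

lemma natural_diagram:
  assumes "diagram_in C UNIV X ss Y"
  shows "natural_at (larr C X ss Y)"
  using assms
proof (induction ss arbitrary: X)
  case Nil
  then show ?case
    using natural_Idt[of X] by (auto simp: L_larr_Nil L_Obj)
next
  case (Cons s ss)
  obtain u c v where s: "s = (u, c, v)"
    by (cases s)
  define Z where "Z = u @ cell_cod c @ v"
  have ok: "wires_in C UNIV u" "cell_ok C c" "wires_in C UNIV v" "X = u @ cell_dom c @ v"
    and Z: "diagram_in C UNIV Z ss Y" and d: "diagram_in C UNIV X [s] Z"
    using Cons.prems diagram_in_ends by (auto simp: s Z_def)
  have c: "diagram_in C UNIV (cell_dom c) [([], c, [])] (cell_cod c)"
    using ok(2) cell_wires_in by auto
  have i: "diagram_in C UNIV u [] u" "diagram_in C UNIV v [] v"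
    using ok by simp_all
  have "natural_at (Idt (L C) u \<otimes>\<^bsub>L C\<^esub> (larr C (cell_dom c) [([], c, [])] (cell_cod c) \<otimes>\<^bsub>L C\<^esub> Idt (L C) v))"
    using ok by (intro natural_tens natural_cell natural_Idt) (simp_all add: L_Obj)
  moreover have "larr C X [s] Z = Idt (L C) u \<otimes>\<^bsub>L C\<^esub>
      (larr C (cell_dom c) [([], c, [])] (cell_cod c) \<otimes>\<^bsub>L C\<^esub> Idt (L C) v)"
    using L_Tens[OF i(1) whisker_diagrams(3)[OF c i(2)]]
    by (simp add: L_larr_Nil[symmetric] L_Tens[OF c i(2)] ok(4) Z_def s)
  ultimately have "natural_at (larr C X [s] Z)"
    by simp
  moreover have "Dom (L C) (larr C Z ss Y) = Cod (L C) (larr C X [s] Z)"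
    unfolding L_larr_ends ..
  ultimately have "natural_at (larr C Z ss Y \<cdot>\<^bsub>L C\<^esub> larr C X [s] Z)"
    using natural_comp Cons.IH[OF Z] by blast
  then show ?case
    by (simp add: L_Comp[OF d Z])
qed

theorem functors_isomorphic: "fun_iso (L C) D G H"
  unfolding fun_iso_def
proof (intro exI[of _ list_iso] conjI ballI)
  fix X Y \<phi> assume "\<phi> \<in> hom (L C) X Y"
  then show "list_iso Y \<cdot> MapA G \<phi> = MapA H \<phi> \<cdot> list_iso X"
    using natural_diagram by (elim L_homE) (auto simp: natural_at_def)
qed (simp_all add: G.D.hom_iff list_iso_append)

end

theorem fun_iso_extend:
  assumes "strict_monoidal_category C" "strong_monoidal_functor (L C) D G"
    "strong_monoidal_functor (L C) D H"
    and "fun_iso C D (comp_fun D G (F C)) (comp_fun D H (F C))"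
  shows "fun_iso (L C) D G H"
proof -
  interpret C: strict_monoidal_category C by fact
  interpret G: strong_monoidal_functor "L C" D G by fact
  obtain t where t: "\<forall>A\<in>Obj C. t A \<in> hom D (MapO G [(A, 0)]) (MapO H [(A, 0)]) \<and> iso_arrow D (t A)"
    and nat: "\<forall>A\<in>Obj C. \<forall>B\<in>Obj C. \<forall>f\<in>hom C A B.
      t B \<cdot>\<^bsub>D\<^esub> MapA G (MapA (F C) f) = MapA H (MapA (F C) f) \<cdot>\<^bsub>D\<^esub> t A"
    and mult: "\<forall>A\<in>Obj C. \<forall>B\<in>Obj C.
      t (A \<odot>\<^bsub>C\<^esub> B) \<cdot>\<^bsub>D\<^esub> (MapA G (Mult (F C) A B) \<cdot>\<^bsub>D\<^esub> Mult G [(A, 0)] [(B, 0)]) =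
      (MapA H (Mult (F C) A B) \<cdot>\<^bsub>D\<^esub> Mult H [(A, 0)] [(B, 0)]) \<cdot>\<^bsub>D\<^esub> (t A \<otimes>\<^bsub>D\<^esub> t B)"
    and uni: "t \<one>\<^bsub>C\<^esub> \<cdot>\<^bsub>D\<^esub> (MapA G (Uni (F C)) \<cdot>\<^bsub>D\<^esub> Uni G) = MapA H (Uni (F C)) \<cdot>\<^bsub>D\<^esub> Uni H"
    using assms(4) unfolding fun_iso_def comp_fun_def
    by (simp del: C.F_simps(2-4)) blast
  interpret functor_pair C D G H t
  proof (intro functor_pair.intro functor_pair_axioms.intro assms)
    fix f A B assume "f \<in> Arr C" "Dom C f = A" "Cod C f = B"
    then show "t B \<cdot>\<^bsub>D\<^esub> MapA G (node C [A] f [B]) = MapA H (node C [A] f [B]) \<cdot>\<^bsub>D\<^esub> t A"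
      using nat by (auto simp: C.hom_iff)
  qed (use t mult uni in \<open>auto simp: G.D.hom_iff\<close>)
  show ?thesis
    by (rule functors_isomorphic)
qed

section \<open>Conservativity of the wire levels\<close>

subsection \<open>Copresheaves on diagrams\<close>

text \<open>\<open>Base s\<close> stands for an element of a representable copresheaf, and
  \<open>Ext W h p\<close> for the class of a pair: a diagram \<open>h\<close> out of
  \<open>W @ [x]\<close> and an element \<open>p\<close> at \<open>W\<close>. The wire
  \<open>x\<close> is not recorded, since it is fixed by the word whose copresheaf is
  considered.\<close>

datatype ('o, 'm) germ = Base "('o, 'm) slice list"
  | Ext "'o wire list" "('o, 'm) slice list" "('o, 'm) germ"

text \<open>\<open>Q Z\<close> is a partial equivalence relation, whose classes are the elements at the object \<open>Z\<close>.\<close>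

locale copresheaf =
  fixes C :: "('o, 'm) moncat" and J :: "int set"
    and Q :: "'o wire list \<Rightarrow> ('o, 'm) germ \<Rightarrow> ('o, 'm) germ \<Rightarrow> bool"
    and T :: "('o, 'm) slice list \<Rightarrow> ('o, 'm) germ \<Rightarrow> ('o, 'm) germ"
  assumes wires: "Q Z p q \<Longrightarrow> wires_in C J Z"
    and sym: "Q Z p q \<Longrightarrow> Q Z q p"
    and trans: "\<lbrakk>Q Z p q; Q Z q r\<rbrakk> \<Longrightarrow> Q Z p r"
    and act: "\<lbrakk>diagram_in C J Z f Z'; Q Z p q\<rbrakk> \<Longrightarrow> Q Z' (T f p) (T f q)"
    and act_eq: "\<lbrakk>diagram_eq_in C J Z Z' f g; Q Z p p\<rbrakk> \<Longrightarrow> Q Z' (T f p) (T g p)"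
    and act_Nil [simp]: "T [] p = p"
    and act_append: "T (f @ g) p = T g (T f p)"
begin

lemma left_refl: "Q Z p q \<Longrightarrow> Q Z p p"
  by (rule trans[OF _ sym])

lemma right_refl: "Q Z p q \<Longrightarrow> Q Z q q"
  by (rule trans[OF sym])

end

text \<open>The coend of \<open>Hom(W \<otimes> x, Z) \<times> Q W\<close> over \<open>W\<close>: the left adjoint of the precomposition with
  \<open>- \<otimes> x\<close>, applied to \<open>Q\<close>.\<close>

inductive ext_eq ::
  "('o, 'm) moncat \<Rightarrow> int set \<Rightarrow> 'o wire \<Rightarrow>
   ('o wire list \<Rightarrow> ('o, 'm) germ \<Rightarrow> ('o, 'm) germ \<Rightarrow> bool) \<Rightarrow>
   (('o, 'm) slice list \<Rightarrow> ('o, 'm) germ \<Rightarrow> ('o, 'm) germ) \<Rightarrow>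
   'o wire list \<Rightarrow> ('o, 'm) germ \<Rightarrow> ('o, 'm) germ \<Rightarrow> bool"
  for C J x Q T Z where
  slide: "\<lbrakk>diagram_in C J W f W'; diagram_in C J (W' @ [x]) h Z; Q W p p\<rbrakk>
    \<Longrightarrow> ext_eq C J x Q T Z (Ext W (whisker [] f [x] @ h) p) (Ext W' h (T f p))"
| cong: "\<lbrakk>diagram_eq_in C J (W @ [x]) Z h h'; Q W p q\<rbrakk>
    \<Longrightarrow> ext_eq C J x Q T Z (Ext W h p) (Ext W h' q)"
| sym: "ext_eq C J x Q T Z p q \<Longrightarrow> ext_eq C J x Q T Z q p"
| trans: "\<lbrakk>ext_eq C J x Q T Z p q; ext_eq C J x Q T Z q r\<rbrakk> \<Longrightarrow> ext_eq C J x Q T Z p r"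

text \<open>The clause for \<open>Base\<close> is a default value; elements of a coend have the form
  \<open>Ext\<close>, see \<open>ext_eq_cases\<close>.\<close>

fun ext_act :: "('o, 'm) slice list \<Rightarrow> ('o, 'm) germ \<Rightarrow> ('o, 'm) germ" where
  "ext_act f (Ext W h p) = Ext W (h @ f) p"
| "ext_act f (Base s) = Base s"

fun ext_map ::
  "('o wire list \<Rightarrow> ('o, 'm) germ \<Rightarrow> ('o, 'm) germ) \<Rightarrow> ('o, 'm) germ \<Rightarrow> ('o, 'm) germ" where
  "ext_map s (Ext W h p) = Ext W h (s W p)"
| "ext_map s (Base t) = Base t"

context copresheaf
begin

text \<open>The relation is generated by rules, so its elements have to be recognised by induction;
  afterwards they can be taken apart as pairs.\<close>

lemma ext_eq_cases:
  assumes "ext_eq C J x Q T Z p q"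
  shows "(\<exists>W h r. p = Ext W h r \<and> diagram_in C J (W @ [x]) h Z \<and> Q W r r) \<and>
    (\<exists>W h r. q = Ext W h r \<and> diagram_in C J (W @ [x]) h Z \<and> Q W r r)"
  using assms
proof induction
  case (slide W f W' h p)
  then have x: "wires_in C J [x]"
    using diagram_in_ends(1)[OF slide(2)] by simp
  have "diagram_in C J (W @ [x]) (whisker [] f [x] @ h) Z"
    by (rule diagram_in_appendI[OF diagram_in_whisker_right[OF slide(1) x] slide(2)])
  moreover have "Q W' (T f p) (T f p)"
    by (rule act[OF slide(1,3)])
  ultimately show ?case
    using slide(2,3) by blast
next
  case (cong W h h' p q)
  then show ?case
    using diagram_eq_inD[OF cong(1)] left_refl[OF cong(2)] right_refl[OF cong(2)] by blast
qed simp_all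

lemma ext_refl: "\<lbrakk>diagram_in C J (W @ [x]) h Z; Q W p p\<rbrakk> \<Longrightarrow> ext_eq C J x Q T Z (Ext W h p) (Ext W h p)"
  by (intro ext_eq.cong diagram_eq_in.refl)

lemma ext_act_append: "ext_act (f @ g) p = ext_act g (ext_act f p)"
  by (cases p) auto

lemma copresheaf_ext: "copresheaf C J (ext_eq C J x Q T) ext_act"
proof
  fix Z p q assume "ext_eq C J x Q T Z p q"
  then show "wires_in C J Z"
    using ext_eq_cases diagram_in_ends by blast
next
  fix Z f Z' p q assume f: "diagram_in C J Z f Z'" and "ext_eq C J x Q T Z p q"
  from this(2) show "ext_eq C J x Q T Z' (ext_act f p) (ext_act f q)"
  proof induction
    case (slide W g W' h p)
    then show ?case
      using ext_eq.slide[of C J W g W' x "h @ f" Z' Q p T] f by (auto intro: diagram_in_appendI)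
  next
    case (cong W h h' p q)
    then show ?case
      using f by (auto intro: ext_eq.cong diagram_eq_in_append_right)
  next
    case (sym p q)
    show ?case
      by (rule ext_eq.sym[OF sym.IH])
  next
    case (trans p q r)
    show ?case
      by (rule ext_eq.trans[OF trans.IH])
  qed
next
  fix Z Z' f g p assume fg: "diagram_eq_in C J Z Z' f g" and "ext_eq C J x Q T Z p p"
  from ext_eq_cases[OF this(2)] obtain W h r
    where "p = Ext W h r" "diagram_in C J (W @ [x]) h Z" "Q W r r"
    by blast
  then show "ext_eq C J x Q T Z' (ext_act f p) (ext_act g p)"
    using fg by (auto intro: ext_eq.cong diagram_eq_in_append_left)
next
  fix p :: "('a, 'b) germ"
  show "ext_act [] p = p"
    by (cases p) auto
next
  fix f g and p :: "('a, 'b) germ"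
  show "ext_act (f @ g) p = ext_act g (ext_act f p)"
    by (rule ext_act_append)
qed (rule ext_eq.sym ext_eq.trans; assumption)+

text \<open>Precomposition with \<open>- @ u\<close>, the functor by which old wires act.\<close>

lemma copresheaf_shift:
  assumes "wires_in C J u"
  shows "copresheaf C J (\<lambda>Z. Q (Z @ u)) (\<lambda>f. T (whisker [] f u))"
proof
  fix Z p q assume "Q (Z @ u) p q"
  then show "wires_in C J Z"
    using wires by fastforce
next
  fix Z f Z' p q assume f: "diagram_in C J Z f Z'" and p: "Q (Z @ u) p q"
  show "Q (Z' @ u) (T (whisker [] f u) p) (T (whisker [] f u) q)"
    by (rule act[OF diagram_in_whisker_right[OF f assms] p])
next
  fix Z Z' f g p assume f: "diagram_eq_in C J Z Z' f g" and p: "Q (Z @ u) p p"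
  show "Q (Z' @ u) (T (whisker [] f u) p) (T (whisker [] g u) p)"
    by (rule act_eq[OF diagram_eq_in_whisker_right[OF f assms] p])
next
  fix Z p q r assume "Q (Z @ u) p q" "Q (Z @ u) q r"
  then show "Q (Z @ u) p r"
    by (rule trans)
qed (simp_all add: sym act_append)

end

text \<open>Natural transformations are represented by maps of germs that respect the relations,
  with naturality squares that commute up to the relation of the target. \<open>trans_eq\<close>
  below is equality of the transformations so represented.\<close>

definition natural ::
  "('o, 'm) moncat \<Rightarrow> int set \<Rightarrow>
   ('o wire list \<Rightarrow> ('o, 'm) germ \<Rightarrow> ('o, 'm) germ \<Rightarrow> bool) \<Rightarrow>
   (('o, 'm) slice list \<Rightarrow> ('o, 'm) germ \<Rightarrow> ('o, 'm) germ) \<Rightarrow>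
   ('o wire list \<Rightarrow> ('o, 'm) germ \<Rightarrow> ('o, 'm) germ \<Rightarrow> bool) \<Rightarrow>
   (('o, 'm) slice list \<Rightarrow> ('o, 'm) germ \<Rightarrow> ('o, 'm) germ) \<Rightarrow>
   ('o wire list \<Rightarrow> ('o, 'm) germ \<Rightarrow> ('o, 'm) germ) \<Rightarrow> bool"
where
  "natural C J Q T Q' T' s \<longleftrightarrow>
    (\<forall>Z p q. Q Z p q \<longrightarrow> Q' Z (s Z p) (s Z q)) \<and>
    (\<forall>Z Z' f p. diagram_in C J Z f Z' \<longrightarrow> Q Z p p \<longrightarrow> Q' Z' (s Z' (T f p)) (T' f (s Z p)))"

definition trans_eq ::
  "('o wire list \<Rightarrow> ('o, 'm) germ \<Rightarrow> ('o, 'm) germ \<Rightarrow> bool) \<Rightarrow>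
   ('o wire list \<Rightarrow> ('o, 'm) germ \<Rightarrow> ('o, 'm) germ \<Rightarrow> bool) \<Rightarrow>
   ('o wire list \<Rightarrow> ('o, 'm) germ \<Rightarrow> ('o, 'm) germ) \<Rightarrow>
   ('o wire list \<Rightarrow> ('o, 'm) germ \<Rightarrow> ('o, 'm) germ) \<Rightarrow> bool"
where
  "trans_eq Q Q' s t \<longleftrightarrow> (\<forall>Z p. Q Z p p \<longrightarrow> Q' Z (s Z p) (t Z p))"

lemma naturalD:
  assumes "natural C J Q T Q' T' s"
  shows "Q Z p q \<Longrightarrow> Q' Z (s Z p) (s Z q)"
    "\<lbrakk>diagram_in C J Z f Z'; Q Z p p\<rbrakk> \<Longrightarrow> Q' Z' (s Z' (T f p)) (T' f (s Z p))"
  using assms by (auto simp: natural_def)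

lemma natural_shift:
  assumes "natural C J Q T Q' T' s" "wires_in C J u"
  shows "natural C J (\<lambda>Z. Q (Z @ u)) (\<lambda>f. T (whisker [] f u)) (\<lambda>Z. Q' (Z @ u))
    (\<lambda>f. T' (whisker [] f u)) (\<lambda>Z. s (Z @ u))"
  unfolding natural_def
proof (intro conjI allI impI)
  fix Z p q assume "Q (Z @ u) p q"
  then show "Q' (Z @ u) (s (Z @ u) p) (s (Z @ u) q)"
    by (rule naturalD(1)[OF assms(1)])
next
  fix Z Z' f p assume f: "diagram_in C J Z f Z'" and p: "Q (Z @ u) p p"
  show "Q' (Z' @ u) (s (Z' @ u) (T (whisker [] f u) p)) (T' (whisker [] f u) (s (Z @ u) p))"
    by (rule naturalD(2)[OF assms(1) diagram_in_whisker_right[OF f assms(2)] p])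
qed

text \<open>Functoriality of the coend: a sliding step is carried to a sliding step followed by a
  naturality square of \<open>s\<close>.\<close>

lemma natural_ext:
  assumes "copresheaf C J Q T" "copresheaf C J Q' T'" and s: "natural C J Q T Q' T' s"
  shows "natural C J (ext_eq C J x Q T) ext_act (ext_eq C J x Q' T') ext_act (\<lambda>_. ext_map s)"
proof -
  interpret Q: copresheaf C J Q T by fact
  interpret Q': copresheaf C J Q' T' by fact
  have *: "ext_eq C J x Q' T' Z (ext_map s p) (ext_map s q)" if "ext_eq C J x Q T Z p q" for Z p q
    using that
  proof induction
    case (slide W f W' h p)
    have "ext_eq C J x Q' T' Z (Ext W (whisker [] f [x] @ h) (s W p)) (Ext W' h (T' f (s W p)))"
      by (rule ext_eq.slide[where Q = Q'], fact, fact, rule naturalD(1)[OF s slide(3)])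
    moreover have "ext_eq C J x Q' T' Z (Ext W' h (T' f (s W p))) (Ext W' h (s W' (T f p)))"
      by (rule ext_eq.cong[where Q = Q', OF diagram_eq_in.refl[OF slide(2)]],
          rule Q'.sym, rule naturalD(2)[OF s slide(1,3)])
    ultimately show ?case
      unfolding ext_map.simps by (rule ext_eq.trans)
  next
    case (cong W h h' p q)
    show ?case
      unfolding ext_map.simps
      by (rule ext_eq.cong[where Q = Q', OF cong(1)], rule naturalD(1)[OF s cong(2)])
  next
    case (sym p q)
    show ?case
      by (rule ext_eq.sym[OF sym.IH])
  next
    case (trans p q r)
    show ?case
      by (rule ext_eq.trans[OF trans.IH])
  qed
  interpret E: copresheaf C J "ext_eq C J x Q T" ext_act
    by (rule Q.copresheaf_ext)
  have "ext_map s (ext_act f p) = ext_act f (ext_map s p)" for f p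
    by (cases p) auto
  then have "ext_eq C J x Q' T' Z' (ext_map s (ext_act f p)) (ext_act f (ext_map s p))"
    if "diagram_in C J Z f Z'" "ext_eq C J x Q T Z p p" for Z f Z' p
    using *[OF E.act[OF that]] by simp
  then show ?thesis
    using * by (auto simp: natural_def)
qed

lemma trans_eq_ext:
  assumes "copresheaf C J Q T" "trans_eq Q Q' s t"
  shows "trans_eq (ext_eq C J x Q T) (ext_eq C J x Q' T') (\<lambda>_. ext_map s) (\<lambda>_. ext_map t)"
  unfolding trans_eq_def
proof (intro allI impI)
  fix Z p assume "ext_eq C J x Q T Z p p"
  from copresheaf.ext_eq_cases[OF assms(1) this] obtain W h r
    where p: "p = Ext W h r" and h: "diagram_in C J (W @ [x]) h Z" and r: "Q W r r"
    by blast
  have "Q' W (s W r) (t W r)"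
    using assms(2) r by (simp add: trans_eq_def)
  then show "ext_eq C J x Q' T' Z (ext_map s p) (ext_map t p)"
    unfolding p ext_map.simps by (rule ext_eq.cong[where Q = Q', OF diagram_eq_in.refl[OF h]])
qed

subsection \<open>The action of diagrams on copresheaves\<close>

text \<open>The copresheaf \<open>w \<cdot> Hom(U, -)\<close> for a word \<open>w\<close>: a wire \<open>x\<close> of an old level acts by precomposition with
  \<open>- \<otimes> x\<close>, which is strictly functorial in \<open>x\<close>, and a wire \<open>A\<^sup>k\<close> of the new level acts by the left adjoint of
  the action of \<open>A\<^bsup>k+1\<^esup>\<close>.\<close>

fun germ_act :: "int \<Rightarrow> 'o wire list \<Rightarrow> ('o, 'm) slice list \<Rightarrow> ('o, 'm) germ \<Rightarrow> ('o, 'm) germ" where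
  "germ_act k [] f (Base s) = Base (s @ f)"
| "germ_act k [] f (Ext W h p) = Ext W h p"
| "germ_act k ((A, n) # w) f p =
    (if n = k then ext_act f p else germ_act k w (whisker [] f [(A, n)]) p)"

fun germ_eq ::
  "('o, 'm) moncat \<Rightarrow> int set \<Rightarrow> int \<Rightarrow> 'o wire list \<Rightarrow> 'o wire list \<Rightarrow>
   'o wire list \<Rightarrow> ('o, 'm) germ \<Rightarrow> ('o, 'm) germ \<Rightarrow> bool" where
  "germ_eq C J k U [] = (\<lambda>Z p q. \<exists>s t. p = Base s \<and> q = Base t \<and> diagram_eq_in C J U Z s t)"
| "germ_eq C J k U ((A, n) # w) =
    (if n = k then ext_eq C J (A, k + 1) (germ_eq C J k U w) (germ_act k w)
     else (\<lambda>Z. germ_eq C J k U w (Z @ [(A, n)])))"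

text \<open>The functor of the word \<open>u\<close> applied to the transformation \<open>s\<close>,
  that is, whiskering by the wires to the left of a cell.\<close>

fun lift ::
  "int \<Rightarrow> 'o wire list \<Rightarrow> ('o wire list \<Rightarrow> ('o, 'm) germ \<Rightarrow> ('o, 'm) germ) \<Rightarrow>
   'o wire list \<Rightarrow> ('o, 'm) germ \<Rightarrow> ('o, 'm) germ" where
  "lift k [] s = s"
| "lift k ((A, n) # u) s =
    (if n = k then (\<lambda>_. ext_map (lift k u s)) else (\<lambda>Z. lift k u s (Z @ [(A, n)])))"

text \<open>At level \<open>k\<close> the cup is the unit of the coend adjunction, pairing
  \<open>p\<close> with an empty diagram, and the cap is the counit, acting on \<open>q\<close> by
  \<open>h\<close>. Every other cell acts through the old action, placed to the right of
  \<open>Z\<close>. The value at \<open>Base\<close> in the clause for \<open>Cap\<close> is a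
  default.\<close>

fun cell_map ::
  "int \<Rightarrow> 'o wire list \<Rightarrow> ('o, 'm) cell \<Rightarrow> 'o wire list \<Rightarrow> ('o, 'm) germ \<Rightarrow> ('o, 'm) germ" where
  "cell_map k v (Node As f Bs) Z p = germ_act k v [(Z, Node As f Bs, [])] p"
| "cell_map k v (Cap A n) Z p =
    (if n = k then (case p of Ext W h q \<Rightarrow> germ_act k v h q | Base s \<Rightarrow> p)
     else germ_act k v [(Z, Cap A n, [])] p)"
| "cell_map k v (Cup A n) Z p = (if n = k then Ext Z [] p else germ_act k v [(Z, Cup A n, [])] p)"

text \<open>All slices are applied at the same \<open>Z\<close>, being components of natural
  transformations between the functors of successive words.\<close>

fun run :: "int \<Rightarrow> ('o, 'm) slice list \<Rightarrow> 'o wire list \<Rightarrow> ('o, 'm) germ \<Rightarrow> ('o, 'm) germ" where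
  "run k [] Z p = p"
| "run k ((u, c, v) # ss) Z p = run k ss Z (lift k u (cell_map k v c) Z p)"

lemma germ_act_Cons:
  "germ_act k ((A, n) # w) =
    (if n = k then ext_act else (\<lambda>f. germ_act k w (whisker [] f [(A, n)])))"
  by (auto simp: fun_eq_iff)

lemma lift_append: "lift k (u @ u') s = lift k u (lift k u' s)"
  by (induction k u s rule: lift.induct) simp_all

lemma ext_map_comp: "ext_map (\<lambda>Z p. s Z (t Z p)) p = ext_map s (ext_map t p)"
  by (cases p) auto

lemma ext_map_id: "ext_map (\<lambda>Z p. p) = (\<lambda>p. p)"
proof
  show "ext_map (\<lambda>Z p. p) p = p" for p :: "('o, 'm) germ"
    by (cases p) auto
qed

lemma lift_comp: "lift k u (\<lambda>Z p. s Z (t Z p)) Z p = lift k u s Z (lift k u t Z p)"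
proof (induction u arbitrary: Z p)
  case (Cons x u)
  obtain A n where x: "x = (A, n)"
    by (cases x)
  have "lift k u (\<lambda>Z p. s Z (t Z p)) = (\<lambda>Z p. lift k u s Z (lift k u t Z p))"
    using Cons by (simp add: fun_eq_iff)
  then show ?case
    by (simp add: x ext_map_comp)
qed simp

lemma lift_id: "lift k u (\<lambda>Z p. p) = (\<lambda>Z p. p)"
  by (induction u) (auto simp: ext_map_id)

lemma run_append: "run k (ss @ ts) Z p = run k ts Z (run k ss Z p)"
  by (induction k ss Z p rule: run.induct) auto

lemma run_whisker: "run k (whisker u ss v) Z p = lift k u (run k (whisker [] ss v)) Z p"
proof (induction ss arbitrary: Z p)
  case Nil
  have "run k [] = (\<lambda>Z p. p)"
    by (simp add: fun_eq_iff)
  then show ?case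
    by (simp add: lift_id)
next
  case (Cons s ss)
  obtain a c b where s: "s = (a, c, b)"
    by (cases s)
  have "run k (whisker [] (s # ss) v) =
      (\<lambda>Z p. run k (whisker [] ss v) Z (lift k a (cell_map k (b @ v) c) Z p))"
    by (simp add: s fun_eq_iff)
  then show ?case
    using Cons by (simp add: s lift_comp lift_append)
qed

text \<open>The wires of level \<open>k\<close> are formal left adjoints, added to those of the levels in \<open>J\<close>. Nodes have their
  wires in \<open>J\<close>, and no wire of level \<open>k\<close> has a left adjoint.\<close>

locale left_extension =
  fixes C :: "('o, 'm) moncat" and J :: "int set" and k :: int
  assumes k: "k \<notin> J" "k - 1 \<notin> J" "k \<noteq> 0"
begin

abbreviation I :: "int set" where
  "I \<equiv> insert k J"

lemma germ_act_J: "wires_in C J u \<Longrightarrow> germ_act k (u @ v) f = germ_act k v (whisker [] f u)"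
  using k(1) by (induction u arbitrary: f) auto

lemma germ_eq_J: "wires_in C J u \<Longrightarrow> germ_eq C J k U (u @ v) Z = germ_eq C J k U v (Z @ u)"
  using k(1) by (induction u arbitrary: Z) auto

lemma lift_J: "wires_in C J u \<Longrightarrow> lift k u s Z = s (Z @ u)"
  using k(1) by (induction u arbitrary: Z) auto

text \<open>Reading the word from its right end, a wire of level \<open>k\<close> contributes a
  coend and any other wire a shift of the argument, beginning with a representable
  copresheaf.\<close>

lemma copresheaf_germ: "wires_in C I w \<Longrightarrow> copresheaf C J (germ_eq C J k U w) (germ_act k w)"
proof (induction w)
  case Nil
  show ?case
  proof
    fix p :: "('o, 'm) germ" and f g
    show "germ_act k [] [] p = p" "germ_act k [] (f @ g) p = germ_act k [] g (germ_act k [] f p)"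
      by (cases p; simp)+
  next
    fix Z p q assume "germ_eq C J k U [] Z p q"
    then show "wires_in C J Z"
      by (auto dest!: diagram_eq_inD diagram_in_ends(2))
  next
    fix Z p q assume "germ_eq C J k U [] Z p q"
    then show "germ_eq C J k U [] Z q p"
      by (auto intro: diagram_eq_in.sym)
  next
    fix Z p q r assume "germ_eq C J k U [] Z p q" "germ_eq C J k U [] Z q r"
    then show "germ_eq C J k U [] Z p r"
      by (auto intro: diagram_eq_in.trans)
  next
    fix Z f Z' p q assume "diagram_in C J Z f Z'" "germ_eq C J k U [] Z p q"
    then show "germ_eq C J k U [] Z' (germ_act k [] f p) (germ_act k [] f q)"
      by (auto intro: diagram_eq_in_append_right)
  next
    fix Z Z' f g p assume "diagram_eq_in C J Z Z' f g" "germ_eq C J k U [] Z p p"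
    then show "germ_eq C J k U [] Z' (germ_act k [] f p) (germ_act k [] g p)"
      using diagram_eq_inD by (fastforce intro: diagram_eq_in_append_left)
  qed
next
  case (Cons x w)
  obtain A n where x: "x = (A, n)"
    by (cases x)
  interpret copresheaf C J "germ_eq C J k U w" "germ_act k w"
    using Cons by (simp add: x)
  show ?case
  proof (cases "n = k")
    case True
    then show ?thesis
      using copresheaf_ext by (simp add: x germ_act_Cons)
  next
    case False
    then show ?thesis
      using Cons.prems copresheaf_shift[of "[(A, n)]"] by (simp add: x germ_act_Cons)
  qed
qed

abbreviation nat_germ where
  "nat_germ U v w s \<equiv> natural C J (germ_eq C J k U v) (germ_act k v) (germ_eq C J k U w) (germ_act k w) s"

abbreviation eq_germ where
  "eq_germ U v w s t \<equiv> trans_eq (germ_eq C J k U v) (germ_eq C J k U w) s t"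

lemma lift_natural:
  assumes "wires_in C I u" "wires_in C I v" "wires_in C I w" "nat_germ U v w s"
  shows "nat_germ U (u @ v) (u @ w) (lift k u s)"
  using assms(1)
proof (induction u)
  case Nil
  then show ?case
    using assms(4) by simp
next
  case (Cons x u)
  obtain A n where x: "x = (A, n)"
    by (cases x)
  have IH: "nat_germ U (u @ v) (u @ w) (lift k u s)"
    using Cons by (simp add: x)
  show ?case
  proof (cases "n = k")
    case True
    have "natural C J (ext_eq C J (A, k + 1) (germ_eq C J k U (u @ v)) (germ_act k (u @ v))) ext_act
        (ext_eq C J (A, k + 1) (germ_eq C J k U (u @ w)) (germ_act k (u @ w))) ext_act (\<lambda>_. ext_map (lift k u s))"
      using Cons.prems assms by (intro natural_ext IH copresheaf_germ) (auto simp: x)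
    then show ?thesis
      using True by (simp add: x germ_act_Cons)
  next
    case False
    then have "wires_in C J [(A, n)]"
      using Cons.prems by (simp add: x)
    from natural_shift[OF IH this] show ?thesis
      using False by (simp add: x germ_act_Cons)
  qed
qed

lemma lift_eq:
  assumes "wires_in C I u" "wires_in C I v" "eq_germ U v w s t"
  shows "eq_germ U (u @ v) (u @ w) (lift k u s) (lift k u t)"
  using assms(1)
proof (induction u)
  case Nil
  then show ?case
    using assms(3) by simp
next
  case (Cons x u)
  obtain A n where x: "x = (A, n)"
    by (cases x)
  have IH: "eq_germ U (u @ v) (u @ w) (lift k u s) (lift k u t)"
    using Cons by (simp add: x)
  show ?case
  proof (cases "n = k")
    case True
    have "copresheaf C J (germ_eq C J k U (u @ v)) (germ_act k (u @ v))"
      using Cons.prems assms(2) by (intro copresheaf_germ) (simp add: x)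
    from trans_eq_ext[OF this IH] show ?thesis
      using True by (simp add: x)
  next
    case False
    then show ?thesis
      using IH by (simp add: x trans_eq_def)
  qed
qed

text \<open>A cap or cup that involves level \<open>k\<close> joins it to \<open>k + 1\<close>,
  because \<open>k - 1\<close> is not among the levels; a node avoids level \<open>k\<close> because
  \<open>k \<noteq> 0\<close>.\<close>

lemma cell_levels:
  assumes "cell_ok C c" "wires_in C I (cell_dom c)" "wires_in C I (cell_cod c)"
  obtains A where "A \<in> Obj C" "c = Cap A k" "wires_in C J [(A, k + 1)]"
  | A where "A \<in> Obj C" "c = Cup A k" "wires_in C J [(A, k + 1)]"
  | "wires_in C J (cell_dom c)" "wires_in C J (cell_cod c)"
    "\<And>v Z p. cell_map k v c Z p = germ_act k v [(Z, c, [])] p"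
proof (cases c)
  case (Node As f Bs)
  then show ?thesis
    using assms k that(3) by (simp add: wires_in_plain)
next
  case (Cap A n)
  then have "n + 1 \<noteq> k"
    using assms k by auto
  then show ?thesis
    using Cap assms that(1)[of A] that(3) by (cases "n = k") auto
next
  case (Cup A n)
  then have "n + 1 \<noteq> k"
    using assms k by auto
  then show ?thesis
    using Cup assms that(2)[of A] that(3) by (cases "n = k") auto
qed

text \<open>For the cap the point is independence of the representing pair, where a sliding step
  becomes associativity of the action. For the cup naturality is a single sliding step, and for old
  cells it is \<open>diagram_interchange\<close>.\<close>

lemma cell_natural:
  assumes c: "cell_ok C c" "wires_in C I (cell_dom c)" "wires_in C I (cell_cod c)"
    and v: "wires_in C I v"
  shows "nat_germ U (cell_dom c @ v) (cell_cod c @ v) (cell_map k v c)"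
proof -
  interpret V: copresheaf C J "germ_eq C J k U v" "germ_act k v"
    by (rule copresheaf_germ[OF v])
  from c show ?thesis
  proof (cases rule: cell_levels)
    case (1 A)
    let ?x = "(A, k + 1)"
    have "k + 1 \<noteq> k"
      by simp
    interpret S: copresheaf C J "\<lambda>Z. germ_eq C J k U v (Z @ [?x])" "\<lambda>f. germ_act k v (whisker [] f [?x])"
      using 1 by (intro V.copresheaf_shift)
    let ?E = "ext_eq C J ?x (\<lambda>Z. germ_eq C J k U v (Z @ [?x])) (\<lambda>f. germ_act k v (whisker [] f [?x]))"
    have E: "germ_eq C J k U (cell_dom c @ v) = ?E" "germ_act k (cell_dom c @ v) = ext_act"
      using 1 by (simp_all add: germ_act_Cons)
    have *: "germ_eq C J k U v Z (cell_map k v c Z p) (cell_map k v c Z q)" if "?E Z p q" for Z p q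
      using that
    proof induction
      case (slide W f W' h p)
      have "diagram_in C J (W @ [?x]) (whisker [] f [?x]) (W' @ [?x])"
        using slide(1) 1(3) by (rule diagram_in_whisker_right)
      then have "germ_eq C J k U v Z (germ_act k v (whisker [] f [?x] @ h) p) (germ_act k v (whisker [] f [?x] @ h) p)"
        using slide by (intro V.act[OF diagram_in_appendI])
      then show ?case
        using 1 by (simp add: V.act_append)
    next
      case (cong W h h' p q)
      have "germ_eq C J k U v Z (germ_act k v h p) (germ_act k v h' p)"
        by (rule V.act_eq[OF cong(1) V.left_refl[OF cong(2)]])
      moreover have "germ_eq C J k U v Z (germ_act k v h' p) (germ_act k v h' q)"
        by (rule V.act[OF diagram_eq_inD[OF cong(1), THEN conjunct2] cong(2)])
      ultimately have "germ_eq C J k U v Z (germ_act k v h p) (germ_act k v h' q)"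
        by (rule V.trans)
      then show ?case
        using 1 by simp
    next
      case (sym p q)
      show ?case
        by (rule V.sym[OF sym.IH])
    next
      case (trans p q r)
      show ?case
        by (rule V.trans[OF trans.IH])
    qed
    moreover have "germ_eq C J k U v Z' (cell_map k v c Z' (ext_act f p)) (germ_act k v f (cell_map k v c Z p))"
      if f: "diagram_in C J Z f Z'" and p: "?E Z p p" for Z f Z' p
    proof -
      from S.ext_eq_cases[OF p] obtain W h r where "p = Ext W h r"
        by blast
      then have "cell_map k v c Z' (ext_act f p) = germ_act k v f (cell_map k v c Z p)"
        using 1 by (simp add: V.act_append)
      then show ?thesis
        using V.act[OF f *[OF p]] by simp
    qed
    ultimately show ?thesis
      unfolding natural_def E using 1 by simp
  next
    case (2 A)
    let ?x = "(A, k + 1)"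
    let ?E = "ext_eq C J ?x (germ_eq C J k U v) (germ_act k v)"
    have E: "germ_eq C J k U (cell_cod c @ v) = (\<lambda>Z. ?E (Z @ [?x]))"
      "germ_act k (cell_cod c @ v) = (\<lambda>f. ext_act (whisker [] f [?x]))"
      using 2 by (simp_all add: germ_act_Cons)
    have "?E (Z @ [?x]) (Ext Z [] p) (Ext Z [] q)" if "germ_eq C J k U v Z p q" for Z p q
      using that V.wires[OF that] 2 by (intro ext_eq.cong diagram_eq_in.refl) auto
    moreover have "?E (Z' @ [?x]) (Ext Z' [] (germ_act k v f p)) (ext_act (whisker [] f [?x]) (Ext Z [] p))"
      if f: "diagram_in C J Z f Z'" and p: "germ_eq C J k U v Z p p" for Z f Z' p
      using ext_eq.slide[of C J Z f Z' ?x "[]" "Z' @ [?x]" "germ_eq C J k U v" p "germ_act k v"] f p 2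
        diagram_in_ends[OF f] by (auto intro: ext_eq.sym)
    ultimately show ?thesis
      unfolding natural_def E using 2 by simp
  next
    case 3
    have "germ_eq C J k U v (Z' @ cell_cod c)
        (germ_act k v [(Z', c, [])] (germ_act k v (whisker [] f (cell_dom c)) p))
        (germ_act k v (whisker [] f (cell_cod c)) (germ_act k v [(Z, c, [])] p))"
      if f: "diagram_in C J Z f Z'" and p: "germ_eq C J k U v (Z @ cell_dom c) p p" for Z f Z' p
      using V.act_eq[OF diagram_interchange[OF f, of "cell_dom c" "[([], c, [])]" "cell_cod c"] p] c 3
      by (simp add: V.act_append[symmetric])
    moreover have "germ_eq C J k U v (Z @ cell_cod c) (germ_act k v [(Z, c, [])] p) (germ_act k v [(Z, c, [])] q)"
      if "germ_eq C J k U v (Z @ cell_dom c) p q" for Z p q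
      using that V.wires[OF that] c 3 by (intro V.act[of "Z @ cell_dom c"]) auto
    ultimately show ?thesis
      unfolding natural_def using 3 by (simp add: germ_act_J germ_eq_J)
  qed
qed

text \<open>This is what makes the exchange move hold.\<close>

lemma cell_map_commute:
  assumes c: "cell_ok C c" "wires_in C I (cell_dom c)" "wires_in C I (cell_cod c)"
    and v: "wires_in C I v" "wires_in C I w" and s: "nat_germ U v w s"
    and p: "germ_eq C J k U (cell_dom c @ v) Z p p"
  shows "germ_eq C J k U (cell_cod c @ w) Z
    (lift k (cell_cod c) s Z (cell_map k v c Z p)) (cell_map k w c Z (lift k (cell_dom c) s Z p))"
proof -
  interpret V: copresheaf C J "germ_eq C J k U v" "germ_act k v"
    by (rule copresheaf_germ[OF v(1)])
  from c show ?thesis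
  proof (cases rule: cell_levels)
    case (1 A)
    let ?x = "(A, k + 1)"
    interpret S: copresheaf C J "\<lambda>Z. germ_eq C J k U v (Z @ [?x])" "\<lambda>f. germ_act k v (whisker [] f [?x])"
      using 1 by (intro V.copresheaf_shift)
    have "ext_eq C J ?x (\<lambda>Z. germ_eq C J k U v (Z @ [?x])) (\<lambda>f. germ_act k v (whisker [] f [?x])) Z p p"
      using p 1 by (simp add: germ_act_Cons)
    from S.ext_eq_cases[OF this] obtain W h r
      where "p = Ext W h r" "diagram_in C J (W @ [?x]) h Z" "germ_eq C J k U v (W @ [?x]) r r"
      by blast
    \<comment> \<open>At the element \<open>Ext W h r\<close> the two sides differ by the naturality
      square of \<open>s\<close> at \<open>h\<close>.\<close>
    then show ?thesis
      using 1 naturalD(2)[OF s] by simp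
  next
    case (2 A)
    have "germ_eq C J k U w Z (s Z p) (s Z p)"
      using naturalD(1)[OF s] p 2 by simp
    then show ?thesis
      using 2 diagram_in_ends copresheaf.wires[OF copresheaf_germ[OF v(2)]]
      by (auto intro!: ext_eq.cong diagram_eq_in.refl)
  next
    case 3
    have p': "germ_eq C J k U v (Z @ cell_dom c) p p"
      using p 3 by (simp add: germ_eq_J)
    have "diagram_in C J (Z @ cell_dom c) [(Z, c, [])] (Z @ cell_cod c)"
      using 3 c V.wires[OF p'] by simp
    from naturalD(2)[OF s this p'] show ?thesis
      using 3 by (simp add: germ_eq_J lift_J)
  qed
qed

lemma run_natural:
  assumes "diagram_in C I X ss Y"
  shows "nat_germ U X Y (run k ss)"
  using assms
proof (induction ss arbitrary: X)
  case Nil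
  have "copresheaf C J (germ_eq C J k U X) (germ_act k X)"
    using Nil by (intro copresheaf_germ) auto
  then show ?case
    using Nil by (auto simp: natural_def intro: copresheaf.act)
next
  case (Cons s ss)
  obtain u c v where s: "s = (u, c, v)"
    by (cases s)
  let ?Z = "u @ cell_cod c @ v"
  have d: "diagram_in C I ?Z ss Y" and ok: "wires_in C I u" "cell_ok C c" "wires_in C I (cell_dom c)"
    "wires_in C I (cell_cod c)" "wires_in C I v" and X: "X = u @ cell_dom c @ v"
    using Cons.prems by (simp_all add: s)
  have 1: "nat_germ U X ?Z (lift k u (cell_map k v c))"
    unfolding X using ok by (intro lift_natural cell_natural) simp_all
  have 2: "nat_germ U ?Z Y (run k ss)"
    by (rule Cons.IH[OF d])
  interpret Y: copresheaf C J "germ_eq C J k U Y" "germ_act k Y"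
    using diagram_in_ends(2)[OF d] by (rule copresheaf_germ)
  interpret Z: copresheaf C J "germ_eq C J k U ?Z" "germ_act k ?Z"
    using diagram_in_ends(1)[OF d] by (rule copresheaf_germ)
  show ?case
    unfolding natural_def
  proof (intro conjI allI impI)
    fix W p q assume "germ_eq C J k U X W p q"
    then show "germ_eq C J k U Y W (run k (s # ss) W p) (run k (s # ss) W q)"
      using naturalD(1)[OF 2 naturalD(1)[OF 1]] by (simp add: s)
  next
    fix W W' f p assume f: "diagram_in C J W f W'" and p: "germ_eq C J k U X W p p"
    let ?t = "lift k u (cell_map k v c)"
    have "germ_eq C J k U Y W' (run k ss W' (?t W' (germ_act k X f p))) (run k ss W' (germ_act k ?Z f (?t W p)))"
      by (rule naturalD(1)[OF 2 naturalD(2)[OF 1 f p]])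
    moreover have "germ_eq C J k U Y W' (run k ss W' (germ_act k ?Z f (?t W p)))
        (germ_act k Y f (run k ss W (?t W p)))"
      by (rule naturalD(2)[OF 2 f naturalD(1)[OF 1 p]])
    ultimately show "germ_eq C J k U Y W' (run k (s # ss) W' (germ_act k X f p)) (germ_act k Y f (run k (s # ss) W p))"
      using Y.trans by (simp add: s)
  qed
qed

text \<open>On diagrams of old levels the interpretation is the old action. Hence moves among such
  diagrams are respected, and in the end a diagram can be read off from its interpretation.\<close>

lemma run_J:
  assumes "diagram_in C J X ss Y" "wires_in C I v"
  shows "run k (whisker [] ss v) Z p = germ_act k v (whisker Z ss []) p"
  using assms(1)
proof (induction ss arbitrary: X p)
  case Nil
  then show ?case
    using copresheaf.act_Nil[OF copresheaf_germ[OF assms(2)]] by simp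
next
  case (Cons s ss)
  obtain a c b where s: "s = (a, c, b)"
    by (cases s)
  have d: "diagram_in C J (a @ cell_cod c @ b) ss Y" and ok: "wires_in C J a" "cell_ok C c"
    "wires_in C J (cell_dom c)" "wires_in C J (cell_cod c)" "wires_in C J b"
    using Cons.prems by (simp_all add: s)
  have "cell_map k (b @ v) c (Z @ a) p = germ_act k (b @ v) [(Z @ a, c, [])] p"
    using ok k by (cases c) auto
  also have "\<dots> = germ_act k v [(Z @ a, c, b)] p"
    using ok by (simp add: germ_act_J)
  finally have "lift k a (cell_map k (b @ v) c) Z p = germ_act k v [(Z @ a, c, b)] p"
    using ok by (simp add: lift_J)
  then show ?case
    using Cons.IH[OF d] copresheaf.act_append[OF copresheaf_germ[OF assms(2)],
        of "[(Z @ a, c, b)]" "whisker Z ss []"]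
    by (simp add: s)
qed

lemma run_move_J:
  assumes "move C l r" "diagram_in C J a l b" "diagram_in C J a r b" "wires_in C I v"
  shows "eq_germ U (a @ v) (b @ v) (run k (whisker [] l v)) (run k (whisker [] r v))"
  unfolding trans_eq_def
proof (intro allI impI)
  interpret V: copresheaf C J "germ_eq C J k U v" "germ_act k v"
    by (rule copresheaf_germ) fact
  note ends = diagram_in_ends[OF assms(2)]
  fix Z p assume "germ_eq C J k U (a @ v) Z p p"
  then have p: "germ_eq C J k U v (Z @ a) p p"
    using ends by (simp add: germ_eq_J)
  have "diagram_eq_in C J (Z @ a) (Z @ b) (whisker Z l []) (whisker Z r [])"
    using V.wires[OF p] by (intro diagram_eq_in_whisker_left move_diagram_eq assms) simp
  from V.act_eq[OF this p] show "germ_eq C J k U (b @ v) Z (run k (whisker [] l v) Z p) (run k (whisker [] r v) Z p)"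
    using ends by (simp add: germ_eq_J run_J[OF assms(2,4)] run_J[OF assms(3,4)])
qed

text \<open>Only two kinds of moves need more than the old action: exchange, which is the
  interchange of natural transformations, and the yankings at level \<open>k\<close>, which are the
  triangles of the coend adjunction.\<close>

lemma run_move:
  assumes "move C l r" "diagram_in C I a l b" "diagram_in C I a r b" "wires_in C I v"
  shows "eq_germ U (a @ v) (b @ v) (run k (whisker [] l v)) (run k (whisker [] r v))"
proof -
  have k1: "n + 1 \<noteq> k" if "n \<in> I" for n
    using that k by auto
  interpret V: copresheaf C J "germ_eq C J k U v" "germ_act k v"
    by (rule copresheaf_germ) fact
  from assms(1) show ?thesis
  proof (cases rule: move.cases)
    case (exchange c w d)
    have a: "a = cell_dom c @ w @ cell_dom d" and b: "b = cell_cod c @ w @ cell_cod d"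
      and ok: "cell_ok C c" "wires_in C I (cell_dom c)" "wires_in C I (cell_cod c)" "wires_in C I w"
      "cell_ok C d" "wires_in C I (cell_dom d)" "wires_in C I (cell_cod d)"
      using assms(2) exchange by auto
    have "nat_germ U (w @ cell_dom d @ v) (w @ cell_cod d @ v) (lift k w (cell_map k v d))"
      using ok assms(4) by (intro lift_natural cell_natural) auto
    then show ?thesis
      unfolding trans_eq_def exchange a b using ok assms(4)
      by (auto simp: lift_append intro!: cell_map_commute)
  next
    case (yank_left A n)
    have ab: "a = [(A, n)]" "b = [(A, n)]" and n: "n \<in> I" "n + 1 \<in> I" and A: "A \<in> Obj C"
      using assms(2) yank_left by auto
    show ?thesis
    proof (cases "n = k")
      \<comment> \<open>The cup turns \<open>Ext W h p\<close> into
        \<open>Ext W h (Ext W [] p)\<close>; the cap lets \<open>h\<close> act on the inner pair and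
        returns \<open>Ext W h p\<close>.\<close>
      case True
      then show ?thesis
        unfolding trans_eq_def yank_left ab by (auto dest!: V.ext_eq_cases intro!: V.ext_refl)
    next
      case False
      then show ?thesis
        using assms(2,3) n A k1 unfolding yank_left
        by (intro run_move_J[OF assms(1)[unfolded yank_left] _ _ assms(4)]) auto
    qed
  next
    case (yank_right A n)
    have ab: "a = [(A, n + 1)]" "b = [(A, n + 1)]" and n: "n \<in> I" "n + 1 \<in> I" and A: "A \<in> Obj C"
      using assms(2) yank_right by auto
    show ?thesis
    proof (cases "n = k")
      \<comment> \<open>Here the cup pairs \<open>p\<close> with an empty diagram, and the cap then
        lets the empty diagram act on \<open>p\<close>.\<close>
      case True
      then show ?thesis
        unfolding trans_eq_def yank_right ab by auto
    next
      case False
      then show ?thesis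
        using assms(2,3) n A k1 unfolding yank_right
        by (intro run_move_J[OF assms(1)[unfolded yank_right] _ _ assms(4)]) auto
    qed
  next
    case (stack As f Bs g Es)
    then show ?thesis
      using assms k(3) by (intro run_move_J[OF assms(1) _ _ assms(4)]) (auto simp: wires_in_plain)
  next
    case (juxtapose As f Bs As' f' Bs')
    then show ?thesis
      using assms k(3) by (intro run_move_J[OF assms(1) _ _ assms(4)]) (auto simp: wires_in_plain)
  next
    case (identity As)
    then show ?thesis
      using assms k(3) by (intro run_move_J[OF assms(1) _ _ assms(4)]) (auto simp: wires_in_plain)
  qed
qed

lemma run_diagram_eq:
  assumes "diagram_eq_in C I X Y ss ts"
  shows "eq_germ U X Y (run k ss) (run k ts)"
proof -
  have "wires_in C I Y"
    using diagram_eq_inD[OF assms] diagram_in_ends by blast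
  then interpret Y: copresheaf C J "germ_eq C J k U Y" "germ_act k Y"
    by (rule copresheaf_germ)
  show ?thesis
    using assms
  proof (induction rule: diagram_eq_in_induct)
    case (refl ss)
    then show ?case
      using naturalD(1)[OF run_natural] by (auto simp: trans_eq_def)
  next
    case (step l r a b u v ss ts)
    have "eq_germ U (u @ a @ v) (u @ b @ v) (lift k u (run k (whisker [] l v))) (lift k u (run k (whisker [] r v)))"
      using step diagram_in_ends by (intro lift_eq run_move) auto
    then show ?case
      using naturalD(1)[OF run_natural[OF step(6)]] naturalD(1)[OF run_natural[OF step(7)]]
      by (simp add: trans_eq_def run_append run_whisker[of k u])
  next
    case (sym ss ts)
    then show ?case
      using Y.sym by (auto simp: trans_eq_def)
  next
    case (trans ss ts us)
    then show ?case
      using Y.trans by (fastforce simp: trans_eq_def)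
  qed
qed

text \<open>The generic element \<open>1\<^sub>X\<close> of the copresheaf represented by \<open>X\<close> is sent by a diagram to its
  class.\<close>

theorem level_conservative:
  assumes "diagram_eq_in C I X Y ss ts" "diagram_in C J X ss Y" "diagram_in C J X ts Y"
  shows "diagram_eq_in C J X Y ss ts"
proof -
  have X: "wires_in C J X" and Y: "wires_in C J Y"
    using diagram_in_ends[OF assms(2)] by auto
  \<comment> \<open>By \<open>germ_eq_J\<close> the word \<open>X\<close> shifts the argument from
    \<open>[]\<close> to \<open>X\<close>, so the elements concerned are diagrams from
    \<open>X\<close> to \<open>X\<close>.\<close>
  have "germ_eq C J k X X [] (Base []) (Base [])"
    using X germ_eq_J[OF X, of X "[]" "[]"] by (auto intro: diagram_eq_in.refl)
  then have "germ_eq C J k X Y [] (run k ss [] (Base [])) (run k ts [] (Base []))"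
    using run_diagram_eq[OF assms(1), of X] by (simp add: trans_eq_def)
  then show ?thesis
    using run_J[OF assms(2), of "[]" "[]"] run_J[OF assms(3), of "[]" "[]"] germ_eq_J[OF Y, of X "[]" "[]"]
    by auto
qed

end

subsection \<open>Turning diagrams upside down\<close>

definition op_cat :: "('o, 'm) moncat \<Rightarrow> ('o, 'm) moncat" where
  "op_cat C = C\<lparr>Dom := Cod C, Cod := Dom C, Comp := \<lambda>g f. Comp C f g\<rparr>"

lemma op_cat_simps [simp]:
  "Obj (op_cat C) = Obj C" "Arr (op_cat C) = Arr C" "Dom (op_cat C) = Cod C"
  "Cod (op_cat C) = Dom C" "Idt (op_cat C) = Idt C" "Comp (op_cat C) g f = Comp C f g"
  "TensO (op_cat C) = TensO C" "Tens (op_cat C) = Tens C" "Unit (op_cat C) = Unit C"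
  "hom (op_cat C) A B = hom C B A" "tens_list (op_cat C) = tens_list C"
  "op_cat (op_cat C) = C" "wires_in (op_cat C) = wires_in C"
  by (auto simp: op_cat_def hom_def tens_list_def fun_eq_iff wires_in_def wires_ok_def)

definition flip_wires :: "'o wire list \<Rightarrow> 'o wire list" where
  "flip_wires X = map (\<lambda>(A, n). (A, - n)) X"

text \<open>Turning upside down keeps the order of the wires and negates exponents. A cap on the
  exponents \<open>n\<close>, \<open>n + 1\<close> becomes a cup that creates \<open>- n\<close>,
  \<open>- n - 1\<close>, and the index of a cup is the smaller of its exponents.\<close>

fun flip_cell :: "('o, 'm) cell \<Rightarrow> ('o, 'm) cell" where
  "flip_cell (Node As f Bs) = Node Bs f As"
| "flip_cell (Cap A n) = Cup A (- n - 1)"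
| "flip_cell (Cup A n) = Cap A (- n - 1)"

definition flip_slices :: "('o, 'm) slice list \<Rightarrow> ('o, 'm) slice list" where
  "flip_slices ss = rev (map (\<lambda>(u, c, v). (flip_wires u, flip_cell c, flip_wires v)) ss)"

lemma flip_wires_simps [simp]:
  "flip_wires [] = []" "flip_wires ((A, n) # X) = (A, - n) # flip_wires X"
  "flip_wires (X @ Y) = flip_wires X @ flip_wires Y"
  "flip_wires (plain As) = plain As" "flip_wires (flip_wires X) = X"
proof -
  show "flip_wires (flip_wires X) = X"
    by (induction X) (auto simp: flip_wires_def)
qed (simp_all add: flip_wires_def plain_def)

lemma flip_cell_simps [simp]:
  "cell_dom (flip_cell c) = flip_wires (cell_cod c)"
  "cell_cod (flip_cell c) = flip_wires (cell_dom c)"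
  "flip_cell (flip_cell c) = c"
  "cell_ok (op_cat C) (flip_cell c) = cell_ok C c"
  by (cases c; auto)+

lemma flip_slices_simps [simp]:
  "flip_slices [] = []"
  "flip_slices ((u, c, v) # ss) = flip_slices ss @ [(flip_wires u, flip_cell c, flip_wires v)]"
  "flip_slices (ss @ ts) = flip_slices ts @ flip_slices ss"
  "flip_slices (flip_slices ss) = ss"
  by (auto simp: flip_slices_def rev_map[symmetric] case_prod_beta intro!: map_idI)

lemma flip_slices_whisker:
  "flip_slices (whisker u ss v) = whisker (flip_wires u) (flip_slices ss) (flip_wires v)"
  by (induction ss) auto

lemma wires_in_flip [simp]: "wires_in C (uminus ` J) (flip_wires X) = wires_in C J X"
  by (induction X) auto

lemma flip_diagram:
  "diagram_in C J X ss Y \<Longrightarrow>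
    diagram_in (op_cat C) (uminus ` J) (flip_wires Y) (flip_slices ss) (flip_wires X)"
proof (induction ss arbitrary: X)
  case (Cons s ss)
  obtain u c v where s: "s = (u, c, v)"
    by (cases s)
  show ?case
    using Cons.prems Cons.IH[of "u @ cell_cod c @ v"] unfolding s flip_slices_simps
    by (intro diagram_in_appendI[of _ _ _ _ "flip_wires (u @ cell_cod c @ v)"]) auto
qed auto

text \<open>The conclusion is an equality rather than a move: an exchange is reversed in direction,
  and a juxtaposition needs an exchange beforehand. The two yankings change places.\<close>

lemma flip_move:
  assumes "move C l r" "diagram_in C J X l Y" "diagram_in C J X r Y"
  shows "diagram_eq_in (op_cat C) (uminus ` J) (flip_wires Y) (flip_wires X) (flip_slices l) (flip_slices r)"
proof -
  note d = flip_diagram[OF assms(2)] flip_diagram[OF assms(3)]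
  note move_op = move_diagram_eq[OF _ d]
  from assms(1) show ?thesis
  proof (cases rule: move.cases)
    case (exchange c w d)
    have "move (op_cat C) (flip_slices r) (flip_slices l)"
      using move.exchange[of "op_cat C" "flip_cell c" "flip_wires w" "flip_cell d"]
      by (simp add: exchange)
    then show ?thesis
      by (intro diagram_eq_in.sym[OF move_diagram_eq] d)
  next
    case (yank_left A n)
    then show ?thesis
      using move.yank_right[of "op_cat C" A "- n - 1"] by (intro move_op) simp
  next
    case (yank_right A n)
    then show ?thesis
      using move.yank_left[of "op_cat C" A "- n - 1"] by (intro move_op) simp
  next
    case (stack As f Bs g Es)
    then show ?thesis
      using move.stack[of "op_cat C" Es g Bs f As] by (intro move_op) simp
  next
    case (juxtapose As f Bs As' f' Bs')
    \<comment> \<open>After flipping, the right-hand node comes first; \<open>?m\<close> restores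
      the order in which the juxtaposition move expects the two nodes.\<close>
    let ?m = "[([], Node Bs f As, plain Bs'), (plain As, Node Bs' f' As', [])]"
    have Y: "Y = plain Bs @ plain Bs'" and X: "X = plain As @ plain As'"
      using juxtapose assms(2) by auto
    have m: "diagram_in (op_cat C) (uminus ` J) (flip_wires Y) ?m (flip_wires X)"
      using d(1) by (simp add: juxtapose X Y)
    have "move (op_cat C) ?m (flip_slices l)"
      using move.exchange[of "op_cat C" "Node Bs f As" "[]" "Node Bs' f' As'"] by (simp add: juxtapose)
    from diagram_eq_in.sym[OF move_diagram_eq[OF this m d(1)]]
    have "diagram_eq_in (op_cat C) (uminus ` J) (flip_wires Y) (flip_wires X) (flip_slices l) ?m" .
    moreover have "move (op_cat C) ?m (flip_slices r)"
      using move.juxtapose[of "op_cat C" Bs f As Bs' f' As'] by (simp add: juxtapose)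
    from move_diagram_eq[OF this m d(2)]
    have "diagram_eq_in (op_cat C) (uminus ` J) (flip_wires Y) (flip_wires X) ?m (flip_slices r)" .
    ultimately show ?thesis
      by (rule diagram_eq_in.trans)
  next
    case (identity As)
    then show ?thesis
      using move.identity[of "op_cat C" As] by (intro move_op) simp
  qed
qed

lemma flip_diagram_eq:
  assumes "diagram_eq_in C J X Y ss ts"
  shows "diagram_eq_in (op_cat C) (uminus ` J) (flip_wires Y) (flip_wires X)
    (flip_slices ss) (flip_slices ts)"
  using assms
proof (induction rule: diagram_eq_in_induct)
  case (refl ss)
  then show ?case
    by (intro diagram_eq_in.refl flip_diagram)
next
  case (step l r a b u v ss ts)
  have "diagram_eq_in (op_cat C) (uminus ` J) (flip_wires (u @ b @ v)) (flip_wires (u @ a @ v))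
      (flip_slices (whisker u l v)) (flip_slices (whisker u r v))"
    unfolding flip_slices_whisker flip_wires_simps(3)
    using step by (intro diagram_eq_in_whisker flip_move) auto
  from diagram_eq_in_append_right[OF
      diagram_eq_in_append_left[OF this flip_diagram[OF step(7)]] flip_diagram[OF step(6)]]
  show ?case
    by simp
next
  case (sym ss ts)
  show ?case
    by (rule diagram_eq_in.sym[OF sym(2)])
next
  case (trans ss ts us)
  show ?case
    by (rule diagram_eq_in.trans[OF trans(3,4)])
qed

subsection \<open>Faithfulness of the embedding\<close>

text \<open>The bounds keep level 0 among the old levels: the new level \<open>a - 1\<close> is
  negative, and it is the only one by which the two intervals differ.\<close>

lemma level_conservative_left:
  assumes "diagram_eq_in C {a - 1..b} X Y ss ts" "a \<le> 0" "0 \<le> b"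
    "diagram_in C {a..b} X ss Y" "diagram_in C {a..b} X ts Y"
  shows "diagram_eq_in C {a..b} X Y ss ts"
proof -
  interpret left_extension C "{a..b}" "a - 1"
    using assms(2) by unfold_locales simp_all
  have "{a - 1..b} = insert (a - 1) {a..b}"
    using assms(2,3) by auto
  from assms(1)[unfolded this] show ?thesis
    by (rule level_conservative) fact+
qed

lemma level_conservative_right:
  assumes "diagram_eq_in C {a..b + 1} X Y ss ts" "a \<le> 0" "0 \<le> b"
    "diagram_in C {a..b} X ss Y" "diagram_in C {a..b} X ts Y"
  shows "diagram_eq_in C {a..b} X Y ss ts"
proof -
  have 1: "uminus ` {a..b + 1} = {- b - 1..- a}" and 2: "uminus ` {a..b} = {- b..- a}"
    and 3: "uminus ` {- b..- a} = {a..b}"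
    by simp_all
  have "diagram_eq_in (op_cat C) {- b..- a} (flip_wires Y) (flip_wires X) (flip_slices ss) (flip_slices ts)"
    by (rule level_conservative_left[OF flip_diagram_eq[OF assms(1), unfolded 1] _ _
          flip_diagram[OF assms(4), unfolded 2] flip_diagram[OF assms(5), unfolded 2]])
      (use assms(2,3) in simp_all)
  from flip_diagram_eq[OF this, unfolded 3] show ?thesis
    by simp
qed

abbreviation levels :: "nat \<Rightarrow> int set" where
  "levels N \<equiv> {- int N..int N}"

lemma level_conservative_0:
  assumes "diagram_eq_in C (levels N) X Y ss ts"
    "diagram_in C {0} X ss Y" "diagram_in C {0} X ts Y"
  shows "diagram_eq_in C {0} X Y ss ts"
  using assms(1)
proof (induction N)
  case (Suc N)
  have d: "diagram_in C {- int N..b} X ss Y" "diagram_in C {- int N..b} X ts Y" if "0 \<le> b" for b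
    using that by (simp_all add: diagram_in_mono[OF assms(2)] diagram_in_mono[OF assms(3)])
  have "levels (Suc N) = {- int N - 1..int N + 1}"
    by auto
  from Suc.prems[unfolded this] have "diagram_eq_in C {- int N..int N + 1} X Y ss ts"
    by (rule level_conservative_left[OF _ _ _ d]) simp_all
  then have "diagram_eq_in C (levels N) X Y ss ts"
    by (rule level_conservative_right[OF _ _ _ d]) simp_all
  then show ?case
    by (rule Suc.IH)
qed simp

text \<open>Speaking of all sufficiently large \<open>N\<close> lets the bounds for the parts of a
  diagram be combined without computing a maximum.\<close>

lemma eventually_wires_in:
  "wires_in C UNIV X \<Longrightarrow> \<forall>\<^sub>F N in sequentially. wires_in C (levels N) X"
proof (induction X)
  case (Cons x X)
  obtain A n where x: "x = (A, n)"
    by (cases x)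
  have "\<forall>\<^sub>F N in sequentially. n \<in> levels N"
    using eventually_ge_at_top[of "nat \<bar>n\<bar>"] by eventually_elim auto
  moreover have "\<forall>\<^sub>F N in sequentially. wires_in C (levels N) X"
    using Cons by (simp add: x)
  ultimately show ?case
    by eventually_elim (use Cons.prems in \<open>simp add: x\<close>)
qed simp

lemma eventually_diagram_in:
  "diagram_in C UNIV X ss Y \<Longrightarrow> \<forall>\<^sub>F N in sequentially. diagram_in C (levels N) X ss Y"
proof (induction ss arbitrary: X)
  case Nil
  then have "\<forall>\<^sub>F N in sequentially. wires_in C (levels N) X"
    using eventually_wires_in[of C X] by auto
  then show ?case
    by eventually_elim (use Nil in simp)
next
  case (Cons s ss)
  obtain u c v where s: "s = (u, c, v)"
    by (cases s)
  have "\<forall>\<^sub>F N in sequentially. wires_in C (levels N) u"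
    "\<forall>\<^sub>F N in sequentially. wires_in C (levels N) v"
    "\<forall>\<^sub>F N in sequentially. wires_in C (levels N) (cell_dom c)"
    "\<forall>\<^sub>F N in sequentially. wires_in C (levels N) (cell_cod c)"
    "\<forall>\<^sub>F N in sequentially. diagram_in C (levels N) (u @ cell_cod c @ v) ss Y"
    by (rule eventually_wires_in Cons.IH; use Cons.prems in \<open>simp add: s\<close>)+
  then show ?case
    by eventually_elim (use Cons.prems in \<open>simp add: s\<close>)
qed

text \<open>A derivation is finite, so only finitely many diagrams, and with them finitely many
  levels, occur in it.\<close>

lemma eventually_diagram_eq_in:
  assumes "diagram_eq_in C UNIV X Y ss ts"
  shows "\<forall>\<^sub>F N in sequentially. diagram_eq_in C (levels N) X Y ss ts"
  using assms
proof induction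
  case (refl ss)
  from eventually_diagram_in[OF refl] show ?case
    by eventually_elim (rule diagram_eq_in.refl)
next
  case (step l r ss u v ts)
  from eventually_diagram_in[OF step(2)] eventually_diagram_in[OF step(3)] show ?case
    by eventually_elim (rule diagram_eq_in.step[OF step(1)])
next
  case (sym ss ts)
  from sym.IH show ?case
    by eventually_elim (rule diagram_eq_in.sym)
next
  case (trans ss ts us)
  from trans.IH show ?case
    by eventually_elim (rule diagram_eq_in.trans)
qed

context strict_monoidal_category
begin

theorem faithful_F: "faithful_functor C (F C)"
  unfolding faithful_functor_def
proof (intro ballI inj_onI)
  fix A B f g assume AB: "A \<in> Obj C" "B \<in> Obj C" and f: "f \<in> hom C A B" and g: "g \<in> hom C A B"
    and eq: "MapA (F C) f = MapA (F C) g"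
  interpret evaluation C "{0}"
    by (rule evaluation_level_0) unfold_locales
  have d: "diagram_in C J (plain [A]) [([], Node [A] h [B], [])] (plain [B])"
    if "h \<in> hom C A B" "0 \<in> J" for h J
    using that AB by simp
  have "diagram_eq_in C UNIV (plain [A]) (plain [B]) [([], Node [A] f [B], [])] [([], Node [A] g [B], [])]"
    using eq f g larr_eq_iff[OF d[OF f]] by (simp add: node_def hom_iff)
  from eventually_diagram_eq_in[OF this]
  obtain N where "diagram_eq_in C (levels N) (plain [A]) (plain [B])
      [([], Node [A] f [B], [])] [([], Node [A] g [B], [])]"
    by (auto simp: eventually_sequentially)
  then have "diagram_eq_in C {0} (plain [A]) (plain [B]) [([], Node [A] f [B], [])] [([], Node [A] g [B], [])]"
    using f g by (intro level_conservative_0 d) simp_all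
  from ev_diagram_eq[OF this] show "f = g"
    using ev_slice[OF d[OF f, of "{0}"]] ev_slice[OF d[OF g, of "{0}"]] f g by (simp add: hom_iff)
qed

end

section \<open>The adjunction\<close>

lemma fun_eq_sym: "fun_eq C G H \<Longrightarrow> fun_eq C H G"
  by (auto simp: fun_eq_def)

lemma fun_eq_trans [trans]: "fun_eq C G H \<Longrightarrow> fun_eq C H K \<Longrightarrow> fun_eq C G K"
  by (auto simp: fun_eq_def)

lemma comp_fun_assoc:
  assumes "strong_monoidal_functor C D G" "strong_monoidal_functor D E H"
    "strong_monoidal_functor E B K"
  shows "fun_eq C (comp_fun B (comp_fun B K H) G) (comp_fun B K (comp_fun E H G))"
proof -
  interpret G: strong_monoidal_functor C D G by fact
  interpret H: strong_monoidal_functor D E H by fact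
  interpret K: strong_monoidal_functor E B K by fact
  show ?thesis
    by (simp add: fun_eq_def comp_fun_def K.map_comp_arr)
qed

lemma comp_fun_cong_left:
  assumes "strong_monoidal_functor C D G" "fun_eq D H H'"
  shows "fun_eq C (comp_fun E H G) (comp_fun E H' G)"
proof -
  interpret G: strong_monoidal_functor C D G by fact
  show ?thesis
    using assms(2) by (simp add: fun_eq_def comp_fun_def)
qed

lemma comp_fun_cong_right:
  assumes "fun_eq C G G'"
  shows "fun_eq C (comp_fun E H G) (comp_fun E H G')"
  using assms by (simp add: fun_eq_def comp_fun_def)

lemma comp_fun_id:
  assumes "strong_monoidal_functor C D G"
  shows "fun_eq C (comp_fun D (id_fun D) G) G" "fun_eq C (comp_fun D G (id_fun C)) G"
proof -
  interpret G: strong_monoidal_functor C D G by fact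
  show "fun_eq C (comp_fun D (id_fun D) G) G" "fun_eq C (comp_fun D G (id_fun C)) G"
    by (simp_all add: fun_eq_def comp_fun_def id_fun_def)
qed

lemma fun_eq_iso:
  assumes "strict_monoidal_category C" "strong_monoidal_functor C D G" "fun_eq C G H"
  shows "fun_iso C D G H"
proof (rule fun_iso_cong[OF assms(1) _ assms(3) fun_iso_refl[OF assms(2)]])
  show "fun_eq C G G"
    by (simp add: fun_eq_def)
qed

text \<open>By naturality of \<open>F\<close>, restricting the two functors along \<open>F C\<close>
  gives the composites of \<open>K\<close> and \<open>K'\<close> with \<open>F C'\<close>; these are
  isomorphic, and the isomorphism extends to \<open>L C\<close>.\<close>

lemma L_map_iso:
  assumes C: "strict_monoidal_category C" and K: "strong_monoidal_functor C C' K"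
    and K': "strong_monoidal_functor C C' K'" and iso: "fun_iso C C' K K'"
  shows "fun_iso (L C) (L C') (L_map C C' K) (L_map C C' K')"
proof -
  interpret C': strict_monoidal_category C'
    using K by (simp add: strong_monoidal_functor_def)
  have "fun_iso C (L C') (comp_fun (L C') (F C') K) (comp_fun (L C') (F C') K')"
    by (rule fun_iso_whisker[OF K K' C'.functor_F iso])
  then have "fun_iso C (L C') (comp_fun (L C') (L_map C C' K) (F C)) (comp_fun (L C') (L_map C C' K') (F C))"
    by (rule fun_iso_cong[OF C strong_monoidal_functor.F_natural[OF K]
          strong_monoidal_functor.F_natural[OF K']])
  then show ?thesis
    by (rule fun_iso_extend[OF C strong_monoidal_functor.functor_L_map[OF K]
          strong_monoidal_functor.functor_L_map[OF K']])
qed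

text \<open>The existence half of the universal property: \<open>G\<close> factors through
  \<open>F C\<close>, even strictly, by naturality of \<open>F\<close> and the triangle at
  \<open>D\<close>.\<close>

lemma counit_L_map_F:
  assumes D: "autonomous_category D" and G: "strong_monoidal_functor C D G"
  shows "fun_eq C (comp_fun D (comp_fun D (counit D) (L_map C D G)) (F C)) G"
proof -
  interpret G: strong_monoidal_functor C D G
    by (rule G)
  interpret D: autonomous_evaluation D
    by (rule autonomous_evaluation[OF D])
  note e = D.functor_counit and LG = G.functor_L_map
  have "fun_eq C (comp_fun D (comp_fun D (counit D) (L_map C D G)) (F C))
      (comp_fun D (counit D) (comp_fun (L D) (L_map C D G) (F C)))"
    by (rule comp_fun_assoc[OF G.C.functor_F LG e])
  also have "fun_eq C \<dots> (comp_fun D (counit D) (comp_fun (L D) (F D) G))"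
    by (rule comp_fun_cong_right[OF fun_eq_sym[OF G.F_natural]])
  also have "fun_eq C \<dots> (comp_fun D (comp_fun D (counit D) (F D)) G)"
    by (rule fun_eq_sym[OF comp_fun_assoc[OF G G.D.functor_F e]])
  also have "fun_eq C \<dots> (comp_fun D (id_fun D) G)"
    by (rule comp_fun_cong_left[OF G D.counit_F])
  also have "fun_eq C \<dots> G"
    by (rule comp_fun_id(1)[OF G])
  finally show ?thesis .
qed

text \<open>Both remaining laws compare functors out of a free autonomous category, hence may be checked on
  their restrictions along the embedding.\<close>

lemma counit_natural:
  assumes D: "autonomous_category D" and D': "autonomous_category D'"
    and G: "strong_monoidal_functor D D' G"
  shows "fun_iso (L D) D' (comp_fun D' G (counit D)) (comp_fun D' (counit D') (L_map D D' G))"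
proof -
  interpret D: autonomous_evaluation D
    by (rule autonomous_evaluation[OF D])
  interpret D': autonomous_evaluation D'
    by (rule autonomous_evaluation[OF D'])
  interpret G: strong_monoidal_functor D D' G
    by (rule G)
  have cat: "strict_monoidal_category D"
    by unfold_locales
  note F = D.functor_F and e = D.functor_counit
  note l = functor_comp[OF e G]
    and r = functor_comp[OF G.functor_L_map D'.functor_counit]
  have "fun_eq D (comp_fun D' (comp_fun D' G (counit D)) (F D)) (comp_fun D' G (comp_fun D (counit D) (F D)))"
    by (rule comp_fun_assoc[OF F e G])
  also have "fun_eq D \<dots> (comp_fun D' G (id_fun D))"
    by (rule comp_fun_cong_right[OF D.counit_F])
  also have "fun_eq D \<dots> G"
    by (rule comp_fun_id(2)[OF G])
  also have "fun_eq D G (comp_fun D' (comp_fun D' (counit D') (L_map D D' G)) (F D))"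
    by (rule fun_eq_sym[OF counit_L_map_F[OF D' G]])
  finally have "fun_iso D D' (comp_fun D' (comp_fun D' G (counit D)) (F D))
      (comp_fun D' (comp_fun D' (counit D') (L_map D D' G)) (F D))"
    by (rule fun_eq_iso[OF cat functor_comp[OF F l]])
  then show ?thesis
    by (rule fun_iso_extend[OF cat l r])
qed

lemma triangle_L:
  assumes C: "strict_monoidal_category C"
  shows "fun_iso (L C) (L C) (comp_fun (L C) (counit (L C)) (L_map C (L C) (F C))) (id_fun (L C))"
proof -
  interpret C: strict_monoidal_category C
    by (rule C)
  interpret F: strong_monoidal_functor C "L C" "F C"
    by (rule C.functor_F)
  interpret LC: autonomous_evaluation "L C"
    by (rule autonomous_evaluation[OF autonomous_category_L])
  note l = functor_comp[OF F.functor_L_map LC.functor_counit]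
  \<comment> \<open>This is the factorisation of \<open>F C\<close> through itself, with
    \<open>L C\<close> in the role of the autonomous category.\<close>
  have "fun_eq C (comp_fun (L C) (comp_fun (L C) (counit (L C)) (L_map C (L C) (F C))) (F C)) (F C)"
    by (rule counit_L_map_F[OF autonomous_category_L C.functor_F])
  also have "fun_eq C (F C) (comp_fun (L C) (id_fun (L C)) (F C))"
    by (rule fun_eq_sym[OF comp_fun_id(1)[OF C.functor_F]])
  finally have "fun_iso C (L C)
      (comp_fun (L C) (comp_fun (L C) (counit (L C)) (L_map C (L C) (F C))) (F C))
      (comp_fun (L C) (id_fun (L C)) (F C))"
    by (rule fun_eq_iso[OF C functor_comp[OF C.functor_F l]])
  then show ?thesis
    by (rule fun_iso_extend[OF C l L.functor_id])
qed

theorem theorem1: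
  fixes C :: "('o, 'm) moncat" and C' :: "('o1, 'm1) moncat" and C'' :: "('o2, 'm2) moncat"
    and D :: "('p, 'n) moncat" and D' :: "('p1, 'n1) moncat"
  assumes C: "strict_monoidal_category C"
    and C': "strict_monoidal_category C'"
    and C'': "strict_monoidal_category C''"
    and D: "autonomous_category D"
    and D': "autonomous_category D'"
  shows
    \<comment> \<open>the embedding\<close>
    "autonomous_category (L C) \<and>
     strong_monoidal_functor C (L C) (F C) \<and>
     faithful_functor C (F C) \<and>
     \<comment> \<open>\<open>L\<close> is a functor, compatible with isomorphism of monoidal functors\<close>
     (\<forall>K. strong_monoidal_functor C C' K \<longrightarrow>
        strong_monoidal_functor (L C) (L C') (L_map C C' K)) \<and>
     fun_eq (L C) (L_map C C (id_fun C)) (id_fun (L C)) \<and>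
     (\<forall>K K'. strong_monoidal_functor C C' K \<and> strong_monoidal_functor C' C'' K' \<longrightarrow>
        fun_eq (L C) (L_map C C'' (comp_fun C'' K' K))
          (comp_fun (L C'') (L_map C' C'' K') (L_map C C' K))) \<and>
     (\<forall>K K'. strong_monoidal_functor C C' K \<and> strong_monoidal_functor C C' K' \<and>
        fun_iso C C' K K' \<longrightarrow> fun_iso (L C) (L C') (L_map C C' K) (L_map C C' K')) \<and>
     \<comment> \<open>the unit \<open>F\<close> is natural\<close>
     (\<forall>K. strong_monoidal_functor C C' K \<longrightarrow>
        fun_eq C (comp_fun (L C') (F C') K) (comp_fun (L C') (L_map C C' K) (F C))) \<and>
     \<comment> \<open>the counit\<close>
     strong_monoidal_functor (L D) D (counit D) \<and>
     (\<forall>G. strong_monoidal_functor D D' G \<longrightarrow>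
        fun_iso (L D) D' (comp_fun D' G (counit D)) (comp_fun D' (counit D') (L_map D D' G))) \<and>
     \<comment> \<open>the triangle equations\<close>
     fun_eq D (comp_fun D (counit D) (F D)) (id_fun D) \<and>
     fun_iso (L C) (L C) (comp_fun (L C) (counit (L C)) (L_map C (L C) (F C))) (id_fun (L C))"
proof (intro conjI allI impI; (elim conjE)?)
  show "autonomous_category (L C)"
    by (rule autonomous_category_L)
  show "strong_monoidal_functor C (L C) (F C)"
    by (rule strict_monoidal_category.functor_F[OF C])
  show "faithful_functor C (F C)"
    by (rule strict_monoidal_category.faithful_F[OF C])
  show "fun_eq (L C) (L_map C C (id_fun C)) (id_fun (L C))"
    by (rule strict_monoidal_category.L_map_id[OF C])
  show "strong_monoidal_functor (L D) D (counit D)"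
    by (rule autonomous_evaluation.functor_counit[OF autonomous_evaluation[OF D]])
  show "fun_eq D (comp_fun D (counit D) (F D)) (id_fun D)"
    by (rule autonomous_evaluation.counit_F[OF autonomous_evaluation[OF D]])
  show "fun_iso (L C) (L C) (comp_fun (L C) (counit (L C)) (L_map C (L C) (F C))) (id_fun (L C))"
    by (rule triangle_L[OF C])
next
  fix K assume K: "strong_monoidal_functor C C' K"
  show "strong_monoidal_functor (L C) (L C') (L_map C C' K)"
    by (rule strong_monoidal_functor.functor_L_map[OF K])
  show "fun_eq C (comp_fun (L C') (F C') K) (comp_fun (L C') (L_map C C' K) (F C))"
    by (rule strong_monoidal_functor.F_natural[OF K])
next
  fix K K' assume "strong_monoidal_functor C C' K" "strong_monoidal_functor C' C'' K'"
  then show "fun_eq (L C) (L_map C C'' (comp_fun C'' K' K))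
      (comp_fun (L C'') (L_map C' C'' K') (L_map C C' K))"
    by (rule L_map_comp)
next
  fix K K' assume "strong_monoidal_functor C C' K" "strong_monoidal_functor C C' K'" "fun_iso C C' K K'"
  then show "fun_iso (L C) (L C') (L_map C C' K) (L_map C C' K')"
    by (rule L_map_iso[OF C])
next
  fix G assume "strong_monoidal_functor D D' G"
  then show "fun_iso (L D) D' (comp_fun D' G (counit D)) (comp_fun D' (counit D') (L_map D D' G))"
    by (rule counit_natural[OF D D'])
qed

end
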